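(* Consider the model described in the context, with minimum path loss $L^{(0)}$, multi-user interference $\mathcal{I}_{MU}$ and power gain $g^{(0)}$, and let $$R=B_c\log_2\left(1+\frac{Pg^{(0)}/L^{(0)}}{P\,\mathcal{I}_{MU}+\sigma_n^2+\sigma_c^2/(1-\rho)}\right),\qquad Q=\rho\,\xi P\left(\frac{g^{(0)}}{L^{(0)}}+\mathcal{I}_{MU}\right).$$ For $R^*\ge0$ and $Q^*\ge0$ put $\sigma_*^2=\sigma_n^2+\sigma_c^2(1-\rho)^{-1}$, $q_*=Q^*/(\rho\xi)$, $\gamma=1/(2^{R^*/B_c}-1)$ and $\mathcal{T}_*=(q_*+\sigma_*^2)/(\gamma+1)$. With $\Lambda_N$ and $\Phi_N$ as given in the context, define $$\Phi(\omega;L^{(0)})=\prod_{N=0}^{\infty}\Phi_N(\omega;L^{(0)}),\qquad \Lambda([0,\alpha))=\sum_{N=0}^{\infty}\Lambda_N([0,\alpha)),$$ and let $\widehat\Lambda([0,\alpha))$ be the derivative of $\Lambda([0,\alpha))$ with respect to $\alpha$. Given the statistical characterisation of $L^{(0)}$, $\mathcal{I}_{MU}$ and $g^{(0)}$ stated in the context, the joint complementary cumulative distribution function $F_c(R^*,Q^* )=\Pr\{R\ge R^*,\,Q\ge Q^*\}$ can be computed as $$F_c(R^*,Q^* )=\mathcal{K}_{m,n}\sum_{s=1}^{m}\;\sum_{t=n-m}^{(n+m-2s)s}a_{s,t}\left(J^{(1)}_{s,t}-J^{(2)}_{s,t}\right),$$ where $$J^{(1)}_{s,t}=\int_0^\infty\!\!\int_0^\infty\frac{1}{\pi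 w}\,\mathrm{Im}\left\{\exp\left(-jw\frac{q_*}{P}\right)\left(s-\frac{jw}{y}\right)^{-(1+t)}\Gamma\left(1+t,\frac{\mathcal{T}_*}{P}(sy-jw)\right)\Phi(w;y)\right\}\widehat\Lambda([0,y))\exp\{-\Lambda([0,y))\}\,dw\,dy,$$ $$J^{(2)}_{s,t}=\int_0^\infty\!\!\int_0^\infty\frac{1}{\pi w}\,\mathrm{Im}\left\{\exp\left(jw\frac{\sigma_*^2}{P}\right)\left(s+\frac{jw\gamma}{y}\right)^{-(1+t)}\Gamma\left(1+t,\frac{\mathcal{T}_*}{P}(sy+jw\gamma)\right)\Phi(w;y)\right\}\widehat\Lambda([0,y))\exp\{-\Lambda([0,y))\}\,dw\,dy.$$
   Context: Parameters: signal bandwidth $B_c$, average transmit power $P$, power splitting ratio $\rho$ with $0\le\rho\le1$, energy harvesting efficiency $\xi$, noise variances $\sigma_n^2$ and $\sigma_c^2$, numbers of transmit and receive antennas $n_t,n_r$, path-loss exponent $\beta$, path-loss constant $\kappa$, penetration loss $K\in[0,1)$, radius $R_D$, transmitter density $\lambda_{PH}$, wall frequency $\lambda_w$. Model. Transmitters ("power heads") are located in a circular region of radius $R_D$ centred at the origin of $\mathbb{R}^2$; the receiver is at the origin and $r^{(n)}$ is the distance of the transmitter $n$ from it. The transmitters whose signal crosses $N$ walls form a Poisson point process $\Psi_N$; the $\Psi_N$ are assumed independent. In polar coordinates $(r,\theta)$, $\Psi_N$ has density with respect to $r\,dr\,d\theta$ equal to $$\lambda_{PH}\,\frac{(\lambda_w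 r|\cos\theta|+\lambda_w r|\sin\theta|)^N}{N!}\exp\{-(\lambda_w r|\cos\theta|+\lambda_w r|\sin\theta|)\}.$$ $N_{max}$ is the maximum number of walls that can be encountered in the circular region. Let $l_N(r)=\kappa r^\beta/K^N$, $L^{(0)}=\min_N\{\min_{n\in\Psi_N}\{l_N(r^{(n)})\}\}$, and $$\mathcal{I}_{MU}=\sum_{N=0}^{N_{max}}\sum_{n\in\Psi_N}\frac{h^{(n)}}{l_N(r^{(n)})}\,\mathbb{1}\{l_N(r^{(n)})>L^{(0)}\},$$ where the $h^{(n)}$ are exponentially distributed random variables with unit variance. The $h^{(n)}$, the power gain $g^{(0)}$ of the serving link (Rayleigh fading with maximum ratio transmission and maximum ratio combining) and the $\Psi_N$ are independent. Functions. For $\eta\ge0$, $$\chi_\eta(\lambda_w)=\lambda_w^\eta\left[\frac{2^{\frac{\eta}{2}}\sqrt{\pi}\,\Gamma\left(\frac{\eta+1}{2}\right)}{\Gamma\left(\frac{\eta+2}{2}\right)}-\frac{\sqrt{2}\;{}_2F_1\left(\frac12,\frac{\eta+1}{2};\frac{\eta+3}{2};\frac12\right)}{\eta+1}\right].$$ With sums over integers $\eta$, $$\Lambda_N([0,\alpha))=\frac{4\lambda_{PH}}{N!}\sum_{\eta=N}^{\infty}\frac{(-1)^{\eta-N}\chi_\eta(\lambda_w)}{(\eta-N)!\,(\eta+2)}\left(\frac{\alpha K^N}{\kappa}\right)^{\frac{\eta+2}{\beta}}\ \text{ if }\alpha<\frac{R_D^\beta\kappa}{K^N},$$ and $\Lambda_N([0,\alpha))=\frac{4\lambda_{PH}}{N!}\sum_{\eta=N}^{\infty}\frac{(-1)^{\eta-N}\chi_\eta(\lambda_w)}{(\eta-N)!\,(\eta+2)}R_D^{\eta+2}$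 if $\alpha\ge R_D^\beta\kappa/K^N$. The derivative of $\Lambda_N([0,\alpha))$ with respect to $\alpha$ is $$\widehat\Lambda_N([0,\alpha))=\frac{4\lambda_{PH}}{N!}\frac{K^N}{\kappa\beta}\sum_{\eta=N}^{\infty}\frac{(-1)^{\eta-N}\chi_\eta(\lambda_w)}{(\eta-N)!}\left(\frac{\alpha K^N}{\kappa}\right)^{\frac{\eta+2}{\beta}-1}\ \text{ if }\alpha<\frac{R_D^\beta\kappa}{K^N},$$ and $0$ if $\alpha\ge R_D^\beta\kappa/K^N$. Further, $$\Delta_{\eta,N}(\omega;y)=\left(\frac{yK^N}{\kappa}\right)^{\frac{\eta+2}{\beta}}\left(1-{}_2F_1\left(1,-\tfrac{\eta+2}{\beta};1-\tfrac{\eta+2}{\beta};\tfrac{j\omega}{y}\right)\right)-R_D^{\eta+2}\left(1-{}_2F_1\left(1,-\tfrac{\eta+2}{\beta};1-\tfrac{\eta+2}{\beta};\tfrac{j\omega K^N}{R_D^\beta\kappa}\right)\right),$$ $$\Phi_N(\omega;y)=\exp\left\{\frac{4\lambda_{PH}}{N!}\sum_{\eta=N}^{\infty}\frac{(-1)^{\eta-N}\chi_\eta(\lambda_w)}{(\eta-N)!\,(\eta+2)}\Delta_{\eta,N}(\omega;y)\right\}\ \text{ if } y<\frac{R_D^\beta\kappa}{K^N},$$ and $\Phi_N(\omega;y)=1$ if $y\ge R_D^\beta\kappa/K^N$. Statistical characterisation. The CDF of $L^{(0)}$ is $\Pr\{L^{(0)}\le\alpha\}=1-\prod_{N=0}^{N_{max}}\exp\{-\Lambda_N([0,\alpha))\}$.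 The CDF of $\mathcal{I}_{MU}$ given $L^{(0)}$ is $$F_{\mathcal{I}_{MU}}(z;L^{(0)})=\frac12-\int_0^\infty\frac{1}{\pi\omega}\,\mathrm{Im}\left\{e^{-j\omega z}\Phi(\omega;L^{(0)})\right\}d\omega .$$ With $m=\min(n_t,n_r)$, $n=\max(n_t,n_r)$ and $\mathcal{K}_{m,n}=\prod_{k=1}^m((m-k)!\,(n-k)!)^{-1}$, the probability density function of $g^{(0)}$ is $$f_{g^{(0)}}(\zeta)=\mathcal{K}_{m,n}\sum_{s=1}^{m}\sum_{t=n-m}^{(n+m-2s)s}a_{s,t}\,\zeta^t e^{-s\zeta},$$ where the $a_{s,t}$ are the (known, algorithmically computable) coefficients of this representation. Notation: $j=\sqrt{-1}$; $\mathbb{1}\{\cdot\}$ is the indicator function; $\Gamma(\cdot)$ is the Gamma function and $\Gamma(\cdot,\cdot)$ the upper incomplete Gamma function; ${}_2F_1$ is the Gaussian hypergeometric function.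
   Formalization: For R*=0 (γ undefined) the formula is a limit γ→∞ and the event also requires L⁽⁰⁾<∞; Λ and Φ stop at N_max when it is finite; 0<ρ<1 and σ_n²+σ_c²>0; where (η+2)/β is an integer, Δ is its limit in β; the CDF of I_MU is assumed only for z≠0. *)

theory Defs
  imports "HOL-Probability.Probability"
begin

subsection \<open>Special functions\<close>

text \<open>The Gaussian hypergeometric function on the plane cut along $[1,\infty)$: the
  hypergeometric series in the unit disc, continued analytically outside of it.\<close>

definition hyp2F1 :: "complex \<Rightarrow> complex \<Rightarrow> complex \<Rightarrow> complex \<Rightarrow> complex" where
  "hyp2F1 a b c z =
     (let S = eval_fps (fps_hypergeo [a, b] [c] 1) in
      if norm z < 1 then S z
      else (THE v. \<exists>f. f holomorphic_on (- complex_of_real ` {1..}) \<and>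
                       (\<forall>u. norm u < 1 \<longrightarrow> f u = S u) \<and> v = f z))"

text \<open>The integral of $u^{a-1} e^{-u}$ from $z$ to $\infty$, taken along the horizontal ray
  starting at $z$; this ray avoids the branch cut unless $z$ is a negative real.\<close>

definition Gamma_upper :: "complex \<Rightarrow> complex \<Rightarrow> complex" where
  "Gamma_upper a z =
     integral {0<..} (\<lambda>x::real. (z + of_real x) powr (a - 1) * exp (- (z + of_real x)))"


subsection \<open>The network\<close>

text \<open>\<open>var_n\<close> and \<open>var_c\<close> are the noise variances, i.e. already squared. The value
  \<open>N_max = \<infinity>\<close> means that there is no a priori bound on the number of walls.\<close>

record network =
  B_c :: real
  tx_power :: real
  rho :: real
  xi :: real
  var_n :: real
  var_c :: real
  n_t :: nat
  n_r :: nat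
  path_exp :: real
  kappa :: real
  pen_loss :: real
  R_D :: real
  lam_PH :: real
  lam_w :: real
  N_max :: enat

definition valid_network :: "network \<Rightarrow> bool" where
  "valid_network S \<longleftrightarrow>
     0 < B_c S \<and> 0 < tx_power S \<and> 0 < rho S \<and> rho S < 1 \<and> 0 < xi S \<and>
     0 \<le> var_n S \<and> 0 \<le> var_c S \<and> 0 < var_n S + var_c S \<and>
     1 \<le> n_t S \<and> 1 \<le> n_r S \<and> 0 < path_exp S \<and> 0 < kappa S \<and>
     0 \<le> pen_loss S \<and> pen_loss S < 1 \<and> 0 < R_D S \<and> 0 \<le> lam_PH S \<and> 0 \<le> lam_w S"

text \<open>A Poisson point process with finite mean measure \<open>\<mu>\<close>, given by the number \<open>C\<close> of its
  points and an enumeration \<open>X 0, \<dots>, X (C - 1)\<close> of them.\<close>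

definition point_count ::
    "('w \<Rightarrow> nat) \<Rightarrow> (nat \<Rightarrow> 'w \<Rightarrow> 'a) \<Rightarrow> 'a set \<Rightarrow> 'w \<Rightarrow> nat" where
  "point_count C X A \<omega> = card {i. i < C \<omega> \<and> X i \<omega> \<in> A}"

definition poisson_process ::
    "'w measure \<Rightarrow> 'a measure \<Rightarrow> ('w \<Rightarrow> nat) \<Rightarrow> (nat \<Rightarrow> 'w \<Rightarrow> 'a) \<Rightarrow> bool" where
  "poisson_process M \<mu> C X \<longleftrightarrow>
     C \<in> measurable M (count_space UNIV) \<and> (\<forall>i. X i \<in> measurable M \<mu>) \<and>
     (\<forall>A\<in>sets \<mu>. \<forall>k. measure M {\<omega> \<in> space M. point_count C X A \<omega> = k} =
        measure \<mu> A ^ k / fact k * exp (- measure \<mu> A)) \<and>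
     (\<forall>\<A>. finite \<A> \<and> \<A> \<subseteq> sets \<mu> \<and> disjoint \<A> \<longrightarrow>
        prob_space.indep_vars M (\<lambda>_. count_space UNIV) (point_count C X) \<A>)"

text \<open>The plane is identified with the complex numbers, so that Lebesgue measure is
  $r\,dr\,d\theta$ with $r = |z|$ and $\theta = \arg z$.\<close>

definition wall_mean :: "network \<Rightarrow> complex \<Rightarrow> real" where
  "wall_mean S z =
     lam_w S * cmod z * \<bar>cos (Arg z)\<bar> + lam_w S * cmod z * \<bar>sin (Arg z)\<bar>"

definition tx_measure :: "network \<Rightarrow> nat \<Rightarrow> complex measure" where
  "tx_measure S N = density lborel (\<lambda>z. indicator (cball 0 (R_D S)) z *
     ennreal (lam_PH S * wall_mean S z ^ N / fact N * exp (- wall_mean S z)))"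

text \<open>A transmitter is labelled by a pair \<open>(N, i)\<close>: it is the \<open>i\<close>-th point of $\Psi_N$, has
  position \<open>X N i\<close> and fading coefficient \<open>h N i\<close>. The sources of randomness are the whole
  processes, the individual fading coefficients and the gain of the serving link.\<close>

datatype source = Process nat | Fading nat nat | Serving

definition sources :: "network \<Rightarrow> source set" where
  "sources S = {Process N | N. enat N \<le> N_max S} \<union>
     {Fading N i | N i. enat N \<le> N_max S} \<union> {Serving}"

definition source_events ::
    "'w measure \<Rightarrow> (nat \<Rightarrow> 'w \<Rightarrow> nat) \<Rightarrow> (nat \<Rightarrow> nat \<Rightarrow> 'w \<Rightarrow> complex) \<Rightarrow>
     (nat \<Rightarrow> nat \<Rightarrow> 'w \<Rightarrow> real) \<Rightarrow> ('w \<Rightarrow> real) \<Rightarrow> source \<Rightarrow> 'w set set" where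
  "source_events M C X h g src = (case src of
       Process N \<Rightarrow> {(\<lambda>\<omega>. (C N \<omega>, \<lambda>i. X N i \<omega>)) -` A \<inter> space M | A.
                        A \<in> sets (count_space UNIV \<Otimes>\<^sub>M PiM UNIV (\<lambda>_. borel))}
     | Fading N i \<Rightarrow> {h N i -` A \<inter> space M | A. A \<in> sets borel}
     | Serving \<Rightarrow> {g -` A \<inter> space M | A. A \<in> sets borel})"

text \<open>The exponential distribution of unit variance is the one with rate 1.\<close>

definition network_model ::
    "network \<Rightarrow> 'w measure \<Rightarrow> (nat \<Rightarrow> 'w \<Rightarrow> nat) \<Rightarrow> (nat \<Rightarrow> nat \<Rightarrow> 'w \<Rightarrow> complex) \<Rightarrow>
     (nat \<Rightarrow> nat \<Rightarrow> 'w \<Rightarrow> real) \<Rightarrow> ('w \<Rightarrow> real) \<Rightarrow> bool" where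
  "network_model S M C X h g \<longleftrightarrow>
     valid_network S \<and> prob_space M \<and>
     (\<forall>N. enat N \<le> N_max S \<longrightarrow> poisson_process M (tx_measure S N) (C N) (X N)) \<and>
     (\<forall>N i. enat N \<le> N_max S \<longrightarrow> distributed M lborel (h N i) (exponential_density 1)) \<and>
     g \<in> borel_measurable M \<and>
     prob_space.indep_sets M (source_events M C X h g) (sources S)"

text \<open>For \<open>pen_loss S = 0\<close> and \<open>N \<ge> 1\<close> the path loss is infinite. The minimum path loss is
  infinite if there is no transmitter.\<close>

definition path_loss :: "network \<Rightarrow> nat \<Rightarrow> real \<Rightarrow> ennreal" where
  "path_loss S N r = ennreal (kappa S * r powr path_exp S) / ennreal (pen_loss S ^ N)"

definition L0 ::
    "network \<Rightarrow> (nat \<Rightarrow> 'w \<Rightarrow> nat) \<Rightarrow> (nat \<Rightarrow> nat \<Rightarrow> 'w \<Rightarrow> complex) \<Rightarrow> 'w \<Rightarrow> ennreal" where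
  "L0 S C X \<omega> = (INF N\<in>{N. enat N \<le> N_max S}. INF i\<in>{..<C N \<omega>}. path_loss S N (cmod (X N i \<omega>)))"

text \<open>Almost surely there are only finitely many transmitters, so the outer series has almost
  surely only finitely many nonzero terms.\<close>

definition I_MU ::
    "network \<Rightarrow> (nat \<Rightarrow> 'w \<Rightarrow> nat) \<Rightarrow> (nat \<Rightarrow> nat \<Rightarrow> 'w \<Rightarrow> complex) \<Rightarrow>
     (nat \<Rightarrow> nat \<Rightarrow> 'w \<Rightarrow> real) \<Rightarrow> 'w \<Rightarrow> real" where
  "I_MU S C X h \<omega> =
     (\<Sum>N. if enat N \<le> N_max S
          then \<Sum>i<C N \<omega>. (let l = path_loss S N (cmod (X N i \<omega>)) in
                 if L0 S C X \<omega> < l then h N i \<omega> * enn2real (1 / l) else 0)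
          else 0)"

definition rx_gain ::
    "network \<Rightarrow> (nat \<Rightarrow> 'w \<Rightarrow> nat) \<Rightarrow> (nat \<Rightarrow> nat \<Rightarrow> 'w \<Rightarrow> complex) \<Rightarrow>
     ('w \<Rightarrow> real) \<Rightarrow> 'w \<Rightarrow> real" where
  "rx_gain S C X g \<omega> = g \<omega> * enn2real (1 / L0 S C X \<omega>)"

definition rate ::
    "network \<Rightarrow> (nat \<Rightarrow> 'w \<Rightarrow> nat) \<Rightarrow> (nat \<Rightarrow> nat \<Rightarrow> 'w \<Rightarrow> complex) \<Rightarrow>
     (nat \<Rightarrow> nat \<Rightarrow> 'w \<Rightarrow> real) \<Rightarrow> ('w \<Rightarrow> real) \<Rightarrow> 'w \<Rightarrow> real" where
  "rate S C X h g \<omega> = B_c S * log 2 (1 + tx_power S * rx_gain S C X g \<omega> /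
     (tx_power S * I_MU S C X h \<omega> + var_n S + var_c S / (1 - rho S)))"

definition harvested ::
    "network \<Rightarrow> (nat \<Rightarrow> 'w \<Rightarrow> nat) \<Rightarrow> (nat \<Rightarrow> nat \<Rightarrow> 'w \<Rightarrow> complex) \<Rightarrow>
     (nat \<Rightarrow> nat \<Rightarrow> 'w \<Rightarrow> real) \<Rightarrow> ('w \<Rightarrow> real) \<Rightarrow> 'w \<Rightarrow> real" where
  "harvested S C X h g \<omega> =
     rho S * xi S * tx_power S * (rx_gain S C X g \<omega> + I_MU S C X h \<omega>)"


subsection \<open>Distribution of the minimum path loss\<close>

text \<open>The value at \<open>1/2\<close> of the hypergeometric function below is real. Only integer
  \<open>\<eta>\<close> occur; with the natural power, \<open>chi 0 0\<close> gets the factor $0^0 = 1$.\<close>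

definition chi :: "nat \<Rightarrow> real \<Rightarrow> real" where
  "chi \<eta> l = l ^ \<eta> *
     (2 powr (\<eta> / 2) * sqrt pi * Gamma ((\<eta> + 1) / 2) / Gamma ((\<eta> + 2) / 2)
      - sqrt 2 * Re (hyp2F1 (1/2) (of_real ((\<eta> + 1) / 2)) (of_real ((\<eta> + 3) / 2)) (1/2)) / (\<eta> + 1))"

text \<open>The condition \<open>below_edge S N \<alpha>\<close> is $\alpha < R_D^\beta \kappa / K^N$, in a form that is
  also correct for $K^N = 0$, where the bound is infinite. Series over \<open>\<eta> \<ge> N\<close> are indexed by
  \<open>k = \<eta> - N\<close>.\<close>

definition below_edge :: "network \<Rightarrow> nat \<Rightarrow> real \<Rightarrow> bool" where
  "below_edge S N \<alpha> \<longleftrightarrow> \<alpha> * pen_loss S ^ N < R_D S powr path_exp S * kappa S"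

definition Lam_N :: "network \<Rightarrow> nat \<Rightarrow> real \<Rightarrow> real" where
  "Lam_N S N \<alpha> = 4 * lam_PH S / fact N *
     (\<Sum>k. let \<eta> = N + k in
        (-1) ^ k * chi \<eta> (lam_w S) / (fact k * (real \<eta> + 2)) *
        (if below_edge S N \<alpha>
         then (\<alpha> * pen_loss S ^ N / kappa S) powr ((real \<eta> + 2) / path_exp S)
         else R_D S ^ (\<eta> + 2)))"

text \<open>There are no transmitters behind more than \<open>N_max S\<close> walls.\<close>

definition Lam :: "network \<Rightarrow> real \<Rightarrow> real" where
  "Lam S \<alpha> = (\<Sum>N. if enat N \<le> N_max S then Lam_N S N \<alpha> else 0)"


subsection \<open>The function \<open>\<Phi>\<close>\<close>

text \<open>The path-loss exponent \<open>b\<close> is a separate argument here because the formula is undefined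
  (its third hypergeometric parameter is a pole) if $(\eta+2)/b$ is an integer. These values of
  \<open>b\<close> are isolated and the singularity of the difference is removable.\<close>

definition Delta_formula :: "network \<Rightarrow> real \<Rightarrow> nat \<Rightarrow> nat \<Rightarrow> real \<Rightarrow> real \<Rightarrow> complex" where
  "Delta_formula S b \<eta> N w y =
     (let \<delta> = (real \<eta> + 2) / b;
          F = hyp2F1 1 (- of_real \<delta>) (1 - of_real \<delta>) in
      of_real ((y * pen_loss S ^ N / kappa S) powr \<delta>) * (1 - F (\<i> * of_real (w / y)))
      - of_real (R_D S ^ (\<eta> + 2)) *
        (1 - F (\<i> * of_real (w * pen_loss S ^ N / (R_D S powr b * kappa S)))))"

definition Delta :: "network \<Rightarrow> nat \<Rightarrow> nat \<Rightarrow> real \<Rightarrow> real \<Rightarrow> complex" where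
  "Delta S \<eta> N w y =
     (if (real \<eta> + 2) / path_exp S \<in> \<nat>
      then Lim (at (path_exp S)) (\<lambda>b. Delta_formula S b \<eta> N w y)
      else Delta_formula S (path_exp S) \<eta> N w y)"

definition Phi_N :: "network \<Rightarrow> nat \<Rightarrow> real \<Rightarrow> real \<Rightarrow> complex" where
  "Phi_N S N w y =
     (if below_edge S N y
      then exp (of_real (4 * lam_PH S / fact N) *
             (\<Sum>k. let \<eta> = N + k in
                of_real ((-1) ^ k * chi \<eta> (lam_w S) / (fact k * (real \<eta> + 2))) * Delta S \<eta> N w y))
      else 1)"

definition Phi :: "network \<Rightarrow> real \<Rightarrow> real \<Rightarrow> complex" where
  "Phi S w y = (\<Prod>N. if enat N \<le> N_max S then Phi_N S N w y else 1)"


subsection \<open>Gain of the serving link\<close>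

definition n_min :: "network \<Rightarrow> nat" where "n_min S = min (n_t S) (n_r S)"
definition n_max :: "network \<Rightarrow> nat" where "n_max S = max (n_t S) (n_r S)"

definition K_mn :: "nat \<Rightarrow> nat \<Rightarrow> real" where
  "K_mn m n = (\<Prod>k=1..m. inverse (fact (m - k) * fact (n - k)))"

definition gain_density :: "network \<Rightarrow> (nat \<Rightarrow> nat \<Rightarrow> real) \<Rightarrow> real \<Rightarrow> real" where
  "gain_density S a \<zeta> = (let m = n_min S; n = n_max S in
     K_mn m n * (\<Sum>s=1..m. \<Sum>t=n-m..(n + m - 2 * s) * s. a s t * \<zeta> ^ t * exp (- real s * \<zeta>)))"


subsection \<open>The formula for the joint complementary distribution function\<close>

definition T_star :: "real \<Rightarrow> real \<Rightarrow> real \<Rightarrow> real" where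
  "T_star \<gamma> q v = (q + v) / (\<gamma> + 1)"

text \<open>The Henstock--Kurzweil integral includes the convergent improper integrals.\<close>

definition J1 :: "network \<Rightarrow> real \<Rightarrow> real \<Rightarrow> real \<Rightarrow> nat \<Rightarrow> nat \<Rightarrow> real" where
  "J1 S \<gamma> q v s t =
     integral {0<..} (\<lambda>y. integral {0<..} (\<lambda>w.
       1 / (pi * w) *
       Im (exp (- \<i> * of_real (w * q / tx_power S)) *
           (of_real s - \<i> * of_real (w / y)) powi (- (1 + int t)) *
           Gamma_upper (1 + of_nat t)
             (of_real (T_star \<gamma> q v / tx_power S) * (of_real (s * y) - \<i> * of_real w)) *
           Phi S w y) *
       deriv (Lam S) y * exp (- Lam S y)))"

definition J2 :: "network \<Rightarrow> real \<Rightarrow> real \<Rightarrow> real \<Rightarrow> nat \<Rightarrow> nat \<Rightarrow> real" where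
  "J2 S \<gamma> q v s t =
     integral {0<..} (\<lambda>y. integral {0<..} (\<lambda>w.
       1 / (pi * w) *
       Im (exp (\<i> * of_real (w * v / tx_power S)) *
           (of_real s + \<i> * of_real (w * \<gamma> / y)) powi (- (1 + int t)) *
           Gamma_upper (1 + of_nat t)
             (of_real (T_star \<gamma> q v / tx_power S) * (of_real (s * y) + \<i> * of_real (w * \<gamma>))) *
           Phi S w y) *
       deriv (Lam S) y * exp (- Lam S y)))"

definition joint_ccdf_formula ::
    "network \<Rightarrow> (nat \<Rightarrow> nat \<Rightarrow> real) \<Rightarrow> real \<Rightarrow> real \<Rightarrow> real \<Rightarrow> real" where
  "joint_ccdf_formula S a \<gamma> q v = (let m = n_min S; n = n_max S in
     K_mn m n * (\<Sum>s=1..m. \<Sum>t=n-m..(n + m - 2 * s) * s.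
       a s t * (J1 S \<gamma> q v s t - J2 S \<gamma> q v s t)))"

end

theory Submission
  imports Defs "HOL-Complex_Analysis.Complex_Analysis"
begin

text \<open>With \<open>G = g / L0\<close> both constraints become a bound on the interference:
  \<open>R \<ge> R\<^sup>*\<close> and \<open>Q \<ge> Q\<^sup>*\<close> hold iff
  \<open>q / P - G \<le> I \<le> \<gamma> G - v / P\<close>. Since \<open>g\<close> is independent of \<open>(L0, I)\<close>, the probability is the
  integral, against the densities of \<open>g\<close> and \<open>L0\<close>, of the difference of two values of the
  conditional distribution function, that is, of two Gil-Pelaez integrals.
  The sum of the gain density and the integral over the gain are then pulled inside the integral
  over \<open>w\<close>, where they produce an incomplete Gamma function.

  The Gil-Pelaez integrals converge only conditionally, so this exchange needs control of \<open>\<Phi>\<close>. An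
  integral form of the hypergeometric terms \<open>\<Delta>\<close> shows that \<open>\<Phi> = exp U\<close> with \<open>U = O(w)\<close> near \<open>0\<close>
  and \<open>U = p + O(1 / w)\<close> near \<open>\<infinity>\<close>, with a real constant \<open>p\<close>. Hence the integrand is absolutely
  integrable up to multiples of \<open>sin (w z) / w\<close>, whose partial integrals are bounded uniformly
  in \<open>z\<close>. That \<open>\<Phi>\<close> is a characteristic function is never needed.\<close>

subsection \<open>The hypergeometric function on the slit plane\<close>

text \<open>The bounds for \<open>U\<close> are summed over all wall counts \<open>N\<close>. Near
  \<open>w = 0\<close> the factor \<open>K ^ N\<close> cancels, but at \<open>\<infinity>\<close>
  the constant in \<open>O(1 / w)\<close> contains \<open>1 / K ^ N\<close>; the factor
  \<open>c ^ N / fact N\<close> of the intensities absorbs it. The integral form of \<Delta> rests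
  on a first order differential equation for 2F1(1, -\<delta>; 1 - \<delta>; z). At the exceptional
  path-loss exponents, where \<Delta> is defined as a limit, continuity in the exponent takes over.
  Two features of the laws shape the rest. The path loss may be infinite with positive probability,
  so its density is defective and expectations are restricted to finite path loss. The conditional
  law of the interference has an atom at \<open>0\<close>, so the threshold \<open>0\<close> must be
  avoided; this costs only null sets, since for fixed path loss a threshold vanishes at one gain at
  most, and for fixed positive gain at one path loss at most. Finally, the alternating series does
  not show that the derivative of \<open>Lam\<close> is nonnegative; the sign comes from the
  monotonicity of a distribution function.\<close>

lemma fps_hypergeo_nth_geometric:
  fixes \<delta> :: real
  assumes "\<delta> \<notin> \<nat>"
  shows "fps_nth (fps_hypergeo [1, - complex_of_real \<delta>] [1 - complex_of_real \<delta>] 1) n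
           = of_real (\<delta> / (\<delta> - real n))"
proof (induction n)
  case 0
  have "\<delta> \<noteq> 0" using assms by auto
  then show ?case by simp
next
  case (Suc n)
  have "\<delta> \<noteq> real n" "\<delta> \<noteq> real (Suc n)" using assms by (metis of_nat_in_Nats)+
  then have ne: "complex_of_real \<delta> \<noteq> of_nat n" "complex_of_real \<delta> \<noteq> of_nat (Suc n)"
    by (metis of_real_eq_iff of_real_of_nat_eq)+
  have e: "1 - complex_of_real \<delta> + of_nat n = - (of_real \<delta> - of_nat (Suc n))"
    by simp
  have e2: "- complex_of_real \<delta> + of_nat n = - (of_real \<delta> - of_nat n)" by simp
  have e3: "(1::complex) + of_nat n = of_nat (Suc n)" by simp
  have "fps_nth (fps_hypergeo [1, - complex_of_real \<delta>] [1 - complex_of_real \<delta>] 1) (Suc n)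
     = 1 * (1 + of_nat n) * (- of_real \<delta> + of_nat n) / (of_nat (Suc n) * (1 - of_real \<delta> + of_nat n)) *
       of_real (\<delta> / (\<delta> - real n))"
    unfolding fps_hypergeo_rec Suc by simp
  also have "\<dots> = 1 * of_nat (Suc n) * (- (of_real \<delta> - of_nat n)) / (of_nat (Suc n) * (- (of_real \<delta> - of_nat (Suc n)))) *
       (of_real \<delta> / (of_real \<delta> - of_nat n))"
    unfolding e e2 e3 by simp
  also have "\<dots> = of_real \<delta> / (of_real \<delta> - of_nat (Suc n))"
  proof -
    have "(of_nat (Suc n) :: complex) \<noteq> 0" by (metis of_nat_neq_0)
    moreover have "complex_of_real \<delta> - of_nat n \<noteq> 0" "complex_of_real \<delta> - of_nat (Suc n) \<noteq> 0"
      using ne by simp_all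
    moreover have "1 * p * (- a) / (p * (- b)) * (d / a) = d / b"
      if "p \<noteq> 0" "a \<noteq> 0" "b \<noteq> 0" for p a b d :: complex
      using that by (simp add: field_simps)
    ultimately show ?thesis by blast
  qed
  finally show ?case by simp
qed

definition slit_plane :: "complex set" where
  "slit_plane = - complex_of_real ` {1..}"

lemma slit_plane_iff: "z \<in> slit_plane \<longleftrightarrow> Im z = 0 \<longrightarrow> Re z < 1"
proof -
  have "z \<in> complex_of_real ` {1..} \<longleftrightarrow> Im z = 0 \<and> 1 \<le> Re z"
    by (auto simp: complex_eq_iff image_iff intro!: bexI[of _ "Re z"])
  then show ?thesis by (auto simp: slit_plane_def)
qed

lemma open_slit_plane: "open slit_plane"
proof -
  have "complex_of_real ` {1..} = {z. Im z = 0} \<inter> {z. 1 \<le> Re z}"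
    by (auto simp: complex_eq_iff image_iff intro!: bexI[of _ "Re _"])
  moreover have "closed ({z. Im z = 0} \<inter> {z. 1 \<le> Re z})"
    by (intro closed_Int closed_Collect_eq closed_Collect_le continuous_intros)
  ultimately show ?thesis by (simp add: open_closed slit_plane_def)
qed

text \<open>Keeps the denominator \<open>1 - t * z\<close> in the integral for the tail of the
  series away from \<open>0\<close>. Geometrically it says that the cut plane is star-shaped about
  \<open>0\<close>.\<close>

lemma mult_of_real_ne_1_slit_plane:
  assumes "z \<in> slit_plane" "0 \<le> t" "t \<le> 1"
  shows "of_real t * z \<noteq> 1"
proof
  assume "of_real t * z = 1"
  then have "t * Re z = 1" "t * Im z = 0" by (auto simp: complex_eq_iff)
  then have "Im z = 0" "Re z < 1" "t \<noteq> 0" using assms by (auto simp: slit_plane_iff)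
  then have "t * Re z < t * 1" using assms by (intro mult_strict_left_mono) auto
  with \<open>t * Re z = 1\<close> assms show False by simp
qed

lemma connected_slit_plane: "connected slit_plane"
proof (rule starlike_imp_connected)
  have "closed_segment 0 z \<subseteq> slit_plane" if "z \<in> slit_plane" for z
  proof
    fix x assume "x \<in> closed_segment 0 z"
    then obtain t where t: "x = of_real t * z" "0 \<le> t" "t \<le> 1"
      by (auto simp: in_segment scaleR_conv_of_real)
    show "x \<in> slit_plane"
    proof (rule ccontr)
      assume "x \<notin> slit_plane"
      then have "Im x = 0" "Re x \<ge> 1" by (auto simp: slit_plane_iff)
      define r where "r = Re x"
      have "r \<ge> 1" "x = of_real r" using \<open>Im x = 0\<close> \<open>Re x \<ge> 1\<close> by (auto simp: r_def complex_eq_iff)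
      then have "of_real (t / r) * z = 1" using t by (auto simp: field_simps)
      moreover have "0 \<le> t / r" "t / r \<le> 1" using t \<open>r \<ge> 1\<close> by auto
      ultimately show False using mult_of_real_ne_1_slit_plane[OF that] by blast
    qed
  qed
  moreover have "0 \<in> slit_plane" by (simp add: slit_plane_iff)
  ultimately show "starlike slit_plane" unfolding starlike_def by blast
qed

text \<open>Leibniz rule on a ball around each point. A positive exponent \<open>e\<close> makes
  \<open>t powr e\<close> continuous up to \<open>t = 0\<close>, so that integrals of continuous
  functions over the closed interval suffice.\<close>

lemma hypergeometric_tail_integral_holomorphic:
  fixes e :: real
  assumes e: "0 < e"
  shows "(\<lambda>z. integral (cbox 0 1) (\<lambda>t. of_real (t powr e) / (1 - of_real t * z))) holomorphic_on slit_plane"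
proof -
  let ?H = "\<lambda>z. integral (cbox 0 1) (\<lambda>t. of_real (t powr e) / (1 - of_real t * z)) :: complex"
  have "\<exists>U. open U \<and> z \<in> U \<and> ?H holomorphic_on U" if z: "z \<in> slit_plane" for z
  proof -
    obtain d where d: "d > 0" "ball z d \<subseteq> slit_plane"
      by (rule openE[OF open_slit_plane z])
    have ne: "1 - of_real t * x \<noteq> 0" if "x \<in> ball z d" "t \<in> {0..1}" for x t
    proof -
      have "x \<in> slit_plane" using d that by blast
      then show ?thesis using mult_of_real_ne_1_slit_plane[of x t] that by auto
    qed
    have cp: "continuous_on {0..1::real} (\<lambda>t. of_real (t powr e) :: complex)"
      using e by (intro continuous_on_of_real continuous_on_powr' continuous_intros) auto
    have "?H holomorphic_on ball z d"
    proof (rule leibniz_rule_holomorphic[where fx = "\<lambda>x t. of_real (t powr e) * of_real t / (1 - of_real t * x)\<^sup>2"])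
      fix x t assume "x \<in> ball z d" "t \<in> cbox 0 (1::real)"
      then have "1 - of_real t * x \<noteq> 0" using ne by simp
      then show "((\<lambda>x. of_real (t powr e) / (1 - of_real t * x)) has_field_derivative
          of_real (t powr e) * of_real t / (1 - of_real t * x)\<^sup>2) (at x within ball z d)"
        by (auto intro!: derivative_eq_intros simp: power2_eq_square divide_simps)
    next
      fix x assume x: "x \<in> ball z d"
      show "(\<lambda>t. of_real (t powr e) / (1 - of_real t * x)) integrable_on cbox 0 1"
        by (rule integrable_continuous, rule continuous_on_divide)
           (use ne[OF x] cp in \<open>auto intro!: continuous_intros\<close>)
    next
      have cp2: "continuous_on (ball z d \<times> {0..1}) (\<lambda>p. of_real (snd p powr e) :: complex)"
        using e by (intro continuous_on_of_real continuous_on_powr' continuous_intros) auto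
      show "continuous_on (ball z d \<times> cbox 0 1)
         (\<lambda>(x, t). of_real (t powr e) * of_real t / (1 - of_real t * x)\<^sup>2)"
        unfolding case_prod_beta
        by (rule continuous_on_divide continuous_on_mult)+
           (use ne cp2 in \<open>auto intro!: continuous_intros\<close>)
    qed simp
    then show ?thesis using d by (intro exI[of _ "ball z d"]) auto
  qed
  then have "?H field_differentiable (at z)" if "z \<in> slit_plane" for z
    using that holomorphic_on_imp_differentiable_at by meson
  then show ?thesis
    unfolding holomorphic_on_def by (simp add: field_differentiable_at_within)
qed

text \<open>Termwise integration of the geometric series of \<open>1 / (1 - t * z)\<close>, which
  converges uniformly in \<open>t\<close> because \<open>norm z < 1\<close>.\<close>

lemma hypergeometric_tail_integral_sums:
  fixes e :: real
  assumes e: "0 < e" and z: "norm (z::complex) < 1"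
  shows "(\<lambda>j. z ^ j * of_real (1 / (e + real j + 1))) sums
           integral (cbox 0 1) (\<lambda>t. of_real (t powr e) / (1 - of_real t * z))"
proof -
  let ?f = "\<lambda>j t. z ^ j * of_real (t powr (e + real j)) :: complex"
  have fi: "(?f j has_integral z ^ j * of_real (1 / (e + real j + 1))) (cbox 0 1)" for j
  proof -
    have "((\<lambda>t. t powr (e + real j)) has_integral 1 powr (e + real j + 1) / (e + real j + 1)) {0..1}"
      using e by (intro has_integral_powr_from_0) auto
    then have "((\<lambda>t. complex_of_real (t powr (e + real j))) has_integral of_real (1 / (e + real j + 1))) {0..1}"
      by (intro has_integral_of_real) simp
    then show ?thesis by (simp add: has_integral_mult_right del: of_real_divide)
  qed
  have ul: "uniform_limit (cbox 0 1) (\<lambda>n t. \<Sum>j<n. ?f j t)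
          (\<lambda>t. \<Sum>j. ?f j t) sequentially"
  proof (rule Weierstrass_m_test)
    show "summable (\<lambda>j. norm z ^ j)" using z by simp
    fix n t assume t: "t \<in> cbox (0::real) 1"
    have "t powr (e + real n) \<le> 1 powr (e + real n)" using t e by (intro powr_mono2) auto
    then have "norm z ^ n * t powr (e + real n) \<le> norm z ^ n * 1" by (intro mult_left_mono) auto
    then show "norm (?f n t) \<le> norm z ^ n" by (simp add: norm_mult norm_power)
  qed
  have lim: "(\<Sum>j. ?f j t) = of_real (t powr e) / (1 - of_real t * z)" if t: "t \<in> cbox 0 1" for t
  proof -
    have nz: "norm (of_real t * z) < 1"
    proof -
      have "\<bar>t\<bar> * norm z \<le> 1 * norm z" using t by (intro mult_right_mono) auto
      then show ?thesis using z by (simp add: norm_mult)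
    qed
    have eq: "?f j t = of_real (t powr e) * (of_real t * z) ^ j" for j
    proof (cases "t = 0")
      case True then show ?thesis using e by (cases j) auto
    next
      case False
      then have "t powr (e + real j) = t powr e * t ^ j" using t by (simp add: powr_add powr_realpow)
      then show ?thesis by (simp add: power_mult_distrib)
    qed
    have "(\<lambda>j. of_real (t powr e) * (of_real t * z) ^ j) sums (of_real (t powr e) * (1 / (1 - of_real t * z)))"
      by (intro sums_mult geometric_sums nz)
    then show ?thesis unfolding eq by (simp add: sums_iff)
  qed
  obtain I J where IJ: "\<And>n. ((\<lambda>t. \<Sum>j<n. ?f j t) has_integral I n) (cbox 0 1)"
     "((\<lambda>t. \<Sum>j. ?f j t) has_integral J) (cbox 0 1)" "(I \<longlongrightarrow> J) sequentially"
  proof (rule uniform_limit_integral_cbox[OF ul])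
    show "continuous_on (cbox 0 1) (\<lambda>t. \<Sum>j<n. ?f j t)" for n
      using e by (intro continuous_intros continuous_on_of_real continuous_on_powr') auto
  qed auto
  have I: "I n = (\<Sum>j<n. z ^ j * of_real (1 / (e + real j + 1)))" for n
    by (rule has_integral_unique[OF IJ(1)]) (intro has_integral_sum finite_lessThan fi)
  have "J = integral (cbox 0 1) (\<lambda>t. \<Sum>j. ?f j t)" using IJ(2) by (simp add: integral_unique)
  also have "\<dots> = integral (cbox 0 1) (\<lambda>t. of_real (t powr e) / (1 - of_real t * z))"
    by (rule integral_cong) (use lim in auto)
  finally have "J = \<dots>" .
  then show ?thesis using IJ(3) unfolding sums_def I by simp
qed

lemma unit_ball_subset_slit_plane: "ball 0 1 \<subseteq> slit_plane"
proof
  fix x :: complex assume "x \<in> ball 0 1"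
  then have "Re x < 1" using abs_Re_le_cmod[of x] by simp
  then show "x \<in> slit_plane" by (simp add: slit_plane_iff)
qed

context
  fixes \<delta> :: real
  assumes \<delta>: "\<delta> \<notin> \<nat>" and pos: "0 < \<delta>"
begin

text \<open>The tail of the series is summed with \<open>1 / (n - \<delta>) = \<integral>\<^sub>0\<^sup>1 t\<^sup>n\<^sup>-\<^sup>\<delta>\<^sup>-\<^sup>1 dt\<close>,
  valid for \<open>n > \<delta>\<close>.\<close>

lemma hypergeometric_continuation:
  obtains f where "f holomorphic_on slit_plane"
    "\<And>z. norm z < 1 \<Longrightarrow> (\<lambda>n. of_real (\<delta> / (\<delta> - real n)) * z ^ n) sums f z"
proof -
  \<comment> \<open>The terms up to \<open>n = m\<close> stay a polynomial. The tail starts at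
    \<open>n = m + 1\<close>, so the smallest exponent \<open>n - \<delta> - 1\<close> occurring in
    it is \<open>m - \<delta> > 0\<close>.\<close>
  define m where "m = nat \<lceil>\<delta>\<rceil> + 1"
  have m: "real m - \<delta> > 0" unfolding m_def by linarith
  let ?H = "\<lambda>z. integral (cbox 0 1) (\<lambda>t. of_real (t powr (real m - \<delta>)) / (1 - of_real t * z)) :: complex"
  define f where "f z = (\<Sum>n<Suc m. of_real (\<delta> / (\<delta> - real n)) * z ^ n) - of_real \<delta> * z ^ Suc m * ?H z" for z
  have "f holomorphic_on slit_plane"
    unfolding f_def by (intro holomorphic_intros hypergeometric_tail_integral_holomorphic m)
  moreover have "(\<lambda>n. of_real (\<delta> / (\<delta> - real n)) * z ^ n) sums f z" if z: "norm z < 1" for z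
  proof -
    have "(\<lambda>j. z ^ j * of_real (1 / (real m - \<delta> + real j + 1))) sums ?H z"
      by (rule hypergeometric_tail_integral_sums[OF m z])
    then have "(\<lambda>j. (- of_real \<delta> * z ^ Suc m) * (z ^ j * of_real (1 / (real m - \<delta> + real j + 1)))) sums
        ((- of_real \<delta> * z ^ Suc m) * ?H z)" by (rule sums_mult)
    moreover have "(- of_real \<delta> * z ^ Suc m) * (z ^ j * of_real (1 / (real m - \<delta> + real j + 1)))
        = of_real (\<delta> / (\<delta> - real (j + Suc m))) * z ^ (j + Suc m)" for j
    proof -
      have e: "\<delta> / (\<delta> - real (j + Suc m)) = - \<delta> * (1 / (real m - \<delta> + real j + 1))"
      proof -
        have "real m - \<delta> + real j + 1 \<noteq> 0" using m by linarith
        moreover have "\<delta> - real (j + Suc m) = - (real m - \<delta> + real j + 1)" by simp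
        ultimately show ?thesis by (metis divide_minus_right minus_divide_left mult.right_neutral times_divide_eq_right)
      qed
      show ?thesis unfolding e by (simp add: power_add mult_ac)
    qed
    ultimately have "(\<lambda>j. of_real (\<delta> / (\<delta> - real (j + Suc m))) * z ^ (j + Suc m)) sums
        (f z - (\<Sum>n<Suc m. of_real (\<delta> / (\<delta> - real n)) * z ^ n))"
      unfolding f_def by simp
    then show ?thesis by (rule iffD1[OF sums_iff_shift'])
  qed
  ultimately show ?thesis by (rule that)
qed

abbreviation (input) F where "F \<equiv> hyp2F1 1 (- complex_of_real \<delta>) (1 - complex_of_real \<delta>)"

text \<open>Outside the disc, \<open>hyp2F1\<close> is defined by a definite description, which
  yields a value only if the continuation exists and is unique. Existence is
  \<open>hypergeometric_continuation\<close>; uniqueness is the identity theorem on the connected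
  cut plane.\<close>

lemma
  shows hyp2F1_geometric_holomorphic: "F holomorphic_on slit_plane"
    and hyp2F1_geometric_sums:
      "norm z < 1 \<Longrightarrow> (\<lambda>n. of_real (\<delta> / (\<delta> - real n)) * z ^ n) sums F z"
proof -
  obtain f where f: "f holomorphic_on slit_plane"
    and fs: "\<And>z. norm z < 1 \<Longrightarrow> (\<lambda>n. of_real (\<delta> / (\<delta> - real n)) * z ^ n) sums f z"
    using hypergeometric_continuation by blast
  define S where "S = eval_fps (fps_hypergeo [1, - complex_of_real \<delta>] [1 - complex_of_real \<delta>] 1)"
  have S: "S z = f z" if "norm z < 1" for z
    unfolding S_def eval_fps_def fps_hypergeo_nth_geometric[OF \<delta>]
    using fs[OF that] by (simp add: sums_iff)
  have uniq: "g z = f z" if "g holomorphic_on slit_plane" "\<forall>u. norm u < 1 \<longrightarrow> g u = S u" "z \<in> slit_plane" for g z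
  proof (rule analytic_continuation_open[of "ball 0 1" slit_plane g f z])
  qed (use unit_ball_subset_slit_plane that f S open_slit_plane connected_slit_plane in auto)
  have F: "F z = f z" if z: "z \<in> slit_plane" for z
  proof (cases "norm z < 1")
    case True
    then show ?thesis using S by (simp add: hyp2F1_def Let_def S_def)
  next
    case False
    have "F z = (THE v. \<exists>g. g holomorphic_on slit_plane \<and> (\<forall>u. norm u < 1 \<longrightarrow> g u = S u) \<and> v = g z)"
      using False by (simp add: hyp2F1_def Let_def S_def slit_plane_def)
    also have "\<dots> = f z"
    proof (rule the_equality)
      show "\<exists>g. g holomorphic_on slit_plane \<and> (\<forall>u. norm u < 1 \<longrightarrow> g u = S u) \<and> f z = g z"
        using f S by (intro exI[of _ f]) auto
    qed (use uniq z in blast)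
    finally show ?thesis .
  qed
  show "F holomorphic_on slit_plane"
    using f F by (simp cong: holomorphic_cong)
  show "(\<lambda>n. of_real (\<delta> / (\<delta> - real n)) * z ^ n) sums F z" if "norm z < 1"
  proof -
    have "F z = S z" using that by (simp add: hyp2F1_def Let_def S_def)
    then show ?thesis using S[OF that] fs[OF that] by simp
  qed
qed

text \<open>The coefficients \<open>c n = \<delta> / (\<delta> - n)\<close> satisfy
  \<open>n * c n = \<delta> * c n - \<delta>\<close>, which is the equation inside the unit disc;
  the identity theorem carries it to the cut plane.\<close>

lemma hyp2F1_geometric_ode:
  assumes z: "z \<in> slit_plane"
  shows "z * deriv F z = of_real \<delta> * F z - of_real \<delta> / (1 - z)"
proof (rule analytic_continuation_open[of "ball 0 1" slit_plane _ _ z])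
  show sub: "ball 0 1 \<subseteq> slit_plane" by (rule unit_ball_subset_slit_plane)
  show "(\<lambda>z. z * deriv F z) holomorphic_on slit_plane"
    by (intro holomorphic_intros hyp2F1_geometric_holomorphic open_slit_plane)
  show "(\<lambda>z. of_real \<delta> * F z - of_real \<delta> / (1 - z)) holomorphic_on slit_plane"
    by (intro holomorphic_intros hyp2F1_geometric_holomorphic) (auto simp: slit_plane_iff)
  fix x :: complex assume "x \<in> ball 0 1"
  then have x: "norm x < 1" by simp
  have xs: "x \<in> slit_plane" using unit_ball_subset_slit_plane \<open>x \<in> ball 0 1\<close> by blast
  let ?c = "\<lambda>n. complex_of_real (\<delta> / (\<delta> - real n))"
  have "(F has_field_derivative deriv F x) (at x)"
    using hyp2F1_geometric_holomorphic open_slit_plane xs by (simp add: holomorphic_derivI)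
  then have "(\<lambda>n. diffs ?c n * x ^ n) sums deriv F x"
    by (rule termdiffs_sums_strong[rotated]) (use x hyp2F1_geometric_sums in auto)
  then have "(\<lambda>n. x * (diffs ?c n * x ^ n)) sums (x * deriv F x)"
    by (rule sums_mult)
  then have "(\<lambda>n. of_nat (Suc n) * ?c (Suc n) * x ^ Suc n) sums (x * deriv F x)"
    by (simp add: diffs_def mult_ac)
  then have A: "(\<lambda>n. of_nat n * ?c n * x ^ n) sums (x * deriv F x)"
    by (subst (asm) sums_Suc_iff) simp
  have "(\<lambda>n. of_real \<delta> * (?c n * x ^ n) - of_real \<delta> * x ^ n) sums
      (of_real \<delta> * F x - of_real \<delta> * (1 / (1 - x)))"
    by (intro sums_diff sums_mult hyp2F1_geometric_sums x geometric_sums)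
  moreover have "of_real \<delta> * (?c n * x ^ n) - of_real \<delta> * x ^ n = of_nat n * ?c n * x ^ n" for n
  proof -
    have "\<delta> \<noteq> real n" using \<delta> by auto
    then have "\<delta> * (\<delta> / (\<delta> - real n)) - \<delta> = real n * (\<delta> / (\<delta> - real n))"
      by (simp add: field_simps)
    then have "of_real \<delta> * ?c n - of_real \<delta> = of_nat n * ?c n"
      by (metis of_real_diff of_real_mult of_real_of_nat_eq)
    then show ?thesis by (metis (no_types, lifting) left_diff_distrib mult.assoc)
  qed
  ultimately show "x * deriv F x = of_real \<delta> * F x - of_real \<delta> / (1 - x)"
    using sums_unique2[OF A] by simp
qed (use z open_slit_plane connected_slit_plane in auto)

end

subsection \<open>Integral form of the functions \<open>\<Delta>\<close>\<close>

text \<open>The radius at which the path loss behind \<open>N\<close> walls equals \<open>y\<close>.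
  It is \<open>0\<close> if \<open>K ^ N = 0\<close>, in accordance with an infinite path loss
  everywhere.\<close>

definition inner_radius :: "network \<Rightarrow> real \<Rightarrow> nat \<Rightarrow> real \<Rightarrow> real" where
  "inner_radius S b N y = (y * pen_loss S ^ N / kappa S) powr (1 / b)"

text \<open>This is \<open>E[exp (j w h / l)] - 1\<close> for an exponential \<open>h\<close> and the path loss
  \<open>l = \<kappa> r\<^sup>b / K\<^sup>N\<close>, multiplied out so that \<open>K = 0\<close> needs no special treatment.\<close>

definition fading_kernel :: "network \<Rightarrow> real \<Rightarrow> nat \<Rightarrow> real \<Rightarrow> real \<Rightarrow> complex" where
  "fading_kernel S b N w r =
     \<i> * of_real (w * pen_loss S ^ N) / (of_real (kappa S * r powr b) - \<i> * of_real (w * pen_loss S ^ N))"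

text \<open>The integral of \<open>(\<eta> + 2) * r ^ (\<eta> + 1)\<close> times the kernel from the
  inner radius to \<open>R_D\<close>, transported to \<open>{0..1}\<close>. An interval that does
  not depend on \<open>b\<close> eases continuity in \<open>b\<close>, and the orientation is right
  even if the inner radius exceeds \<open>R_D\<close>.\<close>

definition Delta_integral :: "network \<Rightarrow> real \<Rightarrow> nat \<Rightarrow> nat \<Rightarrow> real \<Rightarrow> real \<Rightarrow> complex" where
  "Delta_integral S b \<eta> N w y = of_real ((real \<eta> + 2) * (R_D S - inner_radius S b N y)) *
     integral {0..1} (\<lambda>u. let r = inner_radius S b N y + u * (R_D S - inner_radius S b N y)
        in of_real (r ^ (\<eta> + 1)) * fading_kernel S b N w r)"

lemma hyp2F1_0 [simp]: "hyp2F1 a b c 0 = 1"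
  by (simp add: hyp2F1_def Let_def eval_fps_at_0)

lemma imaginary_in_slit_plane [simp]: "\<i> * complex_of_real x \<in> slit_plane"
  by (simp add: slit_plane_iff)

lemma convex_comb_pos:
  fixes a b u :: real
  assumes "0 < a" "0 < b" "0 \<le> u" "u \<le> 1"
  shows "0 < a + u * (b - a)"
proof -
  have "a + u * (b - a) = (1 - u) * a + u * b" by (simp add: algebra_simps)
  also have "\<dots> > 0"
  proof (cases "u = 1")
    case False
    then show ?thesis using assms by (intro add_pos_nonneg mult_pos_pos mult_nonneg_nonneg) auto
  qed (use assms in auto)
  finally show ?thesis .
qed

text \<open>With \<open>Z r = j w K ^ N / (\<kappa> r ^ b)\<close>, the function
  \<open>r ^ (\<eta> + 2) * (1 - F (Z r))\<close> is a primitive of minus the integrand: in its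
  derivative the differential equation and \<open>b * \<delta> = \<eta> + 2\<close> eliminate
  \<open>F\<close> and leave \<open>Z / (1 - Z)\<close>, the fading kernel. Its values at the two
  radii are the two terms of the formula.\<close>

lemma Delta_formula_eq_integral:
  assumes b: "0 < b" "(real \<eta> + 2) / b \<notin> \<nat>"
    and S: "0 < kappa S" "0 < R_D S" "0 \<le> pen_loss S" and y: "0 < y"
  shows "Delta_formula S b \<eta> N w y = Delta_integral S b \<eta> N w y"
proof (cases "pen_loss S ^ N = 0")
  case True
  show ?thesis
    unfolding Delta_formula_def Delta_integral_def fading_kernel_def Let_def True by simp
next
  case False
  define k where "k = pen_loss S ^ N"
  have k: "k > 0" using False zero_le_power[OF S(3), of N] unfolding k_def by linarith
  define \<delta> where "\<delta> = (real \<eta> + 2) / b"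
  have \<delta>: "\<delta> \<notin> \<nat>" "0 < \<delta>" using b by (auto simp: \<delta>_def)
  define F where "F = hyp2F1 1 (- complex_of_real \<delta>) (1 - complex_of_real \<delta>)"
  define \<rho> where "\<rho> = inner_radius S b N y"
  have "0 < y * pen_loss S ^ N / kappa S"
    using k S y by (intro divide_pos_pos mult_pos_pos) (simp_all only: k_def)
  then have \<rho>: "\<rho> > 0" unfolding \<rho>_def inner_radius_def powr_gt_zero by linarith
  define R where "R = R_D S"
  have R: "R > 0" using S by (simp add: R_def)
  define Z where "Z r = \<i> * of_real (w * k / kappa S * r powr (- b))" for r
  define B where "B r = of_real (r ^ (\<eta> + 2)) * (1 - F (Z r))" for r
  define G where "G r = of_real (real \<eta> + 2) * (of_real (r ^ (\<eta> + 1)) * fading_kernel S b N w r)" for r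
  have dB: "(B has_vector_derivative - G r) (at r)" if r: "r > 0" for r
  proof -
    have Zs: "Z r \<in> slit_plane" unfolding Z_def by (rule imaginary_in_slit_plane)
    have dF: "(F has_field_derivative deriv F (Z r)) (at (Z r))"
      using hyp2F1_geometric_holomorphic[OF \<delta>] open_slit_plane Zs
      unfolding F_def by (simp add: holomorphic_derivI)
    have ode: "Z r * deriv F (Z r) = of_real \<delta> * F (Z r) - of_real \<delta> / (1 - Z r)"
      unfolding F_def by (rule hyp2F1_geometric_ode[OF \<delta> Zs])
    have dZ: "(Z has_vector_derivative (of_real (- b / r) * Z r)) (at r)"
    proof -
      have "((\<lambda>r. w * k / kappa S * r powr (- b)) has_real_derivative
          w * k / kappa S * (- b * r powr (- b - 1))) (at r)"
        using r S by (auto intro!: derivative_eq_intros)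
      then have "((\<lambda>r. complex_of_real (w * k / kappa S * r powr (- b))) has_vector_derivative
          of_real (w * k / kappa S * (- b * r powr (- b - 1)))) (at r)"
        by (intro has_vector_derivative_of_real) (simp add: has_real_derivative_iff_has_vector_derivative)
      then have "(Z has_vector_derivative \<i> * of_real (w * k / kappa S * (- b * r powr (- b - 1)))) (at r)"
        unfolding Z_def by (intro has_vector_derivative_mult_right)
      moreover have e: "w * k / kappa S * (- b * r powr (- b - 1)) = (- b / r) * (w * k / kappa S * r powr (- b))"
        using r S by (simp add: powr_diff field_simps)
      have "\<i> * of_real (w * k / kappa S * (- b * r powr (- b - 1))) = of_real (- b / r) * Z r"
        unfolding e Z_def of_real_mult by (simp only: mult_ac)
      ultimately show ?thesis by (simp only:)
    qed
    have dFZ: "((\<lambda>r. F (Z r)) has_vector_derivative (of_real (- b / r) * Z r * deriv F (Z r))) (at r)"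
      using field_vector_diff_chain_at[OF dZ dF] by (simp add: o_def)
    have dr: "((\<lambda>r. complex_of_real (r ^ (\<eta> + 2))) has_vector_derivative
        of_real ((real \<eta> + 2) * r ^ (\<eta> + 1))) (at r)"
    proof -
      have "((\<lambda>r. r ^ (\<eta> + 2)) has_real_derivative (real \<eta> + 2) * r ^ (\<eta> + 1)) (at r)"
        using DERIV_pow[of "\<eta> + 2" r UNIV] by (simp add: add.commute)
      then show ?thesis
        by (intro has_vector_derivative_of_real) (simp add: has_real_derivative_iff_has_vector_derivative)
    qed
    have "(B has_vector_derivative
        (of_real (r ^ (\<eta> + 2)) * (0 - of_real (- b / r) * Z r * deriv F (Z r))
         + of_real ((real \<eta> + 2) * r ^ (\<eta> + 1)) * (1 - F (Z r)))) (at r)"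
      unfolding B_def
      by (intro has_vector_derivative_mult has_vector_derivative_diff has_vector_derivative_const dFZ dr)
    moreover have "of_real (r ^ (\<eta> + 2)) * (0 - of_real (- b / r) * Z r * deriv F (Z r))
         + of_real ((real \<eta> + 2) * r ^ (\<eta> + 1)) * (1 - F (Z r)) = - G r"
    proof -
      have den: "1 - Z r \<noteq> 0" using Zs by (auto simp: Z_def complex_eq_iff)
      have db: "complex_of_real b * of_real \<delta> = of_real (real \<eta> + 2)"
        using b by (simp add: \<delta>_def flip: of_real_mult)
      have r2: "complex_of_real (r ^ (\<eta> + 2)) * of_real (b / r) = of_real (r ^ (\<eta> + 1)) * of_real b"
        using r by (simp add: field_simps)
      have "of_real (r ^ (\<eta> + 2)) * (0 - of_real (- b / r) * Z r * deriv F (Z r))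
          = (of_real (r ^ (\<eta> + 2)) * of_real (b / r)) * (Z r * deriv F (Z r))"
        by simp
      also have "\<dots> = of_real (r ^ (\<eta> + 1)) * (of_real b * of_real \<delta>) * (F (Z r) - 1 / (1 - Z r))"
        unfolding r2 ode by (simp add: algebra_simps)
      also have "\<dots> = of_real (r ^ (\<eta> + 1)) * of_real (real \<eta> + 2) * (F (Z r) - 1 / (1 - Z r))"
        unfolding db ..
      finally have "of_real (r ^ (\<eta> + 2)) * (0 - of_real (- b / r) * Z r * deriv F (Z r))
          + of_real ((real \<eta> + 2) * r ^ (\<eta> + 1)) * (1 - F (Z r))
          = of_real (real \<eta> + 2) * of_real (r ^ (\<eta> + 1)) * (1 - 1 / (1 - Z r))"
        by (simp add: algebra_simps)
      also have "1 - 1 / (1 - Z r) = - (Z r / (1 - Z r))"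
        using den by (simp add: field_simps)
      also have "Z r / (1 - Z r) = fading_kernel S b N w r"
      proof -
        define c where "c = complex_of_real (kappa S * r powr b)"
        have c: "c \<noteq> 0" using r S by (simp add: c_def)
        have "c * Z r = \<i> * of_real (w * k)"
          using r S by (simp add: c_def Z_def powr_minus field_simps)
        then have "fading_kernel S b N w r = c * Z r / (c - c * Z r)"
          by (simp add: fading_kernel_def c_def k_def)
        also have "c - c * Z r = c * (1 - Z r)" by (simp add: algebra_simps)
        finally show ?thesis using c by simp
      qed
      finally show ?thesis unfolding G_def by (simp add: mult.assoc)
    qed
    ultimately show ?thesis by simp
  qed
  have ends: "\<rho> + 1 * (R - \<rho>) = R" "\<rho> + 0 * (R - \<rho>) = \<rho>" by simp_all
  have ftc: "((\<lambda>u. (R - \<rho>) *\<^sub>R (- G (\<rho> + u * (R - \<rho>)))) has_integral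
      (B (\<rho> + 1 * (R - \<rho>)) - B (\<rho> + 0 * (R - \<rho>)))) {0..1}"
  proof (rule fundamental_theorem_of_calculus)
    fix u :: real assume u: "u \<in> {0..1}"
    have "((\<lambda>u. \<rho> + u * (R - \<rho>)) has_vector_derivative (R - \<rho>)) (at u)"
      by (auto intro!: derivative_eq_intros simp: has_real_derivative_iff_has_vector_derivative[symmetric])
    then have "(B \<circ> (\<lambda>u. \<rho> + u * (R - \<rho>)) has_vector_derivative (R - \<rho>) *\<^sub>R (- G (\<rho> + u * (R - \<rho>)))) (at u)"
      by (rule vector_diff_chain_at) (use dB convex_comb_pos[OF \<rho> R] u in auto)
    then show "((\<lambda>u. B (\<rho> + u * (R - \<rho>))) has_vector_derivative (R - \<rho>) *\<^sub>R (- G (\<rho> + u * (R - \<rho>)))) (at u within {0..1})"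
      by (simp add: o_def has_vector_derivative_at_within)
  qed simp
  have "B R - B \<rho> = integral {0..1} (\<lambda>u. (R - \<rho>) *\<^sub>R (- G (\<rho> + u * (R - \<rho>))))"
    using integral_unique[OF ftc] unfolding ends by (rule sym)
  also have "\<dots> = - Delta_integral S b \<eta> N w y"
  proof -
    have "integral {0..1} (\<lambda>u. (R - \<rho>) *\<^sub>R (- G (\<rho> + u * (R - \<rho>)))) =
       integral {0..1} (\<lambda>u. of_real (- ((real \<eta> + 2) * (R - \<rho>))) *
         (of_real ((\<rho> + u * (R - \<rho>)) ^ (\<eta> + 1)) * fading_kernel S b N w (\<rho> + u * (R - \<rho>))))"
      by (intro integral_cong) (simp add: G_def scaleR_conv_of_real)
    also have "\<dots> = of_real (- ((real \<eta> + 2) * (R - \<rho>))) * integral {0..1} (\<lambda>u. 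
         of_real ((\<rho> + u * (R - \<rho>)) ^ (\<eta> + 1)) * fading_kernel S b N w (\<rho> + u * (R - \<rho>)))"
      by (rule integral_mult_right)
    finally show ?thesis by (simp add: Delta_integral_def Let_def \<rho>_def R_def)
  qed
  finally have "Delta_integral S b \<eta> N w y = B \<rho> - B R" by (simp add: algebra_simps)
  also have "\<dots> = Delta_formula S b \<eta> N w y"
  proof -
    have pw: "\<rho> powr b = y * k / kappa S" 
      using b k S y by (simp add: \<rho>_def inner_radius_def k_def powr_powr)
    have "\<rho> ^ (\<eta> + 2) = \<rho> powr (real (\<eta> + 2))" using \<rho> by (simp only: powr_realpow)
    also have "\<dots> = (y * k / kappa S) powr \<delta>"
      using b by (simp add: \<rho>_def inner_radius_def k_def powr_powr \<delta>_def add.commute)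
    finally have 1: "\<rho> ^ (\<eta> + 2) = (y * k / kappa S) powr \<delta>" .
    have 2: "Z \<rho> = \<i> * of_real (w / y)"
      unfolding Z_def powr_minus pw using k S y by (simp add: field_simps)
    have 3: "Z R = \<i> * of_real (w * k / (R powr b * kappa S))"
      unfolding Z_def powr_minus by (simp add: field_simps)
    show ?thesis
      unfolding B_def 1 2 3 by (simp add: Delta_formula_def Let_def F_def \<delta>_def k_def R_def)
  qed
  finally show ?thesis by simp
qed

text \<open>Serves the exponents at which the formula itself is undefined. For
  \<open>K ^ N > 0\<close> all radii involved are positive, so the integrand is jointly continuous
  in \<open>b\<close> and the integration variable.\<close>

lemma continuous_on_Delta_integral:
  assumes S: "0 < kappa S" "0 < R_D S" "0 \<le> pen_loss S" and y: "0 < y"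
  shows "continuous_on {0<..} (\<lambda>b. Delta_integral S b \<eta> N w y)"
proof (cases "pen_loss S ^ N = 0")
  case True
  show ?thesis unfolding Delta_integral_def fading_kernel_def Let_def True by simp
next
  case False
  let ?r = "\<lambda>p. inner_radius S (fst p) N y + snd p * (R_D S - inner_radius S (fst p) N y)"
  have "0 < pen_loss S ^ N" using False zero_le_power[OF S(3), of N] by linarith
  then have "0 < y * pen_loss S ^ N / kappa S"
    using S y by (intro divide_pos_pos mult_pos_pos)
  then have ir: "inner_radius S b N y > 0" for b
    unfolding inner_radius_def powr_gt_zero by linarith
  have c1: "continuous_on {0<..} (\<lambda>b. inner_radius S b N y)"
    unfolding inner_radius_def using False S y by (intro continuous_intros) auto
  have c2: "continuous_on ({0<..} \<times> {0..1}) (\<lambda>p. inner_radius S (fst p) N y)"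
    by (rule continuous_on_compose2[OF c1]) (auto intro!: continuous_intros)
  have pos: "?r p > 0" if "p \<in> {0<..} \<times> {0..1}" for p
    using that by (intro convex_comb_pos ir S) auto
  have c3: "continuous_on ({0<..} \<times> {0..1}) ?r"
    by (intro continuous_intros c2)
  have c4: "continuous_on ({0<..} \<times> {0..1}) (\<lambda>p. ?r p powr fst p)"
    by (intro continuous_on_powr c3 continuous_intros) (use pos in force)
  have ne: "complex_of_real (kappa S * ?r p powr fst p) - \<i> * of_real (w * pen_loss S ^ N) \<noteq> 0"
    if "p \<in> {0<..} \<times> {0..1}" for p
    using pos[OF that] S by (auto simp: complex_eq_iff)
  have c5: "continuous_on ({0<..} \<times> {0..1}) (\<lambda>p. of_real (?r p ^ (\<eta> + 1)) * fading_kernel S (fst p) N w (?r p))"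
    unfolding fading_kernel_def
    by (intro continuous_on_mult continuous_on_divide continuous_on_diff continuous_on_of_real
          continuous_on_power c3 c4 continuous_on_const) (use ne in blast)
  have "continuous_on {0<..} (\<lambda>b. integral (cbox 0 1) (\<lambda>u. of_real (?r (b, u) ^ (\<eta> + 1)) * fading_kernel S b N w (?r (b, u))))"
    by (rule integral_continuous_on_param) (use c5 in \<open>simp add: case_prod_beta\<close>)
  then show ?thesis
    unfolding Delta_integral_def Let_def
    by (intro continuous_intros c1) simp
qed

lemma eventually_quotient_not_Nats:
  fixes c \<beta> :: real
  assumes "0 < \<beta>" "0 < c"
  shows "\<forall>\<^sub>F b in at \<beta>. c / b \<notin> \<nat>"
proof -
  have t: "((\<lambda>b. c / b) \<longlongrightarrow> c / \<beta>) (at \<beta>)"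
    using assms by (intro tendsto_intros) auto
  \<comment> \<open>Distinct naturals are at distance at least \<open>1\<close>; a number outside
    the closed set of naturals has positive distance from all of them.\<close>
  define e where "e = (if c / \<beta> \<in> \<nat> then 1 else setdist {c / \<beta>} \<nat>)"
  have "closed (\<nat> :: real set)" by (rule closed_Nats)
  then have e: "e > 0"
    using setdist_gt_0_compact_closed[of "{c / \<beta>}" "\<nat>"] by (auto simp: e_def Nats_def)
  have "\<forall>\<^sub>F b in at \<beta>. dist (c / b) (c / \<beta>) < e" using t e by (rule tendstoD)
  moreover have "\<forall>\<^sub>F b in at \<beta>. b > 0"
    using assms by (intro order_tendstoD(1)[OF tendsto_ident_at])
  moreover have "\<forall>\<^sub>F b in at \<beta>. b \<noteq> \<beta>" by (simp add: eventually_at_filter)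
  ultimately show ?thesis
  proof eventually_elim
    case (elim b)
    show ?case
    proof
      assume n: "c / b \<in> \<nat>"
      have ne: "c / b \<noteq> c / \<beta>" using elim assms by (simp add: field_simps)
      show False
      proof (cases "c / \<beta> \<in> \<nat>")
        case True
        then obtain i j where ij: "c / b = real i" "c / \<beta> = real j" using n by (auto simp: Nats_def)
        then have "\<bar>real i - real j\<bar> < 1" using elim True by (simp add: e_def dist_real_def)
        then have "i = j" by linarith
        then show False using ij ne by simp
      next
        case False
        then have "setdist {c / \<beta>} \<nat> \<le> dist (c / \<beta>) (c / b)"
          using n by (intro setdist_le_dist) auto
        then show False using elim False by (simp add: e_def dist_commute)
      qed
    qed
  qed
qed

text \<open>At an exceptional exponent \<open>Delta\<close> is a limit of the formula. On a
  punctured neighbourhood the formula agrees with the integral form, which is continuous, so the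
  limit exists and is the integral.\<close>

lemma Delta_eq_integral:
  assumes S: "0 < kappa S" "0 < R_D S" "0 \<le> pen_loss S" "0 < path_exp S" and y: "0 < y"
  shows "Delta S \<eta> N w y = Delta_integral S (path_exp S) \<eta> N w y"
proof (cases "(real \<eta> + 2) / path_exp S \<in> \<nat>")
  case False
  then show ?thesis using Delta_formula_eq_integral S y by (simp add: Delta_def)
next
  case True
  have "isCont (\<lambda>b. Delta_integral S b \<eta> N w y) (path_exp S)"
    using continuous_on_Delta_integral[OF S(1-3) y] S(4)
    by (simp add: continuous_on_eq_continuous_at open_greaterThan)
  then have "((\<lambda>b. Delta_integral S b \<eta> N w y) \<longlongrightarrow> Delta_integral S (path_exp S) \<eta> N w y) (at (path_exp S))"
    by (simp add: isCont_def)
  moreover have "\<forall>\<^sub>F b in at (path_exp S). Delta_integral S b \<eta> N w y = Delta_formula S b \<eta> N w y"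
  proof -
    have "\<forall>\<^sub>F b in at (path_exp S). (real \<eta> + 2) / b \<notin> \<nat>"
      by (rule eventually_quotient_not_Nats) (use S in auto)
    moreover have "\<forall>\<^sub>F b in at (path_exp S). b > 0"
      using S by (intro order_tendstoD(1)[OF tendsto_ident_at])
    ultimately show ?thesis
      by eventually_elim (simp add: Delta_formula_eq_integral S y)
  qed
  ultimately have "((\<lambda>b. Delta_formula S b \<eta> N w y) \<longlongrightarrow> Delta_integral S (path_exp S) \<eta> N w y) (at (path_exp S))"
    by (rule Lim_transform_eventually)
  then show ?thesis using True by (simp add: Delta_def tendsto_Lim)
qed

lemma inner_radius_measurable [measurable]: "inner_radius S b N \<in> borel_measurable borel"
  unfolding inner_radius_def by measurable

section \<open>Bounds for the fading kernel and for \<Delta> on the annulus between inner radius and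
  rim\<close>

locale network_geometry =
  fixes S :: network
  assumes kappa: "0 < kappa S" and R: "0 < R_D S" and K0: "0 \<le> pen_loss S" and K1: "pen_loss S < 1"
    and beta: "0 < path_exp S"
begin

abbreviation "radius N y \<equiv> inner_radius S (path_exp S) N y"
abbreviation "kern N w r \<equiv> fading_kernel S (path_exp S) N w r"

lemma radius_nonneg [simp]: "0 \<le> radius N y"
  by (simp add: inner_radius_def)

lemma radius_powr:
  assumes "0 \<le> y"
  shows "kappa S * radius N y powr path_exp S = y * pen_loss S ^ N"
  using assms kappa beta K0 by (simp add: inner_radius_def powr_powr)

lemma radius_less:
  assumes "below_edge S N y" "0 \<le> y"
  shows "radius N y < R_D S"
proof (rule ccontr)
  assume "\<not> radius N y < R_D S"
  then have "R_D S powr path_exp S \<le> radius N y powr path_exp S"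
    using R beta by (intro powr_mono2) auto
  then have "kappa S * R_D S powr path_exp S \<le> kappa S * radius N y powr path_exp S"
    using kappa by simp
  then show False using assms by (simp add: radius_powr below_edge_def mult.commute)
qed

text \<open>The real part controls the kernel for small \<open>w\<close>, the imaginary part
  controls it for large \<open>w\<close>.\<close>

lemma norm_kernel_denominator:
  "\<bar>kappa S * r powr path_exp S\<bar> \<le> norm (complex_of_real (kappa S * r powr path_exp S) - \<i> * of_real x)"
  "\<bar>x\<bar> \<le> norm (complex_of_real (kappa S * r powr path_exp S) - \<i> * of_real x)"
  using abs_Re_le_cmod[of "complex_of_real (kappa S * r powr path_exp S) - \<i> * of_real x"]
    abs_Im_le_cmod[of "complex_of_real (kappa S * r powr path_exp S) - \<i> * of_real x"]
  by simp_all

lemma norm_kernel_le_1: "norm (kern N w r) \<le> 1"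
proof -
  have "norm (kern N w r) \<le> \<bar>w * pen_loss S ^ N\<bar> / norm (complex_of_real (kappa S * r powr path_exp S) - \<i> * of_real (w * pen_loss S ^ N))"
    unfolding fading_kernel_def by (simp add: norm_divide norm_mult del: of_real_mult)
  also have "\<dots> \<le> 1"
    using norm_kernel_denominator(2)[of "w * pen_loss S ^ N" r] by (auto simp: divide_le_eq_1)
  finally show ?thesis .
qed

text \<open>Beyond \<open>radius N y\<close> the path loss is at least \<open>y\<close>, that is
  \<open>y * K ^ N \<le> \<kappa> * r powr \<beta>\<close>. The factor \<open>K ^ N\<close> cancels
  against the numerator, which makes the bound uniform in \<open>N\<close>.\<close>

lemma norm_kernel_le:
  assumes "0 < y" "0 \<le> w" "radius N y \<le> r"
  shows "norm (kern N w r) \<le> w / y"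
proof (cases "pen_loss S ^ N = 0")
  case True
  show ?thesis unfolding fading_kernel_def True using assms by simp
next
  case False
  then have k: "pen_loss S ^ N > 0" using zero_le_power[OF K0, of N] by linarith
  have "radius N y powr path_exp S \<le> r powr path_exp S"
    using assms beta by (intro powr_mono2) auto
  then have A: "y * pen_loss S ^ N \<le> kappa S * r powr path_exp S"
    using radius_powr[of y N] assms kappa by (metis less_eq_real_def mult_left_mono)
  let ?D = "norm (complex_of_real (kappa S * r powr path_exp S) - \<i> * of_real (w * pen_loss S ^ N))"
  have D: "y * pen_loss S ^ N \<le> ?D"
    using A norm_kernel_denominator(1)[of r "w * pen_loss S ^ N"] by linarith
  have p: "0 < y * pen_loss S ^ N" using k assms by simp
  have "norm (kern N w r) = w * pen_loss S ^ N / ?D"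
  proof -
    have "0 \<le> w * pen_loss S ^ N" using assms k by simp
    then have "norm (\<i> * complex_of_real (w * pen_loss S ^ N)) = w * pen_loss S ^ N"
      by (simp only: norm_mult norm_ii norm_of_real mult_1 abs_of_nonneg)
    then show ?thesis unfolding fading_kernel_def norm_divide by (rule arg_cong)
  qed
  also have "\<dots> \<le> w * pen_loss S ^ N / (y * pen_loss S ^ N)"
    by (rule frac_le[OF _ order_refl p D]) (use assms k in simp)
  also have "\<dots> = w / y" using k by (intro mult_divide_mult_cancel_right) linarith
  finally show ?thesis .
qed

text \<open>For \<open>K ^ N > 0\<close> the kernel tends to \<open>-1\<close> as \<open>w\<close>
  grows, and its sum with \<open>1\<close> has the numerator
  \<open>\<kappa> * r powr \<beta>\<close>. Here the factor \<open>1 / K ^ N\<close>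
  appears.\<close>

lemma norm_kernel_plus_1_le:
  assumes "0 < w" "0 < pen_loss S ^ N" "0 < r" "r \<le> R_D S"
  shows "norm (kern N w r + 1) \<le> kappa S * R_D S powr path_exp S / (w * pen_loss S ^ N)"
proof -
  let ?d = "complex_of_real (kappa S * r powr path_exp S) - \<i> * of_real (w * pen_loss S ^ N)"
  have D: "w * pen_loss S ^ N \<le> norm ?d"
    using norm_kernel_denominator(2)[of "w * pen_loss S ^ N" r] by linarith
  have p: "0 < w * pen_loss S ^ N" using assms by simp
  then have nz: "?d \<noteq> 0" using D by (metis norm_zero linorder_not_le)
  have "kern N w r + 1 = of_real (kappa S * r powr path_exp S) / ?d"
    unfolding fading_kernel_def using nz by (simp add: field_simps)
  then have "norm (kern N w r + 1) = kappa S * r powr path_exp S / norm ?d"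
    using kappa by (simp add: norm_divide norm_mult)
  also have "\<dots> \<le> kappa S * R_D S powr path_exp S / (w * pen_loss S ^ N)"
    using D p kappa assms beta by (intro frac_le mult_left_mono powr_mono2) auto
  finally show ?thesis .
qed

definition annulus_point :: "nat \<Rightarrow> real \<Rightarrow> real \<Rightarrow> real" where
  "annulus_point N y u = radius N y + u * (R_D S - radius N y)"

lemma annulus_point_bounds:
  assumes "below_edge S N y" "0 \<le> y" "u \<in> {0..1}"
  shows "radius N y \<le> annulus_point N y u" "annulus_point N y u \<le> R_D S"
    "0 < u \<Longrightarrow> 0 < annulus_point N y u"
proof -
  have l: "radius N y < R_D S" using radius_less assms by blast
  then show "radius N y \<le> annulus_point N y u" using assms by (simp add: annulus_point_def)
  have "u * (R_D S - radius N y) \<le> 1 * (R_D S - radius N y)"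
    using l assms by (intro mult_right_mono) auto
  then show "annulus_point N y u \<le> R_D S" by (simp add: annulus_point_def)
  assume "0 < u"
  then have "0 < u * (R_D S - radius N y)" using l by simp
  then show "0 < annulus_point N y u" using radius_nonneg[of N y] unfolding annulus_point_def by linarith
qed

text \<open>The length of the annulus supplies one more factor \<open>R_D\<close>. A function that
  is not integrable has integral \<open>0\<close> and meets the bound trivially. The endpoint
  \<open>u = 0\<close>, at which the radius may be \<open>0\<close>, is a null set.\<close>

lemma integral_annulus_bound:
  fixes f :: "real \<Rightarrow> 'a::euclidean_space"
  assumes "below_edge S N y" "0 \<le> y" "0 \<le> c"
    and b: "\<And>u. 0 < u \<Longrightarrow> u \<le> 1 \<Longrightarrow> norm (f u) \<le> annulus_point N y u ^ (\<eta> + 1) * c"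
  shows "(R_D S - radius N y) * norm (integral {0..1} f) \<le> R_D S ^ (\<eta> + 2) * c"
proof -
  define f' where "f' u = (if u = 0 then 0 else f u)" for u
  have "integral {0..1} f = integral {0..1} f'"
    by (rule integral_spike[of "{0}"]) (auto simp: f'_def)
  moreover have "norm (integral {0..1} f') \<le> R_D S ^ (\<eta> + 1) * c"
  proof (cases "f' integrable_on {0..1}")
    case True
    have "norm (integral {0..1} f') \<le> integral {0..1} (\<lambda>u::real. R_D S ^ (\<eta> + 1) * c)"
    proof (rule integral_norm_bound_integral[OF True])
      fix u :: real assume u: "u \<in> {0..1}"
      show "norm (f' u) \<le> R_D S ^ (\<eta> + 1) * c"
      proof (cases "u = 0")
        case False
        then have "0 < u" "u \<le> 1" using u by auto
        then have "norm (f' u) \<le> annulus_point N y u ^ (\<eta> + 1) * c"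
          using b by (simp add: f'_def)
        also have "\<dots> \<le> R_D S ^ (\<eta> + 1) * c"
        proof (intro mult_right_mono power_mono)
          show "annulus_point N y u \<le> R_D S" by (rule annulus_point_bounds[OF assms(1,2) u])
          show "0 \<le> annulus_point N y u"
            using annulus_point_bounds(1)[OF assms(1,2) u] radius_nonneg[of N y] by linarith
        qed fact
        finally show ?thesis .
      qed (use R assms in \<open>auto simp: f'_def\<close>)
    qed (rule integrable_const_ivl)
    then show ?thesis by simp
  qed (use R assms in \<open>auto simp: not_integrable_integral\<close>)
  ultimately have "(R_D S - radius N y) * norm (integral {0..1} f) \<le> R_D S * (R_D S ^ (\<eta> + 1) * c)"
    using R radius_less[OF assms(1,2)] by (intro mult_mono) auto
  then show ?thesis by (simp add: mult_ac)
qed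

lemma Delta_annulus:
  assumes "0 < y"
  shows "Delta S \<eta> N w y = of_real ((real \<eta> + 2) * (R_D S - radius N y)) *
     integral {0..1} (\<lambda>u. of_real (annulus_point N y u ^ (\<eta> + 1)) * kern N w (annulus_point N y u))"
  unfolding Delta_eq_integral[OF kappa R K0 beta assms]
  by (simp add: Delta_integral_def Let_def annulus_point_def)

lemma norm_Delta_le:
  assumes "below_edge S N y" "0 < y" "0 \<le> w"
  shows "norm (Delta S \<eta> N w y) \<le> (real \<eta> + 2) * R_D S ^ (\<eta> + 2) * min 1 (w / y)"
proof -
  have "(R_D S - radius N y) * norm (integral {0..1} (\<lambda>u. of_real (annulus_point N y u ^ (\<eta> + 1)) * kern N w (annulus_point N y u)))
    \<le> R_D S ^ (\<eta> + 2) * min 1 (w / y)"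
  proof (rule integral_annulus_bound)
    fix u :: real assume u: "0 < u" "u \<le> 1"
    then have p: "0 < annulus_point N y u" "radius N y \<le> annulus_point N y u"
      using annulus_point_bounds[OF assms(1), of u] assms by auto
    have "norm (complex_of_real (annulus_point N y u ^ (\<eta> + 1)) * kern N w (annulus_point N y u))
       = annulus_point N y u ^ (\<eta> + 1) * norm (kern N w (annulus_point N y u))"
      using p by (simp add: norm_mult norm_power)
    also have "\<dots> \<le> annulus_point N y u ^ (\<eta> + 1) * min 1 (w / y)"
      using norm_kernel_le_1 norm_kernel_le[OF assms(2,3) p(2)] p by (intro mult_left_mono) auto
    finally show "norm (complex_of_real (annulus_point N y u ^ (\<eta> + 1)) * kern N w (annulus_point N y u))
       \<le> annulus_point N y u ^ (\<eta> + 1) * min 1 (w / y)" .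
  qed (use assms in auto)
  then have "(real \<eta> + 2) * ((R_D S - radius N y) * norm (integral {0..1} (\<lambda>u. of_real (annulus_point N y u ^ (\<eta> + 1)) * kern N w (annulus_point N y u))))
    \<le> (real \<eta> + 2) * (R_D S ^ (\<eta> + 2) * min 1 (w / y))"
    by (intro mult_left_mono) auto
  then show ?thesis
    unfolding Delta_annulus[OF assms(2)] norm_mult norm_of_real
    using radius_less[of N y] assms by (simp add: abs_mult mult.assoc)
qed

text \<open>The limit of \<open>Delta\<close> as \<open>w\<close> tends to infinity, with the kernel
  replaced by its limit \<open>-1\<close>. For \<open>K ^ N = 0\<close> the kernel vanishes
  identically, hence the separate case.\<close>

definition Delta_limit :: "nat \<Rightarrow> nat \<Rightarrow> real \<Rightarrow> real" where
  "Delta_limit \<eta> N y = (if pen_loss S ^ N = 0 then 0 else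
     - (real \<eta> + 2) * (R_D S - radius N y) * integral {0..1} (\<lambda>u. annulus_point N y u ^ (\<eta> + 1)))"

lemma abs_Delta_limit_le:
  assumes "below_edge S N y" "0 < y"
  shows "\<bar>Delta_limit \<eta> N y\<bar> \<le> (real \<eta> + 2) * R_D S ^ (\<eta> + 2)"
proof -
  have "(R_D S - radius N y) * norm (integral {0..1} (\<lambda>u. annulus_point N y u ^ (\<eta> + 1)))
    \<le> R_D S ^ (\<eta> + 2) * 1"
  proof (rule integral_annulus_bound)
    fix u :: real assume u: "0 < u" "u \<le> 1"
    then have p: "0 < annulus_point N y u"
      using annulus_point_bounds[OF assms(1), of u] assms by auto
    then show "norm (annulus_point N y u ^ (\<eta> + 1)) \<le> annulus_point N y u ^ (\<eta> + 1) * 1"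
      by simp
  qed (use assms in auto)
  then have "(real \<eta> + 2) * ((R_D S - radius N y) * \<bar>integral {0..1} (\<lambda>u. annulus_point N y u ^ (\<eta> + 1))\<bar>)
    \<le> (real \<eta> + 2) * R_D S ^ (\<eta> + 2)"
    by (intro mult_left_mono) auto
  then show ?thesis
    unfolding Delta_limit_def
    using radius_less[of N y] assms R by (simp add: abs_mult mult.assoc add.commute)
qed

lemma continuous_on_annulus_point: "continuous_on A (annulus_point N y)"
  unfolding annulus_point_def by (intro continuous_intros)

lemma continuous_on_kern_annulus:
  assumes "below_edge S N y" "0 < y" "pen_loss S ^ N \<noteq> 0"
  shows "continuous_on {0..1} (\<lambda>u. kern N w (annulus_point N y u))"
proof -
  have r: "0 < radius N y" using assms kappa K0 by (simp add: inner_radius_def)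
  have pos: "annulus_point N y u > 0" if "u \<in> {0..1}" for u
    using annulus_point_bounds(1)[OF assms(1) _ that] r assms by simp
  have ne: "complex_of_real (kappa S * annulus_point N y u powr path_exp S) - \<i> * of_real (w * pen_loss S ^ N) \<noteq> 0"
    if "u \<in> {0..1}" for u
    using pos[OF that] kappa by (auto simp: complex_eq_iff)
  show ?thesis unfolding fading_kernel_def
    by (intro continuous_on_mult continuous_on_divide continuous_on_diff continuous_on_of_real
          continuous_on_powr continuous_on_annulus_point continuous_on_const) (use ne pos in force)+
qed

lemma norm_Delta_minus_limit_le:
  assumes "below_edge S N y" "0 < y" "0 < w"
  shows "norm (Delta S \<eta> N w y - of_real (Delta_limit \<eta> N y))
     \<le> (real \<eta> + 2) * R_D S ^ (\<eta> + 2) * (kappa S * R_D S powr path_exp S / (w * pen_loss S ^ N))"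
proof (cases "pen_loss S ^ N = 0")
  case True
  \<comment> \<open>Both sides of the claim are \<open>0\<close> here, the right one because it
    contains a division by \<open>0\<close>.\<close>
  have "Delta S \<eta> N w y = 0"
    unfolding Delta_annulus[OF assms(2)] fading_kernel_def True by simp
  then show ?thesis unfolding Delta_limit_def True by simp
next
  case False
  then have k: "pen_loss S ^ N > 0" using zero_le_power[OF K0, of N] by linarith
  let ?a = "\<lambda>u. annulus_point N y u ^ (\<eta> + 1)"
  let ?c = "kappa S * R_D S powr path_exp S / (w * pen_loss S ^ N)"
  have i1: "(\<lambda>u. of_real (?a u) * kern N w (annulus_point N y u)) integrable_on {0..1}"
    by (intro integrable_continuous_real continuous_on_mult continuous_on_of_real continuous_on_power
        continuous_on_annulus_point continuous_on_kern_annulus assms False)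
  have "continuous_on {0..1} ?a" by (intro continuous_on_power continuous_on_annulus_point)
  then have i2: "(?a has_integral integral {0..1} ?a) {0..1}"
    by (intro integrable_integral integrable_continuous_real)
  then have i3: "((\<lambda>u. complex_of_real (?a u)) has_integral of_real (integral {0..1} ?a)) {0..1}"
    by (rule has_integral_of_real)
  have "Delta S \<eta> N w y - of_real (Delta_limit \<eta> N y) = of_real ((real \<eta> + 2) * (R_D S - radius N y)) *
     (integral {0..1} (\<lambda>u. of_real (?a u) * kern N w (annulus_point N y u)) + of_real (integral {0..1} ?a))"
  proof -
    have "complex_of_real (Delta_limit \<eta> N y) = - (of_real ((real \<eta> + 2) * (R_D S - radius N y)) * of_real (integral {0..1} ?a))"
      unfolding Delta_limit_def using False by (simp only: if_False of_real_mult of_real_minus mult_minus_left)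
    then show ?thesis unfolding Delta_annulus[OF assms(2)] by (simp only: distrib_left diff_minus_eq_add)
  qed
  also have "integral {0..1} (\<lambda>u. of_real (?a u) * kern N w (annulus_point N y u)) + of_real (integral {0..1} ?a)
     = integral {0..1} (\<lambda>u. of_real (?a u) * kern N w (annulus_point N y u) + of_real (?a u))"
    using i1 i3 by (simp add: Henstock_Kurzweil_Integration.integral_add integral_unique has_integral_integrable)
  also have "\<dots> = integral {0..1} (\<lambda>u. of_real (?a u) * (kern N w (annulus_point N y u) + 1))"
    by (intro integral_cong) (simp add: algebra_simps)
  finally have eq: "Delta S \<eta> N w y - of_real (Delta_limit \<eta> N y) = of_real ((real \<eta> + 2) * (R_D S - radius N y)) *
     integral {0..1} (\<lambda>u. of_real (?a u) * (kern N w (annulus_point N y u) + 1))" .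
  have "(R_D S - radius N y) * norm (integral {0..1} (\<lambda>u. of_real (?a u) * (kern N w (annulus_point N y u) + 1)))
    \<le> R_D S ^ (\<eta> + 2) * ?c"
  proof (rule integral_annulus_bound)
    fix u :: real assume u: "0 < u" "u \<le> 1"
    then have p: "0 < annulus_point N y u" "annulus_point N y u \<le> R_D S"
      using annulus_point_bounds[OF assms(1), of u] assms by auto
    have "norm (complex_of_real (?a u) * (kern N w (annulus_point N y u) + 1))
       = ?a u * norm (kern N w (annulus_point N y u) + 1)"
      using p by (simp add: norm_mult norm_power)
    also have "\<dots> \<le> ?a u * ?c"
      using norm_kernel_plus_1_le[OF assms(3) k p] p by (intro mult_left_mono) auto
    finally show "norm (complex_of_real (?a u) * (kern N w (annulus_point N y u) + 1)) \<le> ?a u * ?c" .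
  qed (use assms k kappa in auto)
  then have "(real \<eta> + 2) * ((R_D S - radius N y) * norm (integral {0..1} (\<lambda>u. of_real (?a u) * (kern N w (annulus_point N y u) + 1))))
    \<le> (real \<eta> + 2) * (R_D S ^ (\<eta> + 2) * ?c)"
    by (intro mult_left_mono) auto
  then show ?thesis
    unfolding eq norm_mult norm_of_real
    using radius_less[of N y] assms by (simp add: abs_mult mult.assoc)
qed

text \<open>The gauge integral over \<open>u\<close> is rewritten as a Lebesgue integral, for which
  measurability in the parameters follows from joint measurability of the integrand.\<close>

lemma Delta_measurable:
  "(\<lambda>p. if 0 < snd p \<and> below_edge S N (snd p) then Delta S \<eta> N (fst p) (snd p) else 0)
     \<in> borel_measurable (borel \<Otimes>\<^sub>M borel)"
proof -
  let ?L = "\<lambda>p. of_real ((real \<eta> + 2) * (R_D S - radius N (snd p))) *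
     (LBINT u:{0..1}. of_real (annulus_point N (snd p) u ^ (\<eta> + 1)) * kern N (fst p) (annulus_point N (snd p) u))"
  have "?L p = Delta S \<eta> N (fst p) (snd p)" if p: "0 < snd p" "below_edge S N (snd p)" for p
  proof (cases "pen_loss S ^ N = 0")
    case True
    show ?thesis unfolding Delta_annulus[OF p(1)] unfolding fading_kernel_def True by simp
  next
    case False
    have "set_integrable lborel {0..1} (\<lambda>u. of_real (annulus_point N (snd p) u ^ (\<eta> + 1)) * kern N (fst p) (annulus_point N (snd p) u))"
      by (intro borel_integrable_compact[folded set_integrable_def] borel_integrable_atLeastAtMost' continuous_on_mult continuous_on_of_real continuous_on_power
        continuous_on_annulus_point continuous_on_kern_annulus p False compact_Icc)
    then show ?thesis unfolding Delta_annulus[OF p(1)] by (simp add: set_borel_integral_eq_integral)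
  qed
  then have "(\<lambda>p. if 0 < snd p \<and> below_edge S N (snd p) then Delta S \<eta> N (fst p) (snd p) else 0) =
     (\<lambda>p. if 0 < snd p \<and> below_edge S N (snd p) then ?L p else 0)"
    by (intro ext) auto
  moreover have "\<dots> \<in> borel_measurable (borel \<Otimes>\<^sub>M borel)"
    unfolding set_lebesgue_integral_def annulus_point_def fading_kernel_def below_edge_def by measurable
  ultimately show ?thesis by simp
qed

end

subsection \<open>Bounds for the coefficients and the path loss intensity\<close>

lemma summable_norm_majorant:
  fixes f :: "nat \<Rightarrow> 'a::banach"
  assumes "\<And>n. norm (f n) \<le> g n" "summable g"
  shows "summable f" "norm (suminf f) \<le> suminf g"
  using assms by (auto intro: summable_comparison_test' norm_suminf_le)

text \<open>The coefficients start at \<open>1\<close>, and the ratio \<open>d\<close> of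
  consecutive ones lies in \<open>[0, 1]\<close>.\<close>

lemma fps_hypergeo_nth_le_1:
  fixes a :: real
  assumes "0 < a"
  shows "\<exists>c. 0 \<le> c \<and> c \<le> 1 \<and>
    fps_nth (fps_hypergeo [1/2, complex_of_real a] [complex_of_real (a + 1)] 1) n = of_real c"
proof (induction n)
  case 0
  show ?case by (intro exI[of _ 1]) simp
next
  case (Suc n)
  then obtain c where c: "0 \<le> c" "c \<le> 1"
    "fps_nth (fps_hypergeo [1/2, complex_of_real a] [complex_of_real (a + 1)] 1) n = of_real c" by blast
  define d where "d = (1/2 + real n) * (a + real n) / (real (Suc n) * (a + 1 + real n))"
  have d: "0 \<le> d" "d \<le> 1"
  proof -
    show "0 \<le> d" using assms by (simp add: d_def)
    have "(1/2 + real n) * (a + real n) \<le> real (Suc n) * (a + 1 + real n)"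
      using assms by (intro mult_mono) auto
    then show "d \<le> 1" using assms by (simp add: d_def divide_le_eq_1)
  qed
  have "fps_nth (fps_hypergeo [1/2, complex_of_real a] [complex_of_real (a + 1)] 1) (Suc n)
     = of_real (d * c)"
    unfolding fps_hypergeo_rec c(3) d_def by simp
  moreover have "0 \<le> d * c" "d * c \<le> 1" using c d mult_le_one[of d c] by auto
  ultimately show ?case by blast
qed

text \<open>Coefficients in \<open>[0, 1]\<close> are compared with the geometric series of ratio
  \<open>1/2\<close>, whose sum is \<open>2\<close>.\<close>

lemma norm_hyp2F1_half_le_2:
  fixes a :: real
  assumes "0 < a"
  shows "norm (hyp2F1 (1/2) (of_real a) (of_real (a + 1)) (1/2)) \<le> 2"
proof -
  let ?c = "fps_nth (fps_hypergeo [1/2, complex_of_real a] [complex_of_real (a + 1)] 1)"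
  have "hyp2F1 (1/2) (of_real a) (of_real (a + 1)) (1/2) = (\<Sum>n. ?c n * (1/2) ^ n)"
    by (simp add: hyp2F1_def Let_def eval_fps_def)
  moreover have "norm (\<Sum>n. ?c n * (1/2) ^ n) \<le> (\<Sum>n. (1/2::real) ^ n)"
  proof (rule summable_norm_majorant)
    fix n
    obtain c where c: "0 \<le> c" "c \<le> 1" "?c n = of_real c"
      using fps_hypergeo_nth_le_1[OF assms] by blast
    show "norm (?c n * (1/2) ^ n) \<le> (1/2) ^ n"
      unfolding c(3) using c by (simp add: norm_mult norm_power norm_divide mult_left_le_one_le)
  qed simp
  ultimately show ?thesis by (simp add: suminf_geometric)
qed

text \<open>By the functional equation, raising \<open>n\<close> by \<open>2\<close> multiplies the
  ratio by \<open>(n + 1) / (n + 2) \<le> 1\<close>. The values at \<open>0\<close> and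
  \<open>1\<close> therefore bound all others.\<close>

lemma Gamma_ratio_bounded:
  "\<exists>B. \<forall>n. Gamma ((real n + 1) / 2) / Gamma ((real n + 2) / 2) \<le> B"
proof -
  define r where "r n = Gamma ((real n + 1) / 2) / Gamma ((real n + 2) / 2)" for n
  have step: "r (Suc (Suc n)) \<le> r n" for n
  proof -
    define a b where "a = (real n + 1) / 2" and "b = (real n + 2) / 2"
    have ab: "0 < a" "0 < b" "a \<le> b" by (simp_all add: a_def b_def)
    then have p: "Gamma a > 0" "Gamma b > 0" by (simp_all add: Gamma_real_pos)
    have "Gamma (a + 1) = a * Gamma a" "Gamma (b + 1) = b * Gamma b"
      using ab by (auto intro!: Gamma_plus1 dest!: nonpos_Ints_nonpos)
    moreover have "r (Suc (Suc n)) = Gamma (a + 1) / Gamma (b + 1)"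
    proof -
      have "(real (Suc (Suc n)) + 1) / 2 = a + 1" "(real (Suc (Suc n)) + 2) / 2 = b + 1"
        by (simp_all add: a_def b_def add_divide_distrib)
      then show ?thesis unfolding r_def by (simp only:)
    qed
    ultimately have "r (Suc (Suc n)) = (a / b) * (Gamma a / Gamma b)" by simp
    also have "\<dots> \<le> 1 * (Gamma a / Gamma b)"
      using p ab by (intro mult_right_mono) auto
    also have "\<dots> = 1 * r n" by (simp add: r_def a_def b_def)
    finally show ?thesis by simp
  qed
  have "r n \<le> max (r 0) (r 1)" for n
  proof (induction n rule: induct_nat_012)
    case (ge2 n)
    then show ?case using step[of n] by linarith
  qed auto
  then show ?thesis unfolding r_def by (intro exI allI)
qed

text \<open>The first term of \<open>chi\<close> grows like \<open>2 powr (\<eta> / 2)\<close>, up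
  to a bounded ratio of Gamma values; the second is bounded and is absorbed because
  \<open>1 \<le> sqrt 2 ^ \<eta>\<close>.\<close>

lemma chi_bound:
  assumes l: "0 \<le> l"
  shows "\<exists>A\<ge>0. \<forall>\<eta>. \<bar>chi \<eta> l\<bar> \<le> A * (sqrt 2 * l) ^ \<eta>"
proof -
  obtain B where B: "\<And>n. Gamma ((real n + 1) / 2) / Gamma ((real n + 2) / 2) \<le> B"
    using Gamma_ratio_bounded by (elim exE) (rule that, erule spec)
  have B0: "0 \<le> B"
  proof -
    have "0 \<le> Gamma ((real 0 + 1) / 2) / Gamma ((real 0 + 2) / 2)" by (simp add: Gamma_one_half_real)
    then show ?thesis using B[of 0] by linarith
  qed
  have "\<bar>chi \<eta> l\<bar> \<le> (sqrt pi * B + 2 * sqrt 2) * (sqrt 2 * l) ^ \<eta>" for \<eta>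
  proof -
    define G where "G = Gamma ((real \<eta> + 1) / 2) / Gamma ((real \<eta> + 2) / 2)"
    define H where "H = Re (hyp2F1 (1/2) (of_real ((real \<eta> + 1) / 2)) (of_real ((real \<eta> + 3) / 2)) (1/2))"
    have G: "0 \<le> G" "G \<le> B"
      using B[of \<eta>] by (auto simp: G_def intro!: divide_nonneg_nonneg less_imp_le[OF Gamma_real_pos])
    have e: "(real \<eta> + 1) / 2 + 1 = (real \<eta> + 3) / 2" by (simp add: field_simps)
    have "norm (hyp2F1 (1/2) (of_real ((real \<eta> + 1) / 2)) (of_real ((real \<eta> + 3) / 2)) (1/2)) \<le> 2"
      by (rule norm_hyp2F1_half_le_2[of "(real \<eta> + 1) / 2", unfolded e]) simp
    then have H: "\<bar>H\<bar> \<le> 2" unfolding H_def by (rule order_trans[OF abs_Re_le_cmod])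
    have s2: "2 powr (real \<eta> / 2) = sqrt 2 ^ \<eta>"
      by (simp add: powr_half_sqrt[symmetric] powr_powr flip: powr_realpow)
    have one: "1 \<le> sqrt 2 ^ \<eta>" by (intro one_le_power) simp
    have "\<bar>sqrt 2 ^ \<eta> * sqrt pi * G - sqrt 2 * H / (real \<eta> + 1)\<bar>
        \<le> \<bar>sqrt 2 ^ \<eta> * sqrt pi * G\<bar> + \<bar>sqrt 2 * H / (real \<eta> + 1)\<bar>" by (rule abs_triangle_ineq4)
    also have "\<bar>sqrt 2 ^ \<eta> * sqrt pi * G\<bar> \<le> sqrt 2 ^ \<eta> * (sqrt pi * B)"
      using G by (simp add: abs_mult mult_left_mono)
    also have "\<bar>sqrt 2 * H / (real \<eta> + 1)\<bar> \<le> 2 * sqrt 2"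
    proof -
      have "\<bar>sqrt 2 * H / (real \<eta> + 1)\<bar> = sqrt 2 * \<bar>H\<bar> / (real \<eta> + 1)" by (simp add: abs_mult)
      also have "\<dots> \<le> sqrt 2 * 2 / 1" using H by (intro frac_le mult_left_mono) auto
      finally show ?thesis by simp
    qed
    also have "2 * sqrt 2 \<le> sqrt 2 ^ \<eta> * (2 * sqrt 2)" using mult_right_mono[OF one, of "2 * sqrt 2"] by simp
    finally have X: "\<bar>sqrt 2 ^ \<eta> * sqrt pi * G - sqrt 2 * H / (real \<eta> + 1)\<bar> \<le> sqrt 2 ^ \<eta> * (sqrt pi * B + 2 * sqrt 2)"
      by (simp add: distrib_left)
    have "chi \<eta> l = l ^ \<eta> * (sqrt 2 ^ \<eta> * sqrt pi * G - sqrt 2 * H / (real \<eta> + 1))"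
      unfolding chi_def s2 G_def H_def of_nat_add of_nat_1 of_nat_numeral by (simp only: times_divide_eq_right)
    then have "\<bar>chi \<eta> l\<bar> = l ^ \<eta> * \<bar>sqrt 2 ^ \<eta> * sqrt pi * G - sqrt 2 * H / (real \<eta> + 1)\<bar>"
      using l by (simp add: abs_mult)
    also have "\<dots> \<le> l ^ \<eta> * (sqrt 2 ^ \<eta> * (sqrt pi * B + 2 * sqrt 2))"
      using X l by (intro mult_left_mono) auto
    finally show ?thesis by (simp add: power_mult_distrib mult_ac)
  qed
  then show ?thesis using B0 by (intro exI[of _ "sqrt pi * B + 2 * sqrt 2"]) simp
qed

section \<open>Summable majorants and the mean mass of a disc\<close>

locale network_params =
  fixes S :: network
  assumes valid: "valid_network S"
begin

sublocale network_geometry S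
  using valid by unfold_locales (auto simp: valid_network_def)

lemma lam_PH_nonneg: "0 \<le> lam_PH S" and lam_w_nonneg: "0 \<le> lam_w S"
  using valid by (auto simp: valid_network_def)

definition chi_const :: real where
  "chi_const = (SOME A. 0 \<le> A \<and> (\<forall>\<eta>. \<bar>chi \<eta> (lam_w S)\<bar> \<le> A * (sqrt 2 * lam_w S) ^ \<eta>))"

lemma chi_const: "0 \<le> chi_const" "\<bar>chi \<eta> (lam_w S)\<bar> \<le> chi_const * (sqrt 2 * lam_w S) ^ \<eta>"
proof -
  have "0 \<le> chi_const \<and> (\<forall>\<eta>. \<bar>chi \<eta> (lam_w S)\<bar> \<le> chi_const * (sqrt 2 * lam_w S) ^ \<eta>)"
    unfolding chi_const_def using chi_bound[OF lam_w_nonneg] by (rule someI_ex)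
  then show "0 \<le> chi_const" "\<bar>chi \<eta> (lam_w S)\<bar> \<le> chi_const * (sqrt 2 * lam_w S) ^ \<eta>" by blast+
qed

definition growth :: real where "growth = sqrt 2 * lam_w S * R_D S"

lemma growth_nonneg: "0 \<le> growth"
  using lam_w_nonneg R by (simp add: growth_def)

text \<open>Arises from summing \<open>\<bar>chi (N + k)\<bar> * R_D ^ (N + k + 2) / fact k\<close>
  over \<open>k\<close>, using \<open>chi_bound\<close>: the sum of
  \<open>growth ^ k / fact k\<close> is \<open>exp growth\<close>, and
  \<open>growth ^ N / fact N\<close> stays in front.\<close>

definition majorant :: "nat \<Rightarrow> real" where
  "majorant N = 4 * lam_PH S * chi_const * (R_D S)\<^sup>2 * exp growth * (growth ^ N / fact N)"

lemma majorant_nonneg: "0 \<le> majorant N"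
  unfolding majorant_def using lam_PH_nonneg chi_const growth_nonneg by (intro mult_nonneg_nonneg) auto

lemma summable_majorant: "summable majorant"
proof -
  have "summable (\<lambda>N. growth ^ N / fact N)"
    using summable_exp_generic[of growth] by (simp add: divide_inverse mult.commute)
  then show ?thesis unfolding majorant_def by (rule summable_mult)
qed

text \<open>The factorial outweighs \<open>1 / K ^ N\<close>. For \<open>K = 0\<close> the terms
  with \<open>N \<ge> 1\<close> are \<open>0\<close>, since division by \<open>0\<close> gives
  \<open>0\<close>.\<close>

lemma summable_majorant_div: "summable (\<lambda>N. majorant N / pen_loss S ^ N)"
proof -
  have "summable (\<lambda>N. (growth / pen_loss S) ^ N / fact N)"
    using summable_exp_generic[of "growth / pen_loss S"] by (simp add: divide_inverse mult.commute)
  then have "summable (\<lambda>N. (4 * lam_PH S * chi_const * (R_D S)\<^sup>2 * exp growth) * ((growth / pen_loss S) ^ N / fact N))"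
    by (rule summable_mult)
  then show ?thesis unfolding majorant_def power_divide by (simp add: mult_ac)
qed

definition coef :: "nat \<Rightarrow> nat \<Rightarrow> real" where
  "coef N k = (-1) ^ k * chi (N + k) (lam_w S) / (fact k * (real (N + k) + 2))"

text \<open>One estimate for all series of this shape. The denominator of \<open>coef\<close>
  cancels the factor \<open>real (N + k) + 2\<close>; the parameter \<open>c\<close> carries what
  varies between the uses: \<open>1\<close>, \<open>1 / R_D\<close>, \<open>min 1 (w / y)\<close>,
  or the factor of order \<open>1 / w\<close>.\<close>

lemma
  fixes d :: "nat \<Rightarrow> 'a::{real_normed_field, banach}"
  assumes d: "\<And>k. norm (d k) \<le> (real (N + k) + 2) * R_D S ^ (N + k + 2) * c" and c: "0 \<le> c"
  shows summable_coef_series: "summable (\<lambda>k. of_real (coef N k) * d k)"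
    and norm_coef_series_le:
      "norm (of_real (4 * lam_PH S / fact N) * (\<Sum>k. of_real (coef N k) * d k)) \<le> majorant N * c"
proof -
  let ?g = "\<lambda>k. chi_const * c * (R_D S)\<^sup>2 * growth ^ N * (growth ^ k / fact k)"
  have nb: "norm (of_real (coef N k) * d k) \<le> ?g k" for k
  proof -
    have "norm (of_real (coef N k) * d k) \<le> \<bar>coef N k\<bar> * ((real (N + k) + 2) * R_D S ^ (N + k + 2) * c)"
      unfolding norm_mult norm_of_real using d by (intro mult_left_mono) auto
    also have "\<dots> = \<bar>chi (N + k) (lam_w S)\<bar> / fact k * (R_D S ^ (N + k + 2) * c)"
    proof -
      have "\<bar>coef N k\<bar> = \<bar>chi (N + k) (lam_w S)\<bar> / fact k / (real (N + k) + 2)"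
        by (simp add: coef_def abs_mult power_abs)
      moreover have "real (N + k) + 2 \<noteq> 0" by linarith
      ultimately show ?thesis by simp
    qed
    also have "\<dots> \<le> chi_const * (sqrt 2 * lam_w S) ^ (N + k) / fact k * (R_D S ^ (N + k + 2) * c)"
      using chi_const R c by (intro mult_right_mono divide_right_mono) auto
    also have "\<dots> = ?g k"
      by (simp add: growth_def power_mult_distrib power_add power2_eq_square mult_ac)
    finally show ?thesis .
  qed
  have "(\<lambda>k. growth ^ k / fact k) sums exp growth"
    using exp_converges[of growth] by (simp add: divide_inverse mult.commute)
  then have gs: "?g sums (chi_const * c * (R_D S)\<^sup>2 * growth ^ N * exp growth)"
    by (rule sums_mult)
  show "summable (\<lambda>k. of_real (coef N k) * d k)"
    using nb sums_summable[OF gs] by (rule summable_norm_majorant)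
  have "norm (\<Sum>k. of_real (coef N k) * d k) \<le> suminf ?g"
    using nb sums_summable[OF gs] by (rule summable_norm_majorant)
  also have "\<dots> = chi_const * c * (R_D S)\<^sup>2 * growth ^ N * exp growth"
    using gs by (rule sums_unique[symmetric])
  finally have "4 * lam_PH S / fact N * norm (\<Sum>k. of_real (coef N k) * d k)
      \<le> 4 * lam_PH S / fact N * (chi_const * c * (R_D S)\<^sup>2 * growth ^ N * exp growth)"
    using lam_PH_nonneg by (intro mult_left_mono) auto
  also have "\<dots> = majorant N * c" by (simp add: majorant_def)
  finally show "norm (of_real (4 * lam_PH S / fact N) * (\<Sum>k. of_real (coef N k) * d k)) \<le> majorant N * c"
    unfolding norm_mult norm_of_real using lam_PH_nonneg by simp
qed

text \<open>In the model this is the mean number of transmitters behind \<open>N\<close> walls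
  within distance \<open>r\<close>, since \<open>chi \<eta>\<close> is \<open>lam_w ^ \<eta>\<close>
  times the integral of \<open>(cos \<theta> + sin \<theta>) ^ \<eta>\<close> over a quarter turn.
  The proof works with the power series only.\<close>

definition disc_mass :: "nat \<Rightarrow> real \<Rightarrow> real" where
  "disc_mass N r = 4 * lam_PH S / fact N * (\<Sum>k. coef N k * r ^ (N + k + 2))"

definition disc_mass' :: "nat \<Rightarrow> real \<Rightarrow> real" where
  "disc_mass' N r = 4 * lam_PH S / fact N * (\<Sum>k. coef N k * ((real (N + k) + 2) * r ^ (N + k + 1)))"

lemma power_disc_bound:
  assumes "r \<in> {0..R_D S}"
  shows "norm (r ^ (N + k + 2)) \<le> (real (N + k) + 2) * R_D S ^ (N + k + 2) * 1"
    "norm ((real (N + k) + 2) * r ^ (N + k + 1)) \<le> (real (N + k) + 2) * R_D S ^ (N + k + 2) * (1 / R_D S)"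
proof -
  have "r ^ (N + k + 2) \<le> R_D S ^ (N + k + 2)" using assms by (intro power_mono) auto
  also have "1 * R_D S ^ (N + k + 2) \<le> (real (N + k) + 2) * R_D S ^ (N + k + 2)"
    using R by (intro mult_right_mono) auto
  finally show "norm (r ^ (N + k + 2)) \<le> (real (N + k) + 2) * R_D S ^ (N + k + 2) * 1" using assms by simp
  have "r ^ (N + k + 1) \<le> R_D S ^ (N + k + 1)" using assms by (intro power_mono) auto
  then have "(real (N + k) + 2) * r ^ (N + k + 1) \<le> (real (N + k) + 2) * R_D S ^ (N + k + 1)"
    by (intro mult_left_mono) auto
  moreover have "R_D S ^ (N + k + 2) * (1 / R_D S) = R_D S ^ (N + k + 1)" using R by simp
  ultimately show "norm ((real (N + k) + 2) * r ^ (N + k + 1)) \<le> (real (N + k) + 2) * R_D S ^ (N + k + 2) * (1 / R_D S)"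
    unfolding mult.assoc using assms by (simp add: abs_mult)
qed

lemma abs_disc_mass_le: "r \<in> {0..R_D S} \<Longrightarrow> \<bar>disc_mass N r\<bar> \<le> majorant N"
  using norm_coef_series_le[of "\<lambda>k. r ^ (N + k + 2)" N 1] power_disc_bound(1)[of r N]
  by (simp add: disc_mass_def)

lemma abs_disc_mass'_le: "r \<in> {0..R_D S} \<Longrightarrow> \<bar>disc_mass' N r\<bar> \<le> majorant N / R_D S"
  using norm_coef_series_le[of "\<lambda>k. (real (N + k) + 2) * r ^ (N + k + 1)" N "1 / R_D S"] power_disc_bound(2)[of r N] R
  by (simp add: disc_mass'_def)

lemma summable_coef_abs: "summable (\<lambda>k. \<bar>coef N k\<bar> * ((real (N + k) + 2) * R_D S ^ (N + k + 2) * c))"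
  if "0 \<le> c"
proof -
  \<comment> \<open>Giving the second factor the sign of the coefficient turns the series into that
    of the absolute values.\<close>
  have "summable (\<lambda>k. of_real (coef N k) * (of_real (sgn (coef N k)) * ((real (N + k) + 2) * R_D S ^ (N + k + 2) * c)) :: real)"
    by (rule summable_coef_series[where c = c]) (use that R in \<open>auto simp: abs_mult abs_sgn_eq\<close>)
  then show ?thesis by (simp add: abs_sgn mult_ac)
qed

lemma continuous_on_disc_mass: "continuous_on {0..R_D S} (disc_mass N)"
proof -
  have "continuous_on {0..R_D S} (\<lambda>r. \<Sum>k. coef N k * r ^ (N + k + 2))"
  proof (rule uniform_limit_theorem)
    show "uniform_limit {0..R_D S} (\<lambda>n r. \<Sum>k<n. coef N k * r ^ (N + k + 2))
        (\<lambda>r. \<Sum>k. coef N k * r ^ (N + k + 2)) sequentially"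
    proof (rule Weierstrass_m_test[OF _ summable_coef_abs[of 1 N]])
      fix k r assume "r \<in> {0..R_D S}"
      then show "norm (coef N k * r ^ (N + k + 2)) \<le> \<bar>coef N k\<bar> * ((real (N + k) + 2) * R_D S ^ (N + k + 2) * 1)"
        unfolding norm_mult[of "coef N k"] real_norm_def[of "coef N k"]
        by (intro mult_left_mono power_disc_bound) auto
    qed simp
  qed (auto intro!: always_eventually continuous_intros)
  then show ?thesis unfolding disc_mass_def by (intro continuous_intros)
qed

lemma DERIV_disc_mass:
  assumes r: "0 < r" "r < R_D S"
  shows "(disc_mass N has_real_derivative disc_mass' N r) (at r)"
proof -
  have "((\<lambda>r. \<Sum>k. coef N k * r ^ (N + k + 2)) has_real_derivative
      (\<Sum>k. coef N k * ((real (N + k) + 2) * r ^ (N + k + 1)))) (at r)"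
  proof (rule has_field_derivative_series'(2)[where S = "{0..R_D S}" and ?x0.0 = 0
        and f = "\<lambda>k r. coef N k * r ^ (N + k + 2)" and f' = "\<lambda>k r. coef N k * ((real (N + k) + 2) * r ^ (N + k + 1))"])
    show "((\<lambda>r. coef N k * r ^ (N + k + 2)) has_real_derivative coef N k * ((real (N + k) + 2) * x ^ (N + k + 1))) (at x within {0..R_D S})" for k x
      using DERIV_cmult[OF DERIV_pow[of "N + k + 2" x "{0..R_D S}"], of "coef N k"]
      by (simp add: add_ac)
    show "uniformly_convergent_on {0..R_D S} (\<lambda>n x. \<Sum>k<n. coef N k * ((real (N + k) + 2) * x ^ (N + k + 1)))"
    proof (rule Weierstrass_m_test'[OF _ summable_coef_abs[of "1 / R_D S" N]])
      fix k r assume "r \<in> {0..R_D S}"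
      then show "norm (coef N k * ((real (N + k) + 2) * r ^ (N + k + 1)))
          \<le> \<bar>coef N k\<bar> * ((real (N + k) + 2) * R_D S ^ (N + k + 2) * (1 / R_D S))"
        unfolding norm_mult[of "coef N k"] real_norm_def[of "coef N k"]
        by (intro mult_left_mono power_disc_bound) auto
    qed (use R in simp)
    show "summable (\<lambda>k. coef N k * 0 ^ (N + k + 2))" by simp
  qed (use r R in auto)
  then show ?thesis unfolding disc_mass_def disc_mass'_def by (rule DERIV_cmult)
qed

section \<open>The intensity as a function of the path loss: continuity and derivative\<close>

lemma below_edge_iff:
  assumes "0 \<le> y"
  shows "below_edge S N y \<longleftrightarrow> radius N y < R_D S"
proof
  assume *: "radius N y < R_D S"
  then have "radius N y powr path_exp S < R_D S powr path_exp S"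
    using beta by (intro powr_less_mono2) auto
  then have "kappa S * radius N y powr path_exp S < kappa S * R_D S powr path_exp S"
    using kappa by simp
  then show "below_edge S N y" using assms by (simp add: radius_powr below_edge_def mult.commute)
qed (use radius_less assms in blast)

text \<open>Being below the edge means that the inner radius is less than \<open>R_D\<close>, so
  capping the radius at \<open>R_D\<close> merges the two cases of the definition.\<close>

lemma Lam_N_eq:
  assumes "0 \<le> y"
  shows "Lam_N S N y = disc_mass N (min (R_D S) (radius N y))"
proof -
  have "(y * pen_loss S ^ N / kappa S) powr ((real (N + k) + 2) / path_exp S) = radius N y ^ (N + k + 2)" for k
  proof (cases "y * pen_loss S ^ N / kappa S = 0")
    case True
    show ?thesis unfolding inner_radius_def True by simp
  next
    case False
    then have p: "0 < radius N y" unfolding inner_radius_def powr_gt_zero .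
    have "radius N y ^ (N + k + 2) = radius N y powr (real (N + k + 2))" by (rule powr_realpow[OF p, symmetric])
    also have "real (N + k + 2) = real (N + k) + 2" by simp
    finally show ?thesis by (simp only: inner_radius_def powr_powr times_divide_eq_left mult_1)
  qed
  then have "(if below_edge S N y then (y * pen_loss S ^ N / kappa S) powr ((real (N + k) + 2) / path_exp S)
      else R_D S ^ (N + k + 2)) = min (R_D S) (radius N y) ^ (N + k + 2)" for k
    using below_edge_iff[OF assms, of N] by (simp add: min_def)
  then show ?thesis unfolding Lam_N_def disc_mass_def Let_def coef_def by simp
qed

abbreviation present :: "nat \<Rightarrow> bool" where "present N \<equiv> enat N \<le> N_max S"

lemma abs_Lam_N_le: "0 \<le> y \<Longrightarrow> \<bar>Lam_N S N y\<bar> \<le> majorant N"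
  using R by (simp add: Lam_N_eq abs_disc_mass_le)

lemma summable_Lam: "0 \<le> y \<Longrightarrow> summable (\<lambda>N. if present N then Lam_N S N y else 0)"
  by (rule summable_norm_majorant[OF _ summable_majorant]) (use abs_Lam_N_le majorant_nonneg in auto)

lemma prodinf_exp_Lam:
  assumes "0 \<le> y"
  shows "(\<Prod>N. if present N then exp (- Lam_N S N y) else 1) = exp (- Lam S y)"
proof -
  have "(\<Prod>N. if present N then exp (- Lam_N S N y) else 1)
      = (\<Prod>N. exp (- (if present N then Lam_N S N y else 0)))"
    by (intro arg_cong[where f = prodinf]) auto
  also have "\<dots> = exp (\<Sum>N. - (if present N then Lam_N S N y else 0))"
    by (intro prodinf_exp summable_minus summable_Lam assms)
  also have "\<dots> = exp (- Lam S y)"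
    unfolding Lam_def by (simp only: suminf_minus[OF summable_Lam[OF assms]])
  finally show ?thesis .
qed

lemma Lam_0: "Lam S 0 = 0"
proof -
  have "Lam_N S N 0 = 0" for N
    using R by (simp add: Lam_N_eq inner_radius_def disc_mass_def)
  then have "(if present N then Lam_N S N 0 else 0) = 0" for N by auto
  then show ?thesis by (simp only: Lam_def suminf_zero)
qed

text \<open>Covers the edges and \<open>0\<close> as well, where no derivative is available; the
  fundamental theorem of calculus can then be applied across them.\<close>

lemma continuous_on_Lam: "continuous_on {0..} (Lam S)"
proof -
  have c: "continuous_on {0..} (\<lambda>y. disc_mass N (min (R_D S) (radius N y)))" for N
  proof (rule continuous_on_compose2[OF continuous_on_disc_mass])
    show "continuous_on {0..} (\<lambda>y. min (R_D S) (radius N y))"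
      unfolding inner_radius_def using beta kappa K0
      by (intro continuous_intros continuous_on_powr') auto
  qed (use R in auto)
  have "continuous_on {0..} (\<lambda>y. \<Sum>N. if present N then disc_mass N (min (R_D S) (radius N y)) else 0)"
  proof (rule uniform_limit_theorem)
    show "uniform_limit {0..} (\<lambda>n y. \<Sum>N<n. if present N then disc_mass N (min (R_D S) (radius N y)) else 0)
        (\<lambda>y. \<Sum>N. if present N then disc_mass N (min (R_D S) (radius N y)) else 0) sequentially"
      by (rule Weierstrass_m_test[OF _ summable_majorant])
        (use abs_disc_mass_le majorant_nonneg R in auto)
    have "continuous_on {0..} (\<lambda>y. if present N then disc_mass N (min (R_D S) (radius N y)) else 0)" for N
      by (cases "present N") (use c in auto)
    then show "\<forall>\<^sub>F n in sequentially. continuous_on {0..}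
        (\<lambda>y. \<Sum>N<n. if present N then disc_mass N (min (R_D S) (radius N y)) else 0)"
      by (intro always_eventually allI continuous_on_sum)
  qed simp
  moreover have "Lam S y = (\<Sum>N. if present N then disc_mass N (min (R_D S) (radius N y)) else 0)" if "y \<in> {0..}" for y
    unfolding Lam_def using that by (intro suminf_cong) (simp add: Lam_N_eq)
  ultimately show ?thesis by (subst continuous_on_cong[OF refl]) auto
qed

text \<open>The path losses attained on the rim of the disc for some number of walls. At such a
  point the derivative of \<open>Lam_N\<close> may jump.\<close>

definition edges :: "real set" where
  "edges = {y. \<exists>N. y * pen_loss S ^ N = R_D S powr path_exp S * kappa S}"

text \<open>Since \<open>K < 1\<close>, the powers \<open>K ^ N\<close> tend to \<open>0\<close>,
  and for large \<open>N\<close> the edge lies beyond \<open>a\<close>.\<close>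

lemma finite_edges: "finite (edges \<inter> {0..a})"
proof (cases "0 \<le> a")
  case True
  let ?E = "R_D S powr path_exp S * kappa S"
  have E: "0 < ?E" using R kappa by simp
  have "(\<lambda>N. a * pen_loss S ^ N) \<longlonglongrightarrow> a * 0"
    by (intro tendsto_intros LIMSEQ_power_zero) (use K0 K1 in auto)
  then have "\<forall>\<^sub>F N in sequentially. a * pen_loss S ^ N < ?E"
    using E by (intro order_tendstoD(2)) auto
  then obtain n where n: "\<And>N. N \<ge> n \<Longrightarrow> a * pen_loss S ^ N < ?E"
    by (auto simp: eventually_sequentially)
  have "edges \<inter> {0..a} \<subseteq> (\<lambda>N. ?E / pen_loss S ^ N) ` {..<n}"
  proof
    fix y assume y: "y \<in> edges \<inter> {0..a}"
    then obtain N where N: "y * pen_loss S ^ N = ?E" by (auto simp: edges_def)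
    have "y * pen_loss S ^ N \<le> a * pen_loss S ^ N"
      using y K0 by (intro mult_right_mono) auto
    then have "N < n" using n[of N] N by (cases "N < n") auto
    moreover have "pen_loss S ^ N \<noteq> 0" using N E by (metis less_irrefl mult_zero_right)
    then have "y = ?E / pen_loss S ^ N" using N by (metis nonzero_mult_div_cancel_right)
    ultimately show "y \<in> (\<lambda>N. ?E / pen_loss S ^ N) ` {..<n}" by blast
  qed
  then show ?thesis by (rule finite_subset) simp
qed simp

text \<open>Chain rule: \<open>radius N y / (path_exp S * y)\<close> is the derivative of
  \<open>radius N\<close> at a positive \<open>y\<close>.\<close>

definition Lam_N' :: "nat \<Rightarrow> real \<Rightarrow> real" where
  "Lam_N' N y = (if below_edge S N y then disc_mass' N (radius N y) * (radius N y / (path_exp S * y)) else 0)"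

definition Lam' :: "real \<Rightarrow> real" where
  "Lam' y = (\<Sum>N. if present N then Lam_N' N y else 0)"

lemma Lam'_measurable [measurable]: "Lam' \<in> borel_measurable borel"
  unfolding Lam'_def Lam_N'_def disc_mass'_def below_edge_def by measurable

lemma abs_Lam_N'_le:
  assumes "0 < y"
  shows "\<bar>Lam_N' N y\<bar> \<le> majorant N / (path_exp S * y)"
proof (cases "below_edge S N y")
  case True
  then have r: "radius N y \<in> {0..R_D S}" using below_edge_iff[of y N] assms by auto
  have "\<bar>Lam_N' N y\<bar> = \<bar>disc_mass' N (radius N y)\<bar> * (radius N y / (path_exp S * y))"
    using True assms beta by (simp add: Lam_N'_def abs_mult)
  also have "\<dots> \<le> (majorant N / R_D S) * (R_D S / (path_exp S * y))"
    using abs_disc_mass'_le[OF r, of N] r assms beta majorant_nonneg R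
    by (intro mult_mono divide_right_mono) auto
  finally show ?thesis using R by simp
next
  case False
  then show ?thesis using majorant_nonneg assms beta by (simp add: Lam_N'_def)
qed

lemma DERIV_Lam_N:
  assumes y: "0 < y" "y * pen_loss S ^ N \<noteq> R_D S powr path_exp S * kappa S"
  shows "(Lam_N S N has_real_derivative Lam_N' N y) (at y)"
proof -
  have ev0: "\<forall>\<^sub>F z in nhds y. 0 < z"
    using y by (intro eventually_nhds_in_open[of "{0<..}", simplified]) auto
  have t: "((\<lambda>z. z * pen_loss S ^ N) \<longlongrightarrow> y * pen_loss S ^ N) (nhds y)"
    by (intro tendsto_intros filterlim_ident)
  consider "pen_loss S ^ N = 0" | "pen_loss S ^ N > 0" "below_edge S N y" | "pen_loss S ^ N > 0" "\<not> below_edge S N y"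
    using zero_le_power[OF K0, of N] by linarith
  then show ?thesis
  proof cases
    case 1
    have r: "radius N z = 0" for z unfolding inner_radius_def 1 by simp
    have "\<forall>\<^sub>F z in nhds y. Lam_N S N z = disc_mass N 0"
      using ev0 by eventually_elim (use R in \<open>simp add: Lam_N_eq r\<close>)
    moreover have "((\<lambda>z. disc_mass N 0) has_real_derivative 0) (at y)" by simp
    ultimately show ?thesis
      by (subst DERIV_cong_ev[OF refl]) (auto simp: Lam_N'_def r)
  next
    case 2
    then have ry: "radius N y < R_D S" using below_edge_iff y by auto
    have "0 < y * pen_loss S ^ N / kappa S" using 2 y kappa by (intro divide_pos_pos mult_pos_pos)
    then have rp: "0 < radius N y" unfolding inner_radius_def powr_gt_zero by linarith
    have "\<forall>\<^sub>F z in nhds y. z * pen_loss S ^ N < R_D S powr path_exp S * kappa S"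
      using 2 t by (intro order_tendstoD(2)[OF t]) (simp add: below_edge_def)
    then have ev: "\<forall>\<^sub>F z in nhds y. Lam_N S N z = disc_mass N (radius N z)"
      using ev0
    proof eventually_elim
      case (elim z)
      then have "radius N z < R_D S" using below_edge_iff[of z N] by (simp add: below_edge_def)
      then show ?case using elim by (simp add: Lam_N_eq min_def)
    qed
    have dr: "(radius N has_real_derivative (radius N y / (path_exp S * y))) (at y)"
    proof -
      have p: "0 < y * pen_loss S ^ N / kappa S" using 2 y kappa by (intro divide_pos_pos mult_pos_pos)
      have "((\<lambda>z. (z * pen_loss S ^ N / kappa S) powr (1 / path_exp S)) has_real_derivative
         (1 / path_exp S) * (y * pen_loss S ^ N / kappa S) powr (1 / path_exp S - 1) * (pen_loss S ^ N / kappa S)) (at y)"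
        using p by (auto intro!: derivative_eq_intros simp: kappa[THEN less_imp_neq, symmetric])
      moreover have "(1 / path_exp S) * (y * pen_loss S ^ N / kappa S) powr (1 / path_exp S - 1) * (pen_loss S ^ N / kappa S)
         = radius N y / (path_exp S * y)"
      proof -
        have "(y * pen_loss S ^ N / kappa S) powr (1 / path_exp S - 1) = radius N y / (y * pen_loss S ^ N / kappa S)"
        proof -
          have "x powr (1 / path_exp S - 1) = x powr (1 / path_exp S) / x" if "0 < x" for x :: real
            using that by (simp add: powr_diff)
          then show ?thesis unfolding inner_radius_def using p by blast
        qed
        moreover have "pen_loss S ^ N / kappa S = (y * pen_loss S ^ N / kappa S) / y" using y by simp
        moreover have "(1 / b) * (r / x) * (x / z) = r / (b * z)" if "x \<noteq> 0" for b r x z :: real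
          using that by simp
        ultimately show ?thesis using p by (metis order_less_irrefl)
      qed
      ultimately show ?thesis unfolding inner_radius_def[abs_def] by simp
    qed
    have "((\<lambda>z. disc_mass N (radius N z)) has_real_derivative disc_mass' N (radius N y) * (radius N y / (path_exp S * y))) (at y)"
      using DERIV_chain2[OF DERIV_disc_mass[OF rp ry] dr] .
    then show ?thesis
      by (subst DERIV_cong_ev[OF refl ev refl]) (use 2 in \<open>simp add: Lam_N'_def\<close>)
  next
    case 3
    then have "R_D S powr path_exp S * kappa S < y * pen_loss S ^ N"
      using y by (auto simp: below_edge_def)
    then have "\<forall>\<^sub>F z in nhds y. R_D S powr path_exp S * kappa S < z * pen_loss S ^ N"
      by (intro order_tendstoD(1)[OF t])
    then have ev: "\<forall>\<^sub>F z in nhds y. Lam_N S N z = disc_mass N (R_D S)"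
      using ev0
    proof eventually_elim
      case (elim z)
      then have "\<not> radius N z < R_D S" using below_edge_iff[of z N] by (simp add: below_edge_def)
      then show ?case using elim by (simp add: Lam_N_eq min_def)
    qed
    have "((\<lambda>z. disc_mass N (R_D S)) has_real_derivative 0) (at y)" by simp
    then show ?thesis
      by (subst DERIV_cong_ev[OF refl ev refl]) (use 3 in \<open>simp add: Lam_N'_def\<close>)
  qed
qed

lemma DERIV_Lam:
  assumes y: "0 < y" "y \<notin> edges"
  shows "(Lam S has_real_derivative Lam' y) (at y)"
proof -
  \<comment> \<open>Local finiteness yields a ball that avoids the edges of all \<open>N\<close> at
    once. Staying above \<open>y / 2\<close> makes the bound
    \<open>majorant N / (path_exp S * z)\<close> uniform on it.\<close>
  have "closed (edges \<inter> {0..2 * y})" by (rule finite_imp_closed[OF finite_edges])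
  then have "open (- (edges \<inter> {0..2 * y}) \<inter> {y / 2<..<2 * y})" by (intro open_Int open_Compl open_greaterThanLessThan)
  moreover have "y \<in> - (edges \<inter> {0..2 * y}) \<inter> {y / 2<..<2 * y}" using y by auto
  ultimately obtain e where e: "0 < e" "ball y e \<subseteq> - (edges \<inter> {0..2 * y}) \<inter> {y / 2<..<2 * y}"
    by (rule openE)
  have z: "y / 2 < z" "z \<notin> edges" if "z \<in> ball y e" for z
    using subsetD[OF e(2) that] y by auto
  have "((\<lambda>z. \<Sum>N. if present N then Lam_N S N z else 0) has_real_derivative
      (\<Sum>N. if present N then Lam_N' N y else 0)) (at y)"
  proof (rule has_field_derivative_series'(2)[where S = "ball y e" and ?x0.0 = y
        and f = "\<lambda>N z. if present N then Lam_N S N z else 0" and f' = "\<lambda>N z. if present N then Lam_N' N z else 0"])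
    fix N z assume zb: "z \<in> ball y e"
    have "(Lam_N S N has_real_derivative Lam_N' N z) (at z)"
      by (rule DERIV_Lam_N) (use z[OF zb] y in \<open>auto simp: edges_def\<close>)
    then show "((\<lambda>z. if present N then Lam_N S N z else 0) has_real_derivative (if present N then Lam_N' N z else 0)) (at z within ball y e)"
      by (cases "present N") (auto intro: has_field_derivative_at_within)
  next
    show "uniformly_convergent_on (ball y e) (\<lambda>n z. \<Sum>N<n. if present N then Lam_N' N z else 0)"
    proof (rule Weierstrass_m_test')
      show "summable (\<lambda>N. majorant N * (2 / (path_exp S * y)))"
        by (intro summable_mult2 summable_majorant)
      fix N z assume zb: "z \<in> ball y e"
      have zp: "0 < z" using z[OF zb] y by linarith
      have "\<bar>Lam_N' N z\<bar> \<le> majorant N / (path_exp S * z)" by (rule abs_Lam_N'_le[OF zp])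
      also have "\<dots> \<le> majorant N / (path_exp S * (y / 2))"
        using z[OF zb] y beta majorant_nonneg zp by (intro divide_left_mono mult_left_mono mult_pos_pos) auto
      finally show "norm (if present N then Lam_N' N z else 0) \<le> majorant N * (2 / (path_exp S * y))"
        using majorant_nonneg[of N] y beta by auto
    qed
    show "summable (\<lambda>N. if present N then Lam_N S N y else 0)" using y by (intro summable_Lam) simp
  qed (use e in \<open>auto simp: interior_open\<close>)
  then show ?thesis unfolding Lam_def[abs_def] Lam'_def .
qed

lemma has_integral_Lam_density:
  assumes "0 \<le> a"
  shows "((\<lambda>y. Lam' y * exp (- Lam S y)) has_integral (1 - exp (- Lam S a))) {0..a}"
proof -
  have "((\<lambda>y. Lam' y * exp (- Lam S y)) has_integral (- exp (- Lam S a) - (- exp (- Lam S 0)))) {0..a}"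
  proof (rule fundamental_theorem_of_calculus_interior_strong)
    show "finite (edges \<inter> {0..a})" by (rule finite_edges)
    show "continuous_on {0..a} (\<lambda>y. - exp (- Lam S y))"
      using continuous_on_subset[OF continuous_on_Lam, of "{0..a}"] by (intro continuous_intros) auto
    fix y assume y: "y \<in> {0<..<a} - edges \<inter> {0..a}"
    have "((\<lambda>y. - exp (- Lam S y)) has_real_derivative Lam' y * exp (- Lam S y)) (at y)"
      using DERIV_Lam[of y] y by (auto intro!: derivative_eq_intros)
    then show "((\<lambda>y. - exp (- Lam S y)) has_vector_derivative Lam' y * exp (- Lam S y)) (at y)"
      by (simp add: has_real_derivative_iff_has_vector_derivative)
  qed fact
  then show ?thesis by (simp add: Lam_0)
qed

end

subsection \<open>Bounds for the function \<open>\<Phi>\<close>\<close>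

lemma norm_exp_minus_1_le:
  fixes z :: "'a::{real_normed_field, banach}"
  shows "norm (exp z - 1) \<le> norm z * exp (norm z)"
proof -
  have s: "(\<lambda>n. z ^ Suc n /\<^sub>R fact (Suc n)) sums (exp z - 1)"
    using sums_Suc_iff[of "\<lambda>n. z ^ n /\<^sub>R fact n" "exp z - 1"] exp_converges[of z] by simp
  have e: "(\<lambda>n. norm z * (norm z ^ n /\<^sub>R fact n)) sums (norm z * exp (norm z))"
    by (intro sums_mult exp_converges)
  have "norm (\<Sum>n. z ^ Suc n /\<^sub>R fact (Suc n)) \<le> (\<Sum>n. norm z * (norm z ^ n /\<^sub>R fact n))"
  proof (rule summable_norm_majorant[OF _ sums_summable[OF e]])
    fix n
    have "inverse (fact (Suc n) :: real) \<le> inverse (fact n)"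
      by (intro le_imp_inverse_le fact_mono) auto
    then have "inverse (fact (Suc n)) * norm z ^ Suc n \<le> inverse (fact n) * norm z ^ Suc n"
      by (intro mult_right_mono) auto
    then show "norm (z ^ Suc n /\<^sub>R fact (Suc n)) \<le> norm z * (norm z ^ n /\<^sub>R fact n)"
      by (simp add: norm_power norm_mult mult_ac del: fact_Suc)
  qed
  then show ?thesis using sums_unique[OF s] sums_unique[OF e] by simp
qed

context network_params
begin

definition walls_exponent :: "nat \<Rightarrow> real \<Rightarrow> real \<Rightarrow> complex" where
  "walls_exponent N w y = of_real (4 * lam_PH S / fact N) *
     (\<Sum>k. of_real (coef N k) * Delta S (N + k) N w y)"

definition walls_limit :: "nat \<Rightarrow> real \<Rightarrow> real" where
  "walls_limit N y = 4 * lam_PH S / fact N * (\<Sum>k. coef N k * Delta_limit (N + k) N y)"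

lemma norm_walls_exponent_le:
  assumes "below_edge S N y" "0 < y" "0 \<le> w"
  shows "norm (walls_exponent N w y) \<le> majorant N * min 1 (w / y)"
  unfolding walls_exponent_def
  by (rule norm_coef_series_le, rule norm_Delta_le[OF assms]) (use assms in auto)

lemma abs_walls_limit_le:
  assumes "below_edge S N y" "0 < y"
  shows "\<bar>walls_limit N y\<bar> \<le> majorant N"
proof -
  have "norm (of_real (4 * lam_PH S / fact N) * (\<Sum>k. of_real (coef N k) * Delta_limit (N + k) N y)) \<le> majorant N * 1"
    by (rule norm_coef_series_le) (use abs_Delta_limit_le[OF assms] in \<open>simp_all only: real_norm_def mult_1_right zero_le_one\<close>)
  then show ?thesis by (simp add: walls_limit_def)
qed

lemma norm_walls_exponent_minus_limit_le:
  assumes "below_edge S N y" "0 < y" "0 < w"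
  shows "norm (walls_exponent N w y - of_real (walls_limit N y))
    \<le> majorant N / pen_loss S ^ N * (kappa S * R_D S powr path_exp S / w)"
proof -
  have s1: "summable (\<lambda>k. of_real (coef N k) * Delta S (N + k) N w y)"
    by (rule summable_coef_series, rule norm_Delta_le[OF assms(1,2)]) (use assms in auto)
  have s2: "summable (\<lambda>k. coef N k * Delta_limit (N + k) N y)"
  proof -
    have "summable (\<lambda>k. of_real (coef N k) * Delta_limit (N + k) N y)"
      by (rule summable_coef_series[where c = 1]) (use abs_Delta_limit_le[OF assms(1,2)] in \<open>simp_all only: real_norm_def mult_1_right zero_le_one\<close>)
    then show ?thesis by simp
  qed
  then have s3: "(\<lambda>k. complex_of_real (coef N k) * of_real (Delta_limit (N + k) N y)) sums
      of_real (\<Sum>k. coef N k * Delta_limit (N + k) N y)"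
    by (metis (no_types, lifting) of_real_mult sums_cong sums_of_real summable_sums)
  have "walls_exponent N w y - of_real (walls_limit N y) = of_real (4 * lam_PH S / fact N) *
     ((\<Sum>k. of_real (coef N k) * Delta S (N + k) N w y) - (\<Sum>k. of_real (coef N k) * of_real (Delta_limit (N + k) N y)))"
    unfolding walls_exponent_def walls_limit_def of_real_mult[of "4 * lam_PH S / fact N"] sums_unique[OF s3, symmetric]
    by (simp only: right_diff_distrib)
  also have "\<dots> = of_real (4 * lam_PH S / fact N) *
     (\<Sum>k. of_real (coef N k) * (Delta S (N + k) N w y - of_real (Delta_limit (N + k) N y)))"
    unfolding suminf_diff[OF s1 sums_summable[OF s3]] by (simp only: right_diff_distrib)
  also have "norm \<dots> \<le> majorant N * (kappa S * R_D S powr path_exp S / (w * pen_loss S ^ N))"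
    by (rule norm_coef_series_le, rule norm_Delta_minus_limit_le[OF assms]) (use kappa K0 assms in auto)
  finally show ?thesis by (simp add: mult_ac)
qed

definition Phi_exponent :: "real \<Rightarrow> real \<Rightarrow> complex" where
  "Phi_exponent w y = (\<Sum>N. if present N \<and> below_edge S N y then walls_exponent N w y else 0)"

text \<open>The constant called \<open>p\<close> in the expansion of \<open>U\<close> at infinity.
  The parameter \<open>p\<close> of \<open>gil_pelaez\<close> is its exponential.\<close>

definition Phi_limit :: "real \<Rightarrow> real" where
  "Phi_limit y = (\<Sum>N. if present N \<and> below_edge S N y then walls_limit N y else 0)"

lemma
  assumes y: "0 < y" and w: "0 \<le> w"
  shows summable_walls_exponent:
      "summable (\<lambda>N. if present N \<and> below_edge S N y then walls_exponent N w y else 0)"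
    and norm_Phi_exponent_le: "norm (Phi_exponent w y) \<le> suminf majorant * min 1 (w / y)"
proof -
  have b: "norm (if present N \<and> below_edge S N y then walls_exponent N w y else 0) \<le> majorant N * min 1 (w / y)" for N
    using norm_walls_exponent_le[OF _ y w, of N] majorant_nonneg[of N] y w by auto
  have s: "summable (\<lambda>N. majorant N * min 1 (w / y))" by (intro summable_mult2 summable_majorant)
  show "summable (\<lambda>N. if present N \<and> below_edge S N y then walls_exponent N w y else 0)"
    using b s by (rule summable_norm_majorant)
  show "norm (Phi_exponent w y) \<le> suminf majorant * min 1 (w / y)"
    unfolding Phi_exponent_def suminf_mult2[OF summable_majorant] using b s by (rule summable_norm_majorant)
qed

lemma
  assumes y: "0 < y"
  shows summable_walls_limit: "summable (\<lambda>N. if present N \<and> below_edge S N y then walls_limit N y else 0)"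
    and abs_Phi_limit_le: "\<bar>Phi_limit y\<bar> \<le> suminf majorant"
proof -
  have b: "norm (if present N \<and> below_edge S N y then walls_limit N y else 0) \<le> majorant N" for N
    using abs_walls_limit_le[OF _ y, of N] majorant_nonneg[of N] by auto
  show "summable (\<lambda>N. if present N \<and> below_edge S N y then walls_limit N y else 0)"
    using b summable_majorant by (rule summable_norm_majorant)
  show "\<bar>Phi_limit y\<bar> \<le> suminf majorant"
    unfolding Phi_limit_def using summable_norm_majorant(2)[OF b summable_majorant] by simp
qed

lemma norm_Phi_exponent_minus_limit_le:
  assumes y: "0 < y" and w: "0 < w"
  shows "norm (Phi_exponent w y - of_real (Phi_limit y))
    \<le> (\<Sum>N. majorant N / pen_loss S ^ N) * (kappa S * R_D S powr path_exp S) / w"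
proof -
  let ?u = "\<lambda>N. if present N \<and> below_edge S N y then walls_exponent N w y else 0"
  let ?p = "\<lambda>N. if present N \<and> below_edge S N y then walls_limit N y else 0"
  let ?c = "kappa S * R_D S powr path_exp S / w"
  have c: "0 \<le> ?c" using kappa w by simp
  have b: "norm (?u N - of_real (?p N)) \<le> majorant N / pen_loss S ^ N * ?c" for N
  proof (cases "present N \<and> below_edge S N y")
    case True
    then show ?thesis using norm_walls_exponent_minus_limit_le[OF _ y w, of N] by (simp only: if_True simp_thms)
  next
    case False
    have "0 \<le> majorant N / pen_loss S ^ N * ?c"
      by (rule mult_nonneg_nonneg[OF divide_nonneg_nonneg[OF majorant_nonneg zero_le_power[OF K0]] c])
    then show ?thesis using False by (simp only: if_False of_real_0 diff_self norm_zero)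
  qed
  have s: "summable (\<lambda>N. majorant N / pen_loss S ^ N * ?c)" by (intro summable_mult2 summable_majorant_div)
  have p: "(\<lambda>N. complex_of_real (?p N)) sums of_real (Phi_limit y)"
    unfolding Phi_limit_def by (intro sums_of_real summable_sums summable_walls_limit y)
  have "Phi_exponent w y - of_real (Phi_limit y) = (\<Sum>N. ?u N) - (\<Sum>N. of_real (?p N))"
    unfolding Phi_exponent_def sums_unique[OF p, symmetric] ..
  also have "\<dots> = (\<Sum>N. ?u N - of_real (?p N))"
    by (rule suminf_diff[OF summable_walls_exponent[OF y less_imp_le[OF w]] sums_summable[OF p]])
  also have "norm \<dots> \<le> (\<Sum>N. majorant N / pen_loss S ^ N * ?c)"
    using b s by (rule summable_norm_majorant)
  also have "\<dots> = (\<Sum>N. majorant N / pen_loss S ^ N) * ?c"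
    by (rule suminf_mult2[OF summable_majorant_div, symmetric])
  finally show ?thesis by simp
qed

lemma Phi_eq_exp:
  assumes y: "0 < y" and w: "0 \<le> w"
  shows "Phi S w y = exp (Phi_exponent w y)"
proof -
  have "Phi_N S N w y = exp (if below_edge S N y then walls_exponent N w y else 0)" for N
    by (simp add: Phi_N_def walls_exponent_def coef_def Let_def)
  then have "Phi S w y = (\<Prod>N. exp (if present N \<and> below_edge S N y then walls_exponent N w y else 0))"
    unfolding Phi_def by (intro arg_cong[where f = prodinf]) auto
  also have "\<dots> = exp (Phi_exponent w y)"
    unfolding Phi_exponent_def by (intro prodinf_exp summable_walls_exponent y w)
  finally show ?thesis .
qed

lemma Phi_bounds:
  assumes y: "0 < y"
  obtains B p :: real where "0 < B"
    "\<And>w. 0 < w \<Longrightarrow> norm (Phi S w y) \<le> B"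
    "\<And>w. 0 < w \<Longrightarrow> norm (Phi S w y - 1) \<le> B * w"
    "\<And>w. 1 \<le> w \<Longrightarrow> norm (Phi S w y - of_real p) \<le> B / w"
proof -
  define M where "M = suminf majorant"
  define D where "D = (\<Sum>N. majorant N / pen_loss S ^ N) * (kappa S * R_D S powr path_exp S)"
  have M: "0 \<le> M" unfolding M_def by (intro suminf_nonneg summable_majorant majorant_nonneg)
  have D: "0 \<le> D" unfolding D_def using kappa K0
    by (intro mult_nonneg_nonneg suminf_nonneg summable_majorant_div divide_nonneg_nonneg majorant_nonneg) auto
  have e1: "norm (Phi_exponent w y) \<le> M" "norm (Phi_exponent w y) \<le> M / y * w" if "0 < w" for w
  proof -
    have *: "norm (Phi_exponent w y) \<le> M * min 1 (w / y)"
      using norm_Phi_exponent_le[OF y, of w] that by (simp add: M_def)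
    have "M * min 1 (w / y) \<le> M * 1" "M * min 1 (w / y) \<le> M * (w / y)"
      using M by (intro mult_left_mono; simp)+
    then show "norm (Phi_exponent w y) \<le> M" "norm (Phi_exponent w y) \<le> M / y * w" using * by simp_all
  qed
  \<comment> \<open>One summand for each estimate: \<open>exp M\<close> for boundedness, the third
    near \<open>0\<close>, the fourth at infinity; the \<open>1\<close> makes \<open>B\<close>
    positive. The dependence on \<open>y\<close> enters through \<open>M / y\<close>.\<close>
  define B where "B = 1 + exp M + M / y * exp M + exp M * (D * exp D)"
  have nn: "0 \<le> M / y * exp M" "0 \<le> exp M * (D * exp D)" using M D y by auto
  have 1: "norm (Phi S w y) \<le> B" if "0 < w" for w
  proof -
    have "norm (Phi S w y) \<le> exp (norm (Phi_exponent w y))"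
      unfolding Phi_eq_exp[OF y less_imp_le[OF that]] by (rule norm_exp)
    also have "\<dots> \<le> exp M" using e1[OF that] by simp
    finally show ?thesis using nn by (simp add: B_def)
  qed
  have 2: "norm (Phi S w y - 1) \<le> B * w" if w: "0 < w" for w
  proof -
    have "norm (Phi S w y - 1) \<le> norm (Phi_exponent w y) * exp (norm (Phi_exponent w y))"
      using w y by (simp add: Phi_eq_exp norm_exp_minus_1_le)
    also have "\<dots> \<le> (M / y * w) * exp M" using e1[OF w] M y w by (intro mult_mono) auto
    also have "\<dots> = (M / y * exp M) * w" by simp
    also have "\<dots> \<le> B * w" using w nn by (intro mult_right_mono) (auto simp: B_def)
    finally show ?thesis .
  qed
  have 3: "norm (Phi S w y - of_real (exp (Phi_limit y))) \<le> B / w" if w: "1 \<le> w" for w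
  proof -
    let ?d = "Phi_exponent w y - of_real (Phi_limit y)"
    have d: "norm ?d \<le> D / w"
      using norm_Phi_exponent_minus_limit_le[OF y, of w] w by (simp add: D_def)
    have "D / w \<le> D / 1" using D w by (intro divide_left_mono) auto
    then have d1: "norm ?d \<le> D" using d by simp
    have "Phi S w y - of_real (exp (Phi_limit y)) = of_real (exp (Phi_limit y)) * (exp ?d - 1)"
      using w y by (simp add: Phi_eq_exp exp_diff exp_of_real[symmetric] field_simps)
    then have "norm (Phi S w y - of_real (exp (Phi_limit y))) = exp (Phi_limit y) * norm (exp ?d - 1)"
      by (simp add: norm_mult)
    also have "\<dots> \<le> exp M * (norm ?d * exp (norm ?d))"
      using abs_Phi_limit_le[OF y] by (intro mult_mono norm_exp_minus_1_le) (auto simp: M_def)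
    also have "\<dots> \<le> exp M * ((D / w) * exp D)"
      using d d1 D w by (intro mult_left_mono mult_mono) auto
    also have "\<dots> = (exp M * (D * exp D)) / w" by simp
    also have "\<dots> \<le> B / w" using nn w by (intro divide_right_mono) (auto simp: B_def)
    finally show ?thesis .
  qed
  have "0 < B" using nn by (simp add: B_def add_pos_nonneg)
  then show ?thesis using 1 2 3 by (rule that)
qed

lemma Phi_measurable:
  "(\<lambda>p. if 0 < fst p \<and> 0 < snd p then Phi S (fst p) (snd p) else 0) \<in> borel_measurable (borel \<Otimes>\<^sub>M borel)"
proof -
  let ?D = "\<lambda>\<eta> N p. if 0 < snd p \<and> below_edge S N (snd p) then Delta S \<eta> N (fst p) (snd p) else 0"
  let ?U = "\<lambda>p. \<Sum>N. if present N then of_real (4 * lam_PH S / fact N) * (\<Sum>k. of_real (coef N k) * ?D (N + k) N p) else 0"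
  note [measurable] = Delta_measurable
  have m: "?U \<in> borel_measurable (borel \<Otimes>\<^sub>M borel)" by measurable
  have "Phi_exponent (fst p) (snd p) = ?U p" if "0 < snd p" for p
    unfolding Phi_exponent_def walls_exponent_def using that
    by (intro suminf_cong) auto
  then have "(\<lambda>p. if 0 < fst p \<and> 0 < snd p then Phi S (fst p) (snd p) else 0)
     = (\<lambda>p. if 0 < fst p \<and> 0 < snd p then exp (?U p) else 0)"
    by (intro ext) (auto simp: Phi_eq_exp)
  moreover have "\<dots> \<in> borel_measurable (borel \<Otimes>\<^sub>M borel)" using m by measurable
  ultimately show ?thesis by simp
qed

end

subsection \<open>The upper incomplete Gamma function\<close>

text \<open>The closed form of the upper incomplete Gamma function at the first argument
  \<open>t + 1\<close>. It is entire in \<open>u\<close>, so no branch cut interferes.\<close>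

definition incomplete_Gamma_poly :: "nat \<Rightarrow> complex \<Rightarrow> complex" where
  "incomplete_Gamma_poly t u = exp (- u) * (fact t * (\<Sum>k\<le>t. u ^ k / fact k))"

lemma DERIV_incomplete_Gamma_poly:
  "(incomplete_Gamma_poly t has_field_derivative - (u ^ t * exp (- u))) (at u)"
proof -
  have s: "((\<lambda>u. \<Sum>k\<le>t. u ^ k / fact k) has_field_derivative ((\<Sum>k\<le>t. u ^ k / fact k) - u ^ t / fact t)) (at u)"
  proof (induction t)
    case (Suc t)
    have "((\<lambda>u. u ^ Suc t / fact (Suc t)) has_field_derivative (u ^ t / fact t)) (at u)"
    proof -
      have "((\<lambda>u. u ^ Suc t / fact (Suc t)) has_field_derivative (of_nat (Suc t) * u ^ t / fact (Suc t))) (at u)"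
        using DERIV_cdivide[OF DERIV_power[OF DERIV_ident[of "at u"], of "Suc t"], of "fact (Suc t)"]
        by (simp del: fact_Suc of_nat_Suc)
      moreover have "of_nat (Suc t) * u ^ t / fact (Suc t) = u ^ t / fact t"
        unfolding fact_Suc by (simp del: of_nat_Suc)
      ultimately show ?thesis by simp
    qed
    from DERIV_add[OF Suc.IH this] show ?case by (simp del: fact_Suc)
  qed simp
  have "(incomplete_Gamma_poly t has_field_derivative
      (- exp (- u)) * (fact t * (\<Sum>k\<le>t. u ^ k / fact k))
      + (fact t * ((\<Sum>k\<le>t. u ^ k / fact k) - u ^ t / fact t)) * exp (- u)) (at u)"
    unfolding incomplete_Gamma_poly_def
    by (rule DERIV_mult) (auto intro!: derivative_eq_intros DERIV_cmult s)
  moreover have "(- exp (- u)) * (fact t * (\<Sum>k\<le>t. u ^ k / fact k))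
      + (fact t * ((\<Sum>k\<le>t. u ^ k / fact k) - u ^ t / fact t)) * exp (- u) = - (u ^ t * exp (- u))"
    by (simp add: algebra_simps)
  ultimately show ?thesis by simp
qed

lemma norm_incomplete_Gamma_poly_le:
  "norm (incomplete_Gamma_poly t u) \<le> exp (- Re u) * (fact t * (\<Sum>k\<le>t. norm u ^ k / fact k))"
proof -
  have "norm (\<Sum>k\<le>t. u ^ k / fact k) \<le> (\<Sum>k\<le>t. norm u ^ k / fact k)"
    by (rule order_trans[OF norm_sum]) (simp add: norm_divide norm_power)
  then show ?thesis unfolding incomplete_Gamma_poly_def norm_mult by (simp add: mult_left_mono)
qed

lemma power_sum_le: "(a + b) ^ t \<le> 2 ^ t * (a ^ t + b ^ t)" if "0 \<le> a" "0 \<le> b" for a b :: real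
proof -
  have "(a + b) ^ t \<le> (2 * max a b) ^ t" using that by (intro power_mono) auto
  also have "\<dots> = 2 ^ t * max a b ^ t" by (simp add: power_mult_distrib)
  also have "max a b ^ t \<le> a ^ t + b ^ t" using that by (simp add: max_def)
  finally show ?thesis by simp
qed

lemma set_integrable_power_exp: "set_integrable lborel {0..} (\<lambda>x::real. x ^ k * exp (- x))"
  using has_bochner_integral_I0i_power_exp_m'[of k]
  by (simp add: set_integrable_def has_bochner_integral_iff mult_ac)

lemma set_integrable_power_exp_scale:
  fixes s c :: real
  assumes s: "1 \<le> s" and c: "0 \<le> c"
  shows "set_integrable lborel {c..} (\<lambda>x. x ^ k * exp (- (s * x)))"
proof (rule set_integrable_bound[OF set_integrable_subset[OF set_integrable_power_exp[of k]]])
  show "AE x in lborel. x \<in> {c..} \<longrightarrow> norm (x ^ k * exp (- (s * x))) \<le> norm (x ^ k * exp (- x))"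
  proof (intro AE_I2 impI)
    fix x assume x: "x \<in> {c..}"
    have "1 * x \<le> s * x" using s x c by (intro mult_right_mono) auto
    then have "exp (- (s * x)) \<le> exp (- x)" by simp
    then show "norm (x ^ k * exp (- (s * x))) \<le> norm (x ^ k * exp (- x))"
      using x c by (simp add: abs_mult mult_left_mono)
  qed
qed (use c in \<open>auto simp: set_borel_measurable_def\<close>)

lemma ray_integrand_bound:
  assumes d: "1 \<le> Re d" and z: "0 \<le> Re z" and x: "0 \<le> x"
  shows "norm ((z + d * of_real x) ^ t * exp (- (z + d * of_real x)))
    \<le> 2 ^ t * norm z ^ t * (x ^ 0 * exp (- x)) + 2 ^ t * norm d ^ t * (x ^ t * exp (- x))"
proof -
  have "norm (z + d * of_real x) \<le> norm z + norm d * x"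
    using norm_triangle_ineq[of z "d * of_real x"] x by (simp add: norm_mult)
  then have "norm (z + d * of_real x) ^ t \<le> (norm z + norm d * x) ^ t" by (intro power_mono) auto
  also have "\<dots> \<le> 2 ^ t * (norm z ^ t + (norm d * x) ^ t)" using x by (intro power_sum_le) auto
  finally have 1: "norm (z + d * of_real x) ^ t \<le> 2 ^ t * (norm z ^ t + (norm d * x) ^ t)" .
  have "1 * x \<le> Re d * x" using d x by (intro mult_right_mono)
  then have 2: "exp (- Re (z + d * of_real x)) \<le> exp (- x)" using z by simp
  have "norm ((z + d * of_real x) ^ t * exp (- (z + d * of_real x)))
      = norm (z + d * of_real x) ^ t * exp (- Re (z + d * of_real x))"
    by (simp add: norm_mult norm_power)
  also have "\<dots> \<le> 2 ^ t * (norm z ^ t + (norm d * x) ^ t) * exp (- x)"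
    using 1 2 x by (intro mult_mono) auto
  finally show ?thesis by (simp add: power_mult_distrib algebra_simps)
qed

lemma incomplete_Gamma_poly_ray_tendsto_0:
  assumes d: "1 \<le> Re d" and z: "0 \<le> Re z"
  shows "((\<lambda>x. incomplete_Gamma_poly t (z + d * of_real x)) \<longlongrightarrow> 0) at_top"
proof (rule Lim_null_comparison)
  let ?g = "\<lambda>x::real. fact t * (\<Sum>k\<le>t. (2 ^ k * norm z ^ k * (x ^ 0 / exp x) + 2 ^ k * norm d ^ k * (x ^ k / exp x)) / fact k)"
  show "\<forall>\<^sub>F x in at_top. norm (incomplete_Gamma_poly t (z + d * of_real x)) \<le> ?g x"
    using eventually_ge_at_top[of 0]
  proof eventually_elim
    case (elim x)
    have "norm (incomplete_Gamma_poly t (z + d * of_real x))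
      \<le> exp (- Re (z + d * of_real x)) * (fact t * (\<Sum>k\<le>t. norm (z + d * of_real x) ^ k / fact k))"
      by (rule norm_incomplete_Gamma_poly_le)
    also have "\<dots> = fact t * (\<Sum>k\<le>t. norm ((z + d * of_real x) ^ k * exp (- (z + d * of_real x))) / fact k)"
      by (simp add: sum_distrib_left norm_mult norm_power mult_ac)
    also have "\<dots> \<le> ?g x"
      using ray_integrand_bound[OF d z elim]
      by (intro mult_left_mono sum_mono divide_right_mono) (auto simp: exp_minus divide_inverse)
    finally show ?case .
  qed
  have "(?g \<longlongrightarrow> fact t * (\<Sum>k\<le>t. (2 ^ k * norm z ^ k * 0 + 2 ^ k * norm d ^ k * 0) / fact k)) at_top"
    by (intro tendsto_intros tendsto_power_div_exp_0) auto
  then show "(?g \<longlongrightarrow> 0) at_top" by simp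
qed

text \<open>Two rays are needed: direction \<open>1\<close> from an arbitrary \<open>z\<close>, as
  in the definition of \<open>Gamma_upper\<close>, and direction \<open>q\<close> from
  \<open>0\<close>, as in the integral over the gain. An entire primitive that vanishes at infinity
  along both gives the values without shifting contours.\<close>

lemma
  assumes d: "1 \<le> Re d" and z: "0 \<le> Re z" and a: "0 \<le> a"
  shows ray_set_integrable:
      "set_integrable lborel {a..} (\<lambda>x. (z + d * of_real x) ^ t * exp (- (z + d * of_real x)))" (is ?int)
    and ray_integral_eq:
      "(LBINT x:{a..}. (z + d * of_real x) ^ t * exp (- (z + d * of_real x))) = incomplete_Gamma_poly t (z + d * of_real a) / d" (is ?eq)
proof -
  let ?f = "\<lambda>x::real. (z + d * of_real x) ^ t * exp (- (z + d * of_real x))"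
  let ?b = "\<lambda>x::real. 2 ^ t * norm z ^ t * (x ^ 0 * exp (- x)) + 2 ^ t * norm d ^ t * (x ^ t * exp (- x))"
  have "set_integrable lborel {0..} ?b"
    by (intro set_integral_add set_integrable_mult_right set_integrable_power_exp)
  then have "set_integrable lborel {0..} ?f"
    by (rule set_integrable_bound)
      (use ray_integrand_bound[OF d z] in \<open>auto simp: set_borel_measurable_def intro!: AE_I2 order_trans[OF _ abs_ge_self]\<close>)
  then show int: ?int by (rule set_integrable_subset) (use a in auto)
  have d0: "d \<noteq> 0" using d by auto
  have ftc: "(LBINT x:{a..b}. ?f x) = - incomplete_Gamma_poly t (z + d * of_real b) / d - (- incomplete_Gamma_poly t (z + d * of_real a) / d)"
    if "a \<le> b" for b
    unfolding set_lebesgue_integral_def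
  proof (rule integral_FTC_Icc[OF that])
    show "continuous_on {a..b} ?f" by (intro continuous_intros)
    fix x
    have "((\<lambda>x. z + d * of_real x) has_vector_derivative d) (at x within {a..b})"
      by (auto intro!: derivative_eq_intros)
    moreover have "((\<lambda>u. - incomplete_Gamma_poly t u / d) has_field_derivative ((z + d * of_real x) ^ t * exp (- (z + d * of_real x))) / d) (at (z + d * of_real x))"
      using DERIV_cdivide[OF DERIV_minus[OF DERIV_incomplete_Gamma_poly[of t "z + d * of_real x"]], of d]
      by (simp only: minus_minus)
    ultimately have "((\<lambda>u. - incomplete_Gamma_poly t u / d) \<circ> (\<lambda>x. z + d * of_real x) has_vector_derivative
       d * (((z + d * of_real x) ^ t * exp (- (z + d * of_real x))) / d)) (at x within {a..b})"
      by (rule field_vector_diff_chain_within[OF _ has_field_derivative_at_within])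
    then show "((\<lambda>x. - incomplete_Gamma_poly t (z + d * of_real x) / d) has_vector_derivative ?f x) (at x within {a..b})"
      using d0 by (simp add: o_def)
  qed
  have "((\<lambda>b. LBINT x:{a..b}. ?f x) \<longlongrightarrow> (LBINT x:{a..}. ?f x)) at_top"
    by (rule tendsto_set_lebesgue_integral_at_top[OF _ int]) auto
  moreover have "((\<lambda>b. LBINT x:{a..b}. ?f x) \<longlongrightarrow> - 0 / d - (- incomplete_Gamma_poly t (z + d * of_real a) / d)) at_top"
  proof (rule Lim_transform_eventually)
    show "((\<lambda>b. - incomplete_Gamma_poly t (z + d * of_real b) / d - (- incomplete_Gamma_poly t (z + d * of_real a) / d)) \<longlongrightarrow>
      - 0 / d - (- incomplete_Gamma_poly t (z + d * of_real a) / d)) at_top"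
      by (intro tendsto_intros incomplete_Gamma_poly_ray_tendsto_0 d z) (use d0 in auto)
    show "\<forall>\<^sub>F b in at_top. - incomplete_Gamma_poly t (z + d * of_real b) / d - (- incomplete_Gamma_poly t (z + d * of_real a) / d) = (LBINT x:{a..b}. ?f x)"
      using eventually_ge_at_top[of a] by eventually_elim (rule ftc[symmetric])
  qed
  ultimately have "(LBINT x:{a..}. ?f x) = - 0 / d - (- incomplete_Gamma_poly t (z + d * of_real a) / d)"
    by (rule tendsto_unique[OF trivial_limit_at_top_linorder])
  then show ?eq by simp
qed

lemma Gamma_upper_nat:
  assumes "0 \<le> Re z"
  shows "Gamma_upper (1 + of_nat t) z = incomplete_Gamma_poly t z"
proof -
  let ?f = "\<lambda>x::real. (z + of_real x) ^ t * exp (- (z + of_real x))"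
  have "Gamma_upper (1 + of_nat t) z = integral {0<..} ?f"
    unfolding Gamma_upper_def
  proof (rule integral_cong)
    fix x :: real assume "x \<in> {0<..}"
    then have "z + of_real x \<noteq> 0" using assms by (auto simp: complex_eq_iff)
    then show "(z + of_real x) powr (1 + of_nat t - 1) * exp (- (z + of_real x)) = ?f x"
      by (simp add: powr_nat)
  qed
  also have "\<dots> = integral {0..} ?f"
    by (rule integral_spike_set; rule negligible_subset[OF negligible_sing[of 0]]; fastforce)
  also have "\<dots> = (LBINT x:{0..}. ?f x)"
    using ray_set_integrable[of 1 z 0 t] assms by (simp add: set_borel_integral_eq_integral)
  also have "\<dots> = incomplete_Gamma_poly t z"
    using ray_integral_eq[of 1 z 0 t] assms by simp
  finally show ?thesis .
qed

lemma powi_minus_Suc: "q powi (- (1 + int t)) = inverse (q ^ Suc t)" for q :: complex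
proof -
  have "1 + int t = int (Suc t)" by simp
  then show ?thesis by (simp only: power_int_minus power_int_of_nat)
qed

text \<open>The substitution \<open>u = q * x\<close> turns the integral into one along the ray of
  direction \<open>q\<close> starting at \<open>c * q\<close>. Its value depends on the starting
  point only, up to the factor \<open>1 / q\<close>, hence equals the incomplete Gamma function
  along the horizontal ray.\<close>

lemma
  assumes q: "1 \<le> Re q" and c: "0 \<le> c"
  shows set_integrable_power_cexp: "set_integrable lborel {c..} (\<lambda>x. of_real (x ^ t) * exp (- q * of_real x))"
    and power_cexp_integral_eq: "(LBINT x:{c..}. of_real (x ^ t) * exp (- q * of_real x))
      = q powi (- (1 + int t)) * Gamma_upper (1 + of_nat t) (of_real c * q)"
proof -
  have q0: "q \<noteq> 0" using q by auto
  have eq: "of_real (x ^ t) * exp (- q * of_real x) = inverse (q ^ t) * ((0 + q * of_real x) ^ t * exp (- (0 + q * of_real x)))" for x :: real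
    using q0 by (simp add: power_mult_distrib)
  show "set_integrable lborel {c..} (\<lambda>x. of_real (x ^ t) * exp (- q * of_real x))"
    unfolding eq by (intro set_integrable_mult_right ray_set_integrable q c) simp
  have "(LBINT x:{c..}. of_real (x ^ t) * exp (- q * of_real x)) = inverse (q ^ t) * (incomplete_Gamma_poly t (q * of_real c) / q)"
    unfolding eq set_integral_mult_right using ray_integral_eq[OF q, of 0 c t] c by simp
  also have "\<dots> = q powi (- (1 + int t)) * incomplete_Gamma_poly t (of_real c * q)"
    unfolding powi_minus_Suc using q0 by (simp add: divide_inverse mult_ac)
  also have "incomplete_Gamma_poly t (of_real c * q) = Gamma_upper (1 + of_nat t) (of_real c * q)"
    using q c by (intro Gamma_upper_nat[symmetric]) auto
  finally show "(LBINT x:{c..}. of_real (x ^ t) * exp (- q * of_real x))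
      = q powi (- (1 + int t)) * Gamma_upper (1 + of_nat t) (of_real c * q)" .
qed

text \<open>The incomplete Gamma function grows at most like \<open>norm q ^ t\<close>, against
  \<open>norm q ^ (t + 1)\<close> in the denominator. The remaining factor \<open>1 / norm q\<close>
  is the extra decay in \<open>w\<close> once \<open>q\<close> has imaginary part
  \<open>w * b\<close>.\<close>

lemma norm_power_cexp_integral_le:
  assumes q: "1 \<le> Re q" and c: "0 \<le> c"
  shows "norm (q powi (- (1 + int t)) * Gamma_upper (1 + of_nat t) (of_real c * q))
    \<le> (fact t * (\<Sum>k\<le>t. c ^ k / fact k)) / norm q"
proof -
  have n1: "1 \<le> norm q" using q complex_Re_le_cmod[of q] by linarith
  have "norm (incomplete_Gamma_poly t (of_real c * q)) \<le> exp (- Re (of_real c * q)) * (fact t * (\<Sum>k\<le>t. norm (of_real c * q) ^ k / fact k))"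
    by (rule norm_incomplete_Gamma_poly_le)
  also have "\<dots> \<le> 1 * (fact t * (\<Sum>k\<le>t. norm q ^ t * (c ^ k / fact k)))"
  proof (intro mult_mono mult_left_mono sum_mono)
    show "exp (- Re (of_real c * q)) \<le> 1" using q c by simp
    fix k assume "k \<in> {..t}"
    then have "norm q ^ k \<le> norm q ^ t" using n1 by (intro power_increasing) auto
    then have "norm q ^ k * (c ^ k / fact k) \<le> norm q ^ t * (c ^ k / fact k)" using c by (intro mult_right_mono) auto
    then show "norm (of_real c * q) ^ k / fact k \<le> norm q ^ t * (c ^ k / fact k)"
      using c by (simp add: norm_mult power_mult_distrib mult_ac)
  qed (auto intro!: mult_nonneg_nonneg sum_nonneg)
  also have "\<dots> = norm q ^ t * (fact t * (\<Sum>k\<le>t. c ^ k / fact k))"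
    by (simp add: sum_distrib_left mult_ac)
  finally have 1: "norm (incomplete_Gamma_poly t (of_real c * q)) \<le> norm q ^ t * (fact t * (\<Sum>k\<le>t. c ^ k / fact k))" .
  have "norm (q powi (- (1 + int t))) = inverse (norm q * norm q ^ t)"
    unfolding powi_minus_Suc by (simp add: norm_inverse norm_power norm_mult)
  then have "norm (q powi (- (1 + int t)) * Gamma_upper (1 + of_nat t) (of_real c * q))
     = inverse (norm q * norm q ^ t) * norm (incomplete_Gamma_poly t (of_real c * q))"
    using q c by (simp add: norm_mult Gamma_upper_nat)
  also have "\<dots> \<le> inverse (norm q * norm q ^ t) * (norm q ^ t * (fact t * (\<Sum>k\<le>t. c ^ k / fact k)))"
    by (intro mult_left_mono 1) auto
  also have "\<dots> = (fact t * (\<Sum>k\<le>t. c ^ k / fact k)) / norm q"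
    using n1 by (simp add: field_simps)
  finally show ?thesis .
qed

subsection \<open>Gil-Pelaez integrals\<close>

definition gp_kernel :: "(real \<Rightarrow> complex) \<Rightarrow> real \<Rightarrow> real \<Rightarrow> real" where
  "gp_kernel \<phi> z w = 1 / (pi * w) * Im (exp (- \<i> * of_real (w * z)) * \<phi> w)"

definition gp_partial :: "(real \<Rightarrow> complex) \<Rightarrow> nat \<Rightarrow> real \<Rightarrow> real" where
  "gp_partial \<phi> n z = (LBINT w:{0<..real n}. gp_kernel \<phi> z w)"

text \<open>A sequential limit of Lebesgue integrals, hence measurable in \<open>z\<close> and in
  further parameters of \<phi>, which a gauge integral does not show directly.\<close>

definition gp_limit :: "(real \<Rightarrow> complex) \<Rightarrow> real \<Rightarrow> real" where
  "gp_limit \<phi> z = lim (\<lambda>n. gp_partial \<phi> n z)"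

lemma set_integrable_bounded:
  fixes f :: "real \<Rightarrow> 'a::{banach, second_countable_topology}"
  assumes [measurable]: "f \<in> borel_measurable borel" and b: "\<And>x. x \<in> {a<..b} \<Longrightarrow> norm (f x) \<le> c"
  shows "set_integrable lborel {a<..b} f"
proof (rule set_integrable_bound[where f = "\<lambda>x. c"])
  show "set_integrable lborel {a<..b} (\<lambda>x. c)" 
    unfolding set_integrable_def
    by (rule integrable_scaleR_left, cases "a \<le> b") (auto intro!: integrable_real_indicator)
  show "set_borel_measurable lborel {a<..b} f" unfolding set_borel_measurable_def by measurable
  show "AE x in lborel. x \<in> {a<..b} \<longrightarrow> norm (f x) \<le> norm c"
    using b by (auto intro!: AE_I2 order_trans[OF _ abs_ge_self])
qed

lemma abs_sin_scale_divide_le: "0 < w \<Longrightarrow> \<bar>sin (w * z) / w\<bar> \<le> \<bar>z\<bar>" for w z :: real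
  using abs_sin_le_one[of "w * z"] abs_sin_x_le_abs_x[of "w * z"] by (simp add: field_simps abs_mult)

lemma set_integrable_sin_scale_divide: "set_integrable lborel {0<..b} (\<lambda>w. sin (w * z) / w)" for z :: real
  by (rule set_integrable_bounded[where c = "\<bar>z\<bar>"]) (use abs_sin_scale_divide_le in auto)

lemma LBINT_sin_scale_divide: "0 \<le> b \<Longrightarrow> (LBINT w:{0<..b}. sin (w * z) / w) = sgn z * Si (b * \<bar>z\<bar>)"
  using LBINT_I0c_sin_scale_divide[of b z] interval_integral_Ioc[of 0 b "\<lambda>w. sin (w * z) / w"]
  by (simp add: zero_ereal_def)

lemma LBINT_Ioc_tendsto:
  fixes f :: "real \<Rightarrow> real"
  assumes f: "set_integrable lborel {0<..} f"
  shows "(\<lambda>n. LBINT w:{0<..real n}. f w) \<longlonglongrightarrow> (LBINT w:{0<..}. f w)"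
proof -
  have f': "integrable lborel (\<lambda>w. indicator {0<..} w *\<^sub>R f w)" using f by (simp add: set_integrable_def)
  have "(\<lambda>n. LINT w|lborel. indicator {0<..real n} w *\<^sub>R (indicator {0<..} w *\<^sub>R f w)) \<longlonglongrightarrow> (LINT w|lborel. indicator {0<..} w *\<^sub>R f w)"
  proof (rule integral_dominated_convergence[where w = "\<lambda>w. norm (indicator {0<..} w *\<^sub>R f w)"])
    show "AE w in lborel. (\<lambda>n. indicator {0<..real n} w *\<^sub>R (indicator {0<..} w *\<^sub>R f w)) \<longlonglongrightarrow> indicator {0<..} w *\<^sub>R f w"
    proof (rule AE_I2)
      fix w :: real
      have "\<forall>\<^sub>F n in sequentially. w \<le> real n" by (rule eventually_sequentiallyI[of "nat \<lceil>w\<rceil>"]) linarith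
      then have "\<forall>\<^sub>F n in sequentially. indicator {0<..real n} w *\<^sub>R (indicator {0<..} w *\<^sub>R f w) = indicator {0<..} w *\<^sub>R f w"
        by eventually_elim (auto simp: indicator_def)
      then show "(\<lambda>n. indicator {0<..real n} w *\<^sub>R (indicator {0<..} w *\<^sub>R f w)) \<longlonglongrightarrow> indicator {0<..} w *\<^sub>R f w"
        by (rule tendsto_eventually)
    qed
    show "AE w in lborel. norm (indicator {0<..real n} w *\<^sub>R (indicator {0<..} w *\<^sub>R f w)) \<le> norm (indicator {0<..} w *\<^sub>R f w)" for n
      by (intro AE_I2) (auto simp: indicator_def)
  qed (use f' in \<open>auto intro: borel_measurable_integrable\<close>)
  moreover have "indicator {0<..real n} w *\<^sub>R (indicator {0<..} w *\<^sub>R f w) = indicator {0<..real n} w *\<^sub>R f w" for n w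
    by (auto simp: indicator_def)
  ultimately show ?thesis unfolding set_lebesgue_integral_def by (simp only:)
qed

text \<open>The limit \<open>p\<close> of \<open>\<phi>\<close> at \<open>\<infinity>\<close> is the mass of the atom at \<open>0\<close> and is not zero in general.\<close>

locale gil_pelaez =
  fixes \<phi> :: "real \<Rightarrow> complex" and B p :: real
  assumes measurable_\<phi> [measurable]: "\<phi> \<in> borel_measurable borel"
    and B_pos: "0 < B"
    and bound: "\<And>w. 0 < w \<Longrightarrow> norm (\<phi> w) \<le> B"
    and bound_0: "\<And>w. 0 < w \<Longrightarrow> norm (\<phi> w - 1) \<le> B * w"
    and bound_inf: "\<And>w. 1 \<le> w \<Longrightarrow> norm (\<phi> w - of_real p) \<le> B / w"
begin

lemma kernel_measurable [measurable]: "gp_kernel \<phi> z \<in> borel_measurable borel"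
  unfolding gp_kernel_def by measurable

lemma norm_exp_minus_i [simp]: "norm (exp (- (\<i> * complex_of_real x))) = 1"
  by (simp add: norm_exp_eq_Re)

lemma Im_exp_minus_i: "Im (exp (- \<i> * complex_of_real x)) = - sin x"
  by (simp add: Im_exp)

lemma abs_Im_exp_mult_le: "\<bar>Im (exp (- \<i> * complex_of_real x) * u)\<bar> \<le> norm u"
  using abs_Im_le_cmod[of "exp (- \<i> * complex_of_real x) * u"] by (simp add: norm_mult)

lemma Im_exp_split: "Im (exp (- \<i> * complex_of_real x) * u) =
    Im (exp (- \<i> * complex_of_real x) * (u - of_real r)) - r * sin x"
  using Im_exp_minus_i[of x] by (simp add: algebra_simps)

lemma abs_kernel_le:
  assumes "0 < w"
  shows "\<bar>gp_kernel \<phi> z w\<bar> \<le> (B + \<bar>z\<bar>) / pi" "\<bar>gp_kernel \<phi> z w\<bar> \<le> B / (pi * w)"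
proof -
  have "\<bar>Im (exp (- \<i> * of_real (w * z)) * \<phi> w)\<bar> \<le> norm (\<phi> w - 1) + \<bar>sin (w * z)\<bar>"
    unfolding Im_exp_split[of "w * z" "\<phi> w" 1] of_real_1
    using abs_Im_exp_mult_le[of "w * z" "\<phi> w - 1"] by linarith
  also have "\<dots> \<le> B * w + w * \<bar>z\<bar>"
    using bound_0[OF assms] abs_sin_x_le_abs_x[of "w * z"] assms by (intro add_mono) (auto simp: abs_mult)
  finally have 1: "\<bar>Im (exp (- \<i> * of_real (w * z)) * \<phi> w)\<bar> \<le> w * (B + \<bar>z\<bar>)" by (simp add: algebra_simps)
  have "\<bar>gp_kernel \<phi> z w\<bar> = \<bar>Im (exp (- \<i> * of_real (w * z)) * \<phi> w)\<bar> / (pi * w)"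
    using assms by (simp add: gp_kernel_def abs_mult)
  also have "\<dots> \<le> w * (B + \<bar>z\<bar>) / (pi * w)" using 1 assms by (intro divide_right_mono) auto
  finally show "\<bar>gp_kernel \<phi> z w\<bar> \<le> (B + \<bar>z\<bar>) / pi" using assms by simp
  have "\<bar>gp_kernel \<phi> z w\<bar> = \<bar>Im (exp (- \<i> * of_real (w * z)) * \<phi> w)\<bar> / (pi * w)"
    using assms by (simp add: gp_kernel_def abs_mult)
  also have "\<dots> \<le> B / (pi * w)"
    by (rule divide_right_mono[OF order_trans[OF abs_Im_exp_mult_le bound[OF assms]]]) (use assms in simp)
  finally show "\<bar>gp_kernel \<phi> z w\<bar> \<le> B / (pi * w)" .
qed

lemma set_integrable_kernel: "set_integrable lborel {0<..b} (gp_kernel \<phi> z)"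
  by (rule set_integrable_bounded[where c = "(B + \<bar>z\<bar>) / pi"]) (use abs_kernel_le in auto)

text \<open>Subtracting from \<phi> its limit at \<open>0\<close> for \<open>w \<le> 1\<close> and
  its limit at infinity for \<open>w > 1\<close> leaves an absolutely integrable kernel. What is
  taken off is a multiple of \<open>sin (w * z) / w\<close>.\<close>

definition regular_part :: "real \<Rightarrow> real \<Rightarrow> real" where
  "regular_part z w = Im (exp (- \<i> * of_real (w * z)) * (\<phi> w - (if w \<le> 1 then 1 else of_real p))) / (pi * w)"

lemma regular_part_measurable [measurable]: "regular_part z \<in> borel_measurable borel"
  unfolding regular_part_def by measurable

text \<open>The factor \<open>2 / (1 + w\<^sup>2)\<close> exceeds both \<open>1\<close> for
  \<open>w \<le> 1\<close> and \<open>1 / w\<^sup>2\<close> for \<open>w \<ge> 1\<close>, so one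
  function dominates both ranges.\<close>

definition decay :: "real \<Rightarrow> real" where
  "decay w = B / pi * (2 / (1 + w\<^sup>2))"

lemma decay_nonneg: "0 \<le> decay w"
  using B_pos by (simp add: decay_def)

lemma set_integrable_decay: "set_integrable lborel {0<..} decay"
proof -
  have "set_integrable lborel {0<..} (\<lambda>x. 1 / (1 + x\<^sup>2) :: real)"
    using integrable_I0i_1_div_plus_square
    by (simp add: interval_lebesgue_integrable_def zero_ereal_def einterval_eq)
  then have "set_integrable lborel {0<..} (\<lambda>w. (B / pi * 2) * (1 / (1 + w\<^sup>2)))"
    by (rule set_integrable_mult_right)
  then show ?thesis by (simp add: decay_def[abs_def])
qed

lemma abs_regular_part_le:
  assumes "0 < w"
  shows "\<bar>regular_part z w\<bar> \<le> decay w"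
proof -
  have d: "0 < pi * w" using assms by simp
  have "\<bar>regular_part z w\<bar> \<le> norm (\<phi> w - (if w \<le> 1 then 1 else of_real p)) / (pi * w)"
    unfolding regular_part_def abs_divide using assms
    by (intro frac_le order_refl abs_Im_exp_mult_le) auto
  also have "\<dots> \<le> decay w"
  proof (cases "w \<le> 1")
    case True
    then have "norm (\<phi> w - (if w \<le> 1 then 1 else of_real p)) / (pi * w) \<le> B * w / (pi * w)"
      using bound_0[OF assms] d by (intro divide_right_mono) auto
    also have "\<dots> = B / pi * 1" using assms by simp
    also have "\<dots> \<le> B / pi * (2 / (1 + w\<^sup>2))"
      using True assms B_pos power_le_one[of w 2] by (intro mult_left_mono) (auto simp: pos_le_divide_eq add_pos_nonneg)
    finally show ?thesis by (simp only: decay_def)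
  next
    case False
    then have "norm (\<phi> w - (if w \<le> 1 then 1 else of_real p)) / (pi * w) \<le> (B / w) / (pi * w)"
      using bound_inf[of w] d by (intro divide_right_mono) auto
    also have "\<dots> = B / pi * (1 / w\<^sup>2)" by (simp add: power2_eq_square)
    also have "\<dots> \<le> B / pi * (2 / (1 + w\<^sup>2))"
    proof (intro mult_left_mono)
      have "1 \<le> w\<^sup>2" using False by (intro one_le_power) auto
      then show "1 / w\<^sup>2 \<le> 2 / (1 + w\<^sup>2)" by (simp add: divide_simps)
    qed (use B_pos in auto)
    finally show ?thesis by (simp only: decay_def)
  qed
  finally show ?thesis .
qed

lemma set_integrable_regular_part: "set_integrable lborel {0<..} (regular_part z)"
  by (rule set_integrable_bound[OF set_integrable_decay])
    (use abs_regular_part_le in \<open>auto simp: set_borel_measurable_def intro!: AE_I2 order_trans[OF _ abs_ge_self]\<close>)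

lemma kernel_eq:
  assumes "0 < w"
  shows "gp_kernel \<phi> z w = regular_part z w - (if w \<le> 1 then 1 else p) / pi * (sin (w * z) / w)"
proof -
  have "complex_of_real (if w \<le> 1 then 1 else p) = (if w \<le> 1 then 1 else of_real p)" by simp
  then show ?thesis
    unfolding gp_kernel_def regular_part_def
    using Im_exp_split[of "w * z" "\<phi> w" "if w \<le> 1 then 1 else p"]
    by (simp add: diff_divide_distrib)
qed

text \<open>The coefficient \<open>1\<close> on \<open>{0<..1}\<close> contributes
  \<open>sgn z * Si \<bar>z\<bar>\<close>, and the coefficient \<open>p\<close> on
  \<open>{1<..n}\<close> contributes \<open>p\<close> times the rest of the sine integral. The
  argument \<open>s\<close> stands for \<open>Si (n * \<bar>z\<bar>)\<close>, the only part that
  depends on \<open>n\<close>; its limit is \<open>pi / 2\<close> for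
  \<open>z \<noteq> 0\<close>.\<close>

definition singular_part :: "real \<Rightarrow> real \<Rightarrow> real" where
  "singular_part z s = (sgn z * Si \<bar>z\<bar> + p * (sgn z * s - sgn z * Si \<bar>z\<bar>)) / pi"

lemma gp_partial_eq:
  assumes n: "1 \<le> n"
  shows "gp_partial \<phi> n z = (LBINT w:{0<..real n}. regular_part z w) - singular_part z (Si (real n * \<bar>z\<bar>))"
proof -
  let ?s = "\<lambda>w. sin (w * z) / w"
  have un: "{0<..real n} = {0<..1} \<union> {1<..real n}" using n by auto
  have si1: "set_integrable lborel {0<..1} ?s" "set_integrable lborel {1<..real n} ?s"
    by (auto intro: set_integrable_subset[OF set_integrable_sin_scale_divide[of "real n" z]] set_integrable_sin_scale_divide)
  have ri: "set_integrable lborel {0<..1} (regular_part z)" "set_integrable lborel {1<..real n} (regular_part z)"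
    by (rule set_integrable_subset[OF set_integrable_regular_part]; auto)+
  have ki: "set_integrable lborel {0<..1} (gp_kernel \<phi> z)" "set_integrable lborel {1<..real n} (gp_kernel \<phi> z)"
    by (rule set_integrable_subset[OF set_integrable_kernel[of "real n"]]; use n in auto)+
  have "gp_partial \<phi> n z = (LBINT w:{0<..1}. gp_kernel \<phi> z w) + (LBINT w:{1<..real n}. gp_kernel \<phi> z w)"
    unfolding gp_partial_def un by (intro set_integral_Un ki) auto
  also have "(LBINT w:{0<..1}. gp_kernel \<phi> z w) = (LBINT w:{0<..1}. regular_part z w - 1 / pi * ?s w)"
    by (rule set_lebesgue_integral_cong) (auto simp: kernel_eq)
  also have "\<dots> = (LBINT w:{0<..1}. regular_part z w) - 1 / pi * (LBINT w:{0<..1}. ?s w)"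
    by (subst set_integral_diff(2)[OF ri(1) set_integrable_mult_right[OF si1(1)]]) (simp only: set_integral_mult_right)
  also have "(LBINT w:{1<..real n}. gp_kernel \<phi> z w) = (LBINT w:{1<..real n}. regular_part z w - p / pi * ?s w)"
    by (rule set_lebesgue_integral_cong) (auto simp: kernel_eq)
  also have "\<dots> = (LBINT w:{1<..real n}. regular_part z w) - p / pi * (LBINT w:{1<..real n}. ?s w)"
    by (subst set_integral_diff(2)[OF ri(2) set_integrable_mult_right[OF si1(2)]]) (simp only: set_integral_mult_right)
  also have "(LBINT w:{1<..real n}. ?s w) = (LBINT w:{0<..real n}. ?s w) - (LBINT w:{0<..1}. ?s w)"
    unfolding un using set_integral_Un[OF _ si1] by auto
  also have "(LBINT w:{0<..1}. ?s w) = sgn z * Si \<bar>z\<bar>" using LBINT_sin_scale_divide[of 1 z] by simp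
  also have "(LBINT w:{0<..real n}. ?s w) = sgn z * Si (real n * \<bar>z\<bar>)" by (rule LBINT_sin_scale_divide) simp
  finally have "gp_partial \<phi> n z = (LBINT w:{0<..1}. regular_part z w) + (LBINT w:{1<..real n}. regular_part z w)
      - singular_part z (Si (real n * \<bar>z\<bar>))"
    by (simp add: singular_part_def add_divide_distrib diff_divide_distrib right_diff_distrib)
  also have "(LBINT w:{0<..1}. regular_part z w) + (LBINT w:{1<..real n}. regular_part z w) = (LBINT w:{0<..real n}. regular_part z w)"
    unfolding un by (intro set_integral_Un[symmetric] ri) auto
  finally show ?thesis .
qed

lemma gp_partial_bounded: "\<exists>C\<ge>0. \<forall>n z. \<bar>gp_partial \<phi> n z\<bar> \<le> C"
proof -
  obtain C where C: "\<And>x. \<bar>Si x\<bar> \<le> C" using bounded_Si by auto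
  have C0: "0 \<le> C" using C[of 0] by linarith
  define D where "D = (LBINT w:{0<..}. decay w)"
  have D0: "0 \<le> D" unfolding D_def set_lebesgue_integral_def
    using decay_nonneg by (intro integral_nonneg_AE AE_I2) (auto simp: indicator_def)
  have r: "\<bar>LBINT w:{0<..real n}. regular_part z w\<bar> \<le> D" for n z
  proof -
    have rs: "set_integrable lborel {0<..real n} (regular_part z)"
      by (rule set_integrable_subset[OF set_integrable_regular_part]) auto
    have "\<bar>LBINT w:{0<..real n}. regular_part z w\<bar> \<le> (LBINT w:{0<..real n}. \<bar>regular_part z w\<bar>)"
      using set_integral_norm_bound[OF rs] by simp
    also have "\<dots> \<le> D"
      unfolding D_def set_lebesgue_integral_def
    proof (rule integral_mono)
      show "integrable lborel (\<lambda>w. indicator {0<..real n} w *\<^sub>R \<bar>regular_part z w\<bar>)"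
        using set_integrable_abs[OF rs] by (simp add: set_integrable_def)
      show "integrable lborel (\<lambda>w. indicator {0<..} w *\<^sub>R decay w)"
        using set_integrable_decay by (simp add: set_integrable_def)
      show "indicator {0<..real n} w *\<^sub>R \<bar>regular_part z w\<bar> \<le> indicator {0<..} w *\<^sub>R decay w" for w
        using abs_regular_part_le[of w z] decay_nonneg[of w] by (auto simp: indicator_def)
    qed
    finally show ?thesis .
  qed
  have s: "\<bar>singular_part z (Si x)\<bar> \<le> (C + \<bar>p\<bar> * (C + C)) / pi" for z x
  proof -
    have sg: "\<bar>sgn z * Si y\<bar> \<le> C" for y using C[of y] C0 by (auto simp: abs_mult sgn_if)
    have "\<bar>sgn z * Si \<bar>z\<bar> + p * (sgn z * Si x - sgn z * Si \<bar>z\<bar>)\<bar> \<le> C + \<bar>p\<bar> * (C + C)"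
    proof (rule order_trans[OF abs_triangle_ineq], rule add_mono[OF sg])
      have "\<bar>sgn z * Si x - sgn z * Si \<bar>z\<bar>\<bar> \<le> C + C" using sg[of x] sg[of "\<bar>z\<bar>"] by linarith
      then show "\<bar>p * (sgn z * Si x - sgn z * Si \<bar>z\<bar>)\<bar> \<le> \<bar>p\<bar> * (C + C)"
        unfolding abs_mult by (intro mult_left_mono) auto
    qed
    then show ?thesis unfolding singular_part_def abs_divide by (simp add: divide_right_mono)
  qed
  have "\<bar>gp_partial \<phi> n z\<bar> \<le> D + (C + \<bar>p\<bar> * (C + C)) / pi" for n z
  proof (cases "1 \<le> n")
    case True
    then show ?thesis using r[of n z] s[of z "real n * \<bar>z\<bar>"] unfolding gp_partial_eq[OF True] by linarith
  next
    case False
    then have "gp_partial \<phi> n z = 0" by (simp add: gp_partial_def set_lebesgue_integral_def)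
    then show ?thesis using D0 C0 by simp
  qed
  then show ?thesis using D0 C0 by (intro exI[of _ "D + (C + \<bar>p\<bar> * (C + C)) / pi"]) auto
qed

lemma gp_partial_tendsto_explicit:
  assumes z: "z \<noteq> 0"
  shows "(\<lambda>n. gp_partial \<phi> n z) \<longlonglongrightarrow> (LBINT w:{0<..}. regular_part z w) - singular_part z (pi / 2)"
proof -
  note r = LBINT_Ioc_tendsto[OF set_integrable_regular_part, of z]
  have "filterlim (\<lambda>n. real n * \<bar>z\<bar>) at_top sequentially"
    using z by (intro filterlim_tendsto_pos_mult_at_top[OF tendsto_const] filterlim_at_top_mult_tendsto_pos[OF tendsto_const] filterlim_real_sequentially) auto
  then have "(\<lambda>n. Si (real n * \<bar>z\<bar>)) \<longlonglongrightarrow> pi / 2" by (rule filterlim_compose[OF Si_at_top])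
  then have "(\<lambda>n. (LBINT w:{0<..real n}. regular_part z w) - singular_part z (Si (real n * \<bar>z\<bar>)))
      \<longlonglongrightarrow> (LBINT w:{0<..}. regular_part z w) - singular_part z (pi / 2)"
    unfolding singular_part_def using r by (intro tendsto_intros) auto
  then show ?thesis
    by (rule Lim_transform_eventually)
      (auto intro!: eventually_sequentiallyI[of 1] simp: gp_partial_eq)
qed

lemma gp_limit_eq:
  assumes "z \<noteq> 0"
  shows "gp_limit \<phi> z = (LBINT w:{0<..}. regular_part z w) - singular_part z (pi / 2)"
  unfolding gp_limit_def by (rule limI[OF gp_partial_tendsto_explicit[OF assms]])

lemma gp_partial_tendsto: "z \<noteq> 0 \<Longrightarrow> (\<lambda>n. gp_partial \<phi> n z) \<longlonglongrightarrow> gp_limit \<phi> z"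
  using gp_partial_tendsto_explicit gp_limit_eq by simp

text \<open>The regular part is continuous by dominated convergence and
  \<open>sgn z * Si \<bar>z\<bar>\<close> is continuous everywhere. Only the term
  \<open>p * sgn z * (pi / 2)\<close> can jump, and only at \<open>0\<close>; after division by
  \<open>pi\<close> the jump has size \<open>p\<close>.\<close>

lemma gp_limit_tendsto:
  assumes x: "x \<longlonglongrightarrow> z" and z: "z \<noteq> 0"
  shows "(\<lambda>n. gp_limit \<phi> (x n)) \<longlonglongrightarrow> gp_limit \<phi> z"
proof -
  have r: "(\<lambda>n. LBINT w:{0<..}. regular_part (x n) w) \<longlonglongrightarrow> (LBINT w:{0<..}. regular_part z w)"
    unfolding set_lebesgue_integral_def
  proof (rule integral_dominated_convergence[where w = "\<lambda>w. indicator {0<..} w *\<^sub>R decay w"])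
    show "integrable lborel (\<lambda>w. indicator {0<..} w *\<^sub>R decay w)"
      using set_integrable_decay by (simp add: set_integrable_def)
    show "AE w in lborel. (\<lambda>n. indicator {0<..} w *\<^sub>R regular_part (x n) w) \<longlonglongrightarrow> indicator {0<..} w *\<^sub>R regular_part z w"
    proof (intro AE_I2 tendsto_scaleR tendsto_const)
      show "(\<lambda>n. regular_part (x n) w) \<longlonglongrightarrow> regular_part z w" for w
        unfolding regular_part_def divide_inverse
        by (intro tendsto_mult tendsto_Im tendsto_const tendsto_exp tendsto_of_real x)
    qed
    show "AE w in lborel. norm (indicator {0<..} w *\<^sub>R regular_part (x n) w) \<le> indicator {0<..} w *\<^sub>R decay w" for n
      using abs_regular_part_le[of _ "x n"] decay_nonneg by (intro AE_I2) (auto simp: indicator_def)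
  qed measurable
  have "(\<lambda>n. Si \<bar>x n\<bar>) \<longlonglongrightarrow> Si \<bar>z\<bar>"
    by (rule isCont_tendsto_compose[OF isCont_Si]) (intro tendsto_rabs x)
  moreover have "(\<lambda>n. sgn (x n)) \<longlonglongrightarrow> sgn z" by (intro tendsto_sgn x z)
  ultimately have "(\<lambda>n. (LBINT w:{0<..}. regular_part (x n) w) - singular_part (x n) (pi / 2))
      \<longlonglongrightarrow> (LBINT w:{0<..}. regular_part z w) - singular_part z (pi / 2)"
    unfolding singular_part_def using r x z by (intro tendsto_intros) auto
  then have "(\<lambda>n. (LBINT w:{0<..}. regular_part (x n) w) - singular_part (x n) (pi / 2)) \<longlonglongrightarrow> gp_limit \<phi> z"
    using gp_limit_eq[OF z] by simp
  moreover have "\<forall>\<^sub>F n in sequentially. (LBINT w:{0<..}. regular_part (x n) w) - singular_part (x n) (pi / 2) = gp_limit \<phi> (x n)"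
    using tendsto_imp_eventually_ne[OF x z] by eventually_elim (simp add: gp_limit_eq)
  ultimately show ?thesis by (rule Lim_transform_eventually)
qed

text \<open>A gauge integral over an unbounded set is a limit over growing boxes. On the boxes
  \<open>[-n, n]\<close> it reduces to the Lebesgue partial integrals.\<close>

lemma has_integral_kernel_imp_gp_limit:
  assumes I: "(gp_kernel \<phi> z has_integral I) {0<..}" and z: "z \<noteq> 0"
  shows "gp_limit \<phi> z = I"
proof -
  have "(\<lambda>n. gp_partial \<phi> n z) \<longlonglongrightarrow> I"
  proof (rule LIMSEQ_I)
    fix e :: real assume "0 < e"
    then obtain r where r: "0 < r" "\<And>a b. ball 0 r \<subseteq> cbox a b \<Longrightarrow>
        norm (integral (cbox a b) (\<lambda>w. if w \<in> {0<..} then gp_kernel \<phi> z w else 0) - I) < e"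
      using I unfolding has_integral_alt' by blast
    have "norm (gp_partial \<phi> n z - I) < e" if n: "nat \<lceil>r\<rceil> \<le> n" for n
    proof -
      have "ball 0 r \<subseteq> cbox (- real n) (real n)" using n by (auto simp: dist_real_def)
      then have 1: "norm (integral (cbox (- real n) (real n)) (\<lambda>w. if w \<in> {0<..} then gp_kernel \<phi> z w else 0) - I) < e"
        by (rule r(2))
      have "integral (cbox (- real n) (real n)) (\<lambda>w. if w \<in> {0<..} then gp_kernel \<phi> z w else 0)
          = integral ({- real n..real n} \<inter> {0<..}) (gp_kernel \<phi> z)"
        unfolding cbox_interval by (simp only: integral_restrict_Int Int_commute)
      also have "{- real n..real n} \<inter> {0<..} = {0<..real n}" by auto
      also have "integral {0<..real n} (gp_kernel \<phi> z) = gp_partial \<phi> n z"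
        unfolding gp_partial_def by (rule set_borel_integral_eq_integral(2)[OF set_integrable_kernel, symmetric])
      finally show ?thesis using 1 by simp
    qed
    then show "\<exists>no. \<forall>n\<ge>no. norm (gp_partial \<phi> n z - I) < e" by blast
  qed
  then show ?thesis using gp_partial_tendsto[OF z] by (rule LIMSEQ_unique[symmetric])
qed

end

lemma integrable_lborel_product:
  fixes f g :: "real \<Rightarrow> real"
  assumes f: "integrable lborel f" and g: "integrable lborel g"
  shows "integrable (lborel \<Otimes>\<^sub>M lborel) (\<lambda>x. f (fst x) * g (snd x))"
proof -
  have [measurable]: "f \<in> borel_measurable borel" "g \<in> borel_measurable borel"
    using f g by (auto dest: borel_measurable_integrable)
  show ?thesis
    by (rule lborel_pair.Fubini_integrable) (use f g in \<open>auto simp: abs_mult\<close>)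
qed

text \<open>By \<open>power_cexp_integral_eq\<close> this is the integral of
  \<open>x ^ t * exp (- (s + u) * x)\<close> over \<open>{c..}\<close>, provided that the real part
  of \<open>s + u\<close> is at least \<open>1\<close> and \<open>0 \<le> c\<close>.\<close>

definition gain_transform :: "real \<Rightarrow> nat \<Rightarrow> real \<Rightarrow> complex \<Rightarrow> complex" where
  "gain_transform s t c u = (of_real s + u) powi (- (1 + int t)) *
     Gamma_upper (1 + of_nat t) (of_real c * (of_real s + u))"

context gil_pelaez
begin

lemma gp_partial_measurable [measurable]: "gp_partial \<phi> n \<in> borel_measurable borel"
  unfolding gp_partial_def set_lebesgue_integral_def gp_kernel_def by measurable

lemma gp_limit_measurable [measurable]: "gp_limit \<phi> \<in> borel_measurable borel"
  unfolding gp_limit_def by measurable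

text \<open>The order of integration is exchanged for \<open>w \<le> n\<close>, where everything is absolutely
  integrable. Then \<open>n \<rightarrow> \<infinity>\<close>: the partial integrals are bounded uniformly in the gain, and the
  incomplete Gamma function contributes the decay needed to make the integrand
  \<open>O(1 / w\<^sup>2)\<close>.\<close>

lemma has_integral_gain_transform:
  fixes s \<alpha> b c :: real
  assumes s: "1 \<le> s" and b: "b \<noteq> 0" and c: "0 \<le> c"
  shows "((\<lambda>w. 1 / (pi * w) * Im (exp (- \<i> * of_real (w * \<alpha>)) * gain_transform s t c (\<i> * of_real (w * b)) * \<phi> w))
     has_integral (LBINT x:{c..}. x ^ t * exp (- (s * x)) * gp_limit \<phi> (\<alpha> + b * x))) {0<..}"
proof -
  define f where "f x = x ^ t * exp (- (s * x))" for x :: real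
  have [measurable]: "f \<in> borel_measurable borel" unfolding f_def by measurable
  have f0: "0 \<le> f x" if "c \<le> x" for x using that c by (simp add: f_def)
  define V where "V w = 1 / (pi * w) * Im (exp (- \<i> * of_real (w * \<alpha>)) * gain_transform s t c (\<i> * of_real (w * b)) * \<phi> w)" for w
  \<comment> \<open>Dominates the integrand for all \<open>w > 0\<close> at once: the kernel is
    bounded linearly in the threshold, hence linearly in the gain \<open>x\<close>, while the weight
    decays exponentially.\<close>
  define k where "k x = indicator {c..} x * (f x * ((B + \<bar>\<alpha>\<bar> + \<bar>b\<bar> * x) / pi))" for x
  note fint = set_integrable_power_exp_scale[OF s c]
  have kint: "integrable lborel k"
  proof -
    have "set_integrable lborel {c..} (\<lambda>x. ((B + \<bar>\<alpha>\<bar>) / pi) * (x ^ t * exp (- (s * x))) + (\<bar>b\<bar> / pi) * (x ^ Suc t * exp (- (s * x))))"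
      by (intro set_integral_add set_integrable_mult_right fint)
    moreover have "((B + \<bar>\<alpha>\<bar>) / pi) * (x ^ t * exp (- (s * x))) + (\<bar>b\<bar> / pi) * (x ^ Suc t * exp (- (s * x))) = f x * ((B + \<bar>\<alpha>\<bar> + \<bar>b\<bar> * x) / pi)" for x
      by (simp add: f_def add_divide_distrib distrib_left mult_ac)
    ultimately show ?thesis unfolding set_integrable_def k_def by simp
  qed
  have kb: "\<bar>indicator {c..} x * (f x * gp_kernel \<phi> (\<alpha> + b * x) w)\<bar> \<le> k x" if w: "0 < w" for x w
  proof (cases "c \<le> x")
    case True
    have "\<bar>\<alpha> + b * x\<bar> \<le> \<bar>\<alpha>\<bar> + \<bar>b\<bar> * x"
      using True c abs_triangle_ineq[of \<alpha> "b * x"] by (simp add: abs_mult)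
    then have "(B + \<bar>\<alpha> + b * x\<bar>) / pi \<le> (B + \<bar>\<alpha>\<bar> + \<bar>b\<bar> * x) / pi"
      by (intro divide_right_mono) auto
    then have "\<bar>gp_kernel \<phi> (\<alpha> + b * x) w\<bar> \<le> (B + \<bar>\<alpha>\<bar> + \<bar>b\<bar> * x) / pi"
      using abs_kernel_le(1)[OF w, of "\<alpha> + b * x"] by linarith
    then have "f x * \<bar>gp_kernel \<phi> (\<alpha> + b * x) w\<bar> \<le> f x * ((B + \<bar>\<alpha>\<bar> + \<bar>b\<bar> * x) / pi)"
      by (rule mult_left_mono[OF _ f0[OF True]])
    then show ?thesis using f0[OF True] True by (simp add: k_def abs_mult)
  qed (simp add: k_def)
  \<comment> \<open>The same quantity before the integral over the gain is evaluated. This form is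
    visibly measurable in \<open>w\<close>, and the bound by the integral of \<open>k\<close>
    applies to it.\<close>
  define V' where "V' w = (LINT x|lborel. indicator {c..} x * (f x * gp_kernel \<phi> (\<alpha> + b * x) w))" for w
  have V'm [measurable]: "V' \<in> borel_measurable borel"
    unfolding V'_def gp_kernel_def by measurable
  have inner: "V' w = V w" if w: "0 < w" for w
  proof -
    define q where "q = complex_of_real s + \<i> * of_real (w * b)"
    have q1: "1 \<le> Re q" using s by (simp add: q_def)
    define u where "u = exp (- \<i> * of_real (w * \<alpha>)) * \<phi> w"
    have "indicator {c..} x * (f x * gp_kernel \<phi> (\<alpha> + b * x) w) =
        1 / (pi * w) * Im (u * (indicator {c..} x *\<^sub>R (of_real (x ^ t) * exp (- q * of_real x))))" for x
    proof -
      have e: "exp (- \<i> * of_real (w * (\<alpha> + b * x))) * of_real (exp (- (s * x))) = exp (- \<i> * of_real (w * \<alpha>)) * exp (- q * of_real x)"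
        unfolding exp_of_real[symmetric] exp_add[symmetric] by (simp add: q_def algebra_simps)
      have "f x * Im (exp (- \<i> * of_real (w * (\<alpha> + b * x))) * \<phi> w)
          = Im (of_real (f x) * (exp (- \<i> * of_real (w * (\<alpha> + b * x))) * \<phi> w))"
        by (simp only: Im_complex_of_real Re_complex_of_real times_complex.sel(2) mult_zero_left add_0_right)
      also have "of_real (f x) * (exp (- \<i> * of_real (w * (\<alpha> + b * x))) * \<phi> w)
          = of_real (x ^ t) * \<phi> w * (exp (- \<i> * of_real (w * (\<alpha> + b * x))) * of_real (exp (- (s * x))))"
        by (simp add: f_def mult_ac)
      also have "\<dots> = u * (of_real (x ^ t) * exp (- q * of_real x))"
        unfolding e u_def by (simp only: mult_ac)
      finally have "f x * gp_kernel \<phi> (\<alpha> + b * x) w = 1 / (pi * w) * Im (u * (of_real (x ^ t) * exp (- q * of_real x)))"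
        unfolding gp_kernel_def by (metis mult.left_commute)
      then show ?thesis by (auto simp: indicator_def)
    qed
    then have "V' w = 1 / (pi * w) * (LINT x|lborel. Im (u * (indicator {c..} x *\<^sub>R (of_real (x ^ t) * exp (- q * of_real x)))))"
      unfolding V'_def by simp
    also have "(LINT x|lborel. Im (u * (indicator {c..} x *\<^sub>R (of_real (x ^ t) * exp (- q * of_real x)))))
       = Im (LINT x|lborel. u * (indicator {c..} x *\<^sub>R (of_real (x ^ t) * exp (- q * of_real x))))"
      using set_integrable_power_cexp[OF q1 c, of t] unfolding set_integrable_def
      by (intro integral_Im integrable_mult_right)
    also have "(LINT x|lborel. u * (indicator {c..} x *\<^sub>R (of_real (x ^ t) * exp (- q * of_real x))))
        = u * (LBINT x:{c..}. of_real (x ^ t) * exp (- q * of_real x))"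
      unfolding set_lebesgue_integral_def by (rule integral_mult_right_zero)
    also have "\<dots> = u * gain_transform s t c (\<i> * of_real (w * b))"
      unfolding gain_transform_def q_def[symmetric] power_cexp_integral_eq[OF q1 c] by (rule refl)
    finally show ?thesis unfolding V_def u_def by (simp only: mult_ac)
  qed
  have V'b: "\<exists>M. \<forall>w>0. \<bar>V' w\<bar> \<le> M * decay w"
  proof -
    define K where "K = (LINT x|lborel. k x)"
    define C where "C = fact t * (\<Sum>j\<le>t. c ^ j / fact j)"
    have C0: "0 \<le> C" unfolding C_def using c by (intro mult_nonneg_nonneg sum_nonneg) auto
    have V'K: "\<bar>V' w\<bar> \<le> K" if "0 < w" for w
      unfolding V'_def K_def real_norm_def[symmetric]
      by (rule Bochner_Integration.integral_norm_bound_integral) 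
        (use kint kb[OF that] in \<open>auto intro!: Bochner_Integration.integrable_bound[OF kint] AE_I2 order_trans[OF _ abs_ge_self] simp: gp_kernel_def\<close>)
    have K0: "0 \<le> K" using V'K[of 1] by linarith
    \<comment> \<open>For \<open>w \<le> 1\<close> the constant bound \<open>K\<close> suffices,
      because \<open>decay\<close> is at least \<open>B / pi\<close> there. For \<open>w > 1\<close>
      the transform contributes \<open>C / (w * \<bar>b\<bar>)\<close> and the kernel a second
      factor \<open>1 / w\<close>.\<close>
    have "\<bar>V' w\<bar> \<le> (K * pi / B + C / \<bar>b\<bar>) * decay w" if w: "0 < w" for w
    proof (cases "w \<le> 1")
      case True
      have "w\<^sup>2 \<le> 1" using True w by (intro power_le_one) auto
      then have "1 \<le> 2 / (1 + w\<^sup>2)" by (simp add: pos_le_divide_eq add_pos_nonneg)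
      then have "B / pi * 1 \<le> decay w" unfolding decay_def using B_pos by (intro mult_left_mono) auto
      then have "K * pi / B * (B / pi) \<le> K * pi / B * decay w"
        using K0 B_pos by (intro mult_left_mono) auto
      then have "K \<le> K * pi / B * decay w" using B_pos by simp
      also have "\<dots> \<le> (K * pi / B + C / \<bar>b\<bar>) * decay w"
        using C0 decay_nonneg by (intro mult_right_mono) auto
      finally show ?thesis using V'K[OF w] by simp
    next
      case False
      define q where "q = complex_of_real s + \<i> * of_real (w * b)"
      have q1: "1 \<le> Re q" using s by (simp add: q_def)
      have qb: "w * \<bar>b\<bar> \<le> norm q" using abs_Im_le_cmod[of q] w by (simp add: q_def abs_mult)
      have "norm (gain_transform s t c (\<i> * of_real (w * b))) \<le> C / norm q"
        unfolding gain_transform_def C_def q_def[symmetric] by (rule norm_power_cexp_integral_le[OF q1 c])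
      also have "\<dots> \<le> C / (w * \<bar>b\<bar>)" using frac_le[OF C0 order_refl _ qb] w b by simp
      finally have g: "norm (gain_transform s t c (\<i> * of_real (w * b))) \<le> C / (w * \<bar>b\<bar>)" .
      have "\<bar>Im (exp (- \<i> * of_real (w * \<alpha>)) * gain_transform s t c (\<i> * of_real (w * b)) * \<phi> w)\<bar>
         \<le> norm (gain_transform s t c (\<i> * of_real (w * b)) * \<phi> w)"
        unfolding mult.assoc by (rule abs_Im_exp_mult_le)
      also have "\<dots> \<le> C / (w * \<bar>b\<bar>) * B"
        unfolding norm_mult using g bound[OF w] by (intro mult_mono) (use C0 w in auto)
      finally have "\<bar>V w\<bar> \<le> (C / (w * \<bar>b\<bar>) * B) / (pi * w)"
        unfolding V_def
      proof -
        have "\<bar>1 / (pi * w) * X\<bar> \<le> Y / (pi * w)" if "\<bar>X\<bar> \<le> Y" for X Y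
          using that w by (simp add: abs_mult divide_right_mono)
        then show "\<bar>Im (exp (- \<i> * of_real (w * \<alpha>)) * gain_transform s t c (\<i> * of_real (w * b)) * \<phi> w)\<bar> \<le> C / (w * \<bar>b\<bar>) * B \<Longrightarrow>
            \<bar>1 / (pi * w) * Im (exp (- \<i> * of_real (w * \<alpha>)) * gain_transform s t c (\<i> * of_real (w * b)) * \<phi> w)\<bar> \<le> C / (w * \<bar>b\<bar>) * B / (pi * w)" .
      qed
      also have "\<dots> = C / \<bar>b\<bar> * (B / pi * (1 / w\<^sup>2))" by (simp add: power2_eq_square)
      also have "\<dots> \<le> C / \<bar>b\<bar> * decay w"
      proof -
        have "1 \<le> w\<^sup>2" using False by (intro one_le_power) auto
        then have "1 / w\<^sup>2 \<le> 2 / (1 + w\<^sup>2)" by (simp add: divide_simps)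
        then show ?thesis unfolding decay_def using C0 B_pos by (intro mult_left_mono) auto
      qed
      also have "\<dots> \<le> (K * pi / B + C / \<bar>b\<bar>) * decay w"
        using K0 B_pos decay_nonneg by (intro mult_right_mono) auto
      finally show ?thesis using inner[OF w] by simp
    qed
    then show ?thesis by blast
  qed
  then obtain M where M: "\<And>w. 0 < w \<Longrightarrow> \<bar>V' w\<bar> \<le> M * decay w" by auto
  have V'int: "set_integrable lborel {0<..} V'"
    by (rule set_integrable_bound[OF set_integrable_mult_right[OF set_integrable_decay, of M]])
      (use M in \<open>auto simp: set_borel_measurable_def intro!: AE_I2 order_trans[OF _ abs_ge_self]\<close>)
  have swap: "(LBINT w:{0<..real n}. V' w) = (LBINT x:{c..}. f x * gp_partial \<phi> n (\<alpha> + b * x))" for n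
  proof -
    let ?g = "\<lambda>w x. indicator {0<..real n} w * (indicator {c..} x * (f x * gp_kernel \<phi> (\<alpha> + b * x) w))"
    have "integrable (lborel \<Otimes>\<^sub>M lborel) (\<lambda>x. indicator {0<..real n} (fst x) * k (snd x))"
      by (intro integrable_lborel_product kint integrable_real_indicator) auto
    then have gi: "integrable (lborel \<Otimes>\<^sub>M lborel) (case_prod ?g)"
    proof (rule Bochner_Integration.integrable_bound)
      show "case_prod ?g \<in> borel_measurable (lborel \<Otimes>\<^sub>M lborel)" unfolding gp_kernel_def by measurable
      have "\<bar>?g w x\<bar> \<le> \<bar>indicator {0<..real n} w * k x\<bar>" for w x
        using kb[of w x] by (auto simp: indicator_def)
      then show "AE x in lborel \<Otimes>\<^sub>M lborel. norm (case_prod ?g x) \<le> norm (indicator {0<..real n} (fst x) * k (snd x))"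
        by (intro AE_I2) (auto simp: case_prod_beta)
    qed
    have pt: "(LINT w|lborel. ?g w x) = indicator {c..} x *\<^sub>R (f x * gp_partial \<phi> n (\<alpha> + b * x))" for x
    proof -
      have "?g w x = (indicator {c..} x * f x) * (indicator {0<..real n} w *\<^sub>R gp_kernel \<phi> (\<alpha> + b * x) w)" for w by simp
      then have "(LINT w|lborel. ?g w x) = (indicator {c..} x * f x) * (LINT w|lborel. indicator {0<..real n} w *\<^sub>R gp_kernel \<phi> (\<alpha> + b * x) w)"
        by (simp only: integral_mult_right_zero)
      then show ?thesis by (simp add: gp_partial_def set_lebesgue_integral_def)
    qed
    have "(LBINT w:{0<..real n}. V' w) = (LINT w|lborel. LINT x|lborel. ?g w x)"
      unfolding set_lebesgue_integral_def V'_def by simp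
    also have "\<dots> = (LINT x|lborel. LINT w|lborel. ?g w x)"
      using lborel_pair.Fubini_integral[OF gi] by simp
    also have "\<dots> = (LBINT x:{c..}. f x * gp_partial \<phi> n (\<alpha> + b * x))"
      unfolding set_lebesgue_integral_def by (intro Bochner_Integration.integral_cong refl pt)
    finally show ?thesis .
  qed
  have "(\<lambda>n. LBINT x:{c..}. f x * gp_partial \<phi> n (\<alpha> + b * x)) \<longlonglongrightarrow> (LBINT x:{c..}. f x * gp_limit \<phi> (\<alpha> + b * x))"
    unfolding set_lebesgue_integral_def
  proof -
    obtain C where C: "\<And>n z. \<bar>gp_partial \<phi> n z\<bar> \<le> C" using gp_partial_bounded by auto
    have C0: "0 \<le> C" using C[of 0 0] by linarith
    show "(\<lambda>n. LINT x|lborel. indicator {c..} x *\<^sub>R (f x * gp_partial \<phi> n (\<alpha> + b * x)))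
       \<longlonglongrightarrow> (LINT x|lborel. indicator {c..} x *\<^sub>R (f x * gp_limit \<phi> (\<alpha> + b * x)))"
    proof (rule integral_dominated_convergence[where w = "\<lambda>x. indicator {c..} x *\<^sub>R (C * f x)"])
      show "integrable lborel (\<lambda>x. indicator {c..} x *\<^sub>R (C * f x))"
        using set_integrable_mult_right[OF fint[of t], of C] by (simp add: set_integrable_def f_def)
      show "AE x in lborel. (\<lambda>n. indicator {c..} x *\<^sub>R (f x * gp_partial \<phi> n (\<alpha> + b * x))) \<longlonglongrightarrow> indicator {c..} x *\<^sub>R (f x * gp_limit \<phi> (\<alpha> + b * x))"
        \<comment> \<open>The single gain at which the threshold hits \<open>0\<close>.\<close>
        using AE_lborel_singleton[of "- \<alpha> / b"]
      proof eventually_elim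
        case (elim x)
        then have "\<alpha> + b * x \<noteq> 0" using b by (auto simp: field_simps add_eq_0_iff)
        then show ?case by (intro tendsto_intros gp_partial_tendsto)
      qed
      show "AE x in lborel. norm (indicator {c..} x *\<^sub>R (f x * gp_partial \<phi> n (\<alpha> + b * x))) \<le> indicator {c..} x *\<^sub>R (C * f x)" for n
      proof (rule AE_I2)
        fix x
        have "\<bar>gp_partial \<phi> n (\<alpha> + b * x)\<bar> * f x \<le> C * f x" if "c \<le> x"
          by (rule mult_right_mono[OF C f0[OF that]])
        then show "norm (indicator {c..} x *\<^sub>R (f x * gp_partial \<phi> n (\<alpha> + b * x))) \<le> indicator {c..} x *\<^sub>R (C * f x)"
          using f0 by (cases "c \<le> x") (auto simp: abs_mult mult.commute[of "f x"])
      qed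
    qed measurable
  qed
  then have "(\<lambda>n. LBINT w:{0<..real n}. V' w) \<longlonglongrightarrow> (LBINT x:{c..}. f x * gp_limit \<phi> (\<alpha> + b * x))"
    unfolding swap .
  then have eq: "(LBINT w:{0<..}. V' w) = (LBINT x:{c..}. f x * gp_limit \<phi> (\<alpha> + b * x))"
    using LBINT_Ioc_tendsto[OF V'int] by (metis LIMSEQ_unique)
  have "(V' has_integral (LBINT w:{0<..}. V' w)) {0<..}"
    using set_borel_integral_eq_integral[OF V'int] by (simp add: has_integral_iff)
  then have "(V has_integral (LBINT w:{0<..}. V' w)) {0<..}"
    by (rule has_integral_eq[rotated]) (simp add: inner)
  then show ?thesis unfolding eq V_def f_def .
qed

end

subsection \<open>The interference and the serving link\<close>

text \<open>Cartesian coordinates replace \<open>Arg\<close>; measurability and a bound on the disc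
  are then immediate.\<close>

lemma wall_mean_eq: "wall_mean S z = lam_w S * (\<bar>Re z\<bar> + \<bar>Im z\<bar>)"
proof -
  have "Re z = cmod z * cos (Arg z)" "Im z = cmod z * sin (Arg z)"
    using rcis_cmod_Arg[of z] Re_rcis Im_rcis by metis+
  then have "\<bar>Re z\<bar> = cmod z * \<bar>cos (Arg z)\<bar>" "\<bar>Im z\<bar> = cmod z * \<bar>sin (Arg z)\<bar>"
    by (metis abs_mult abs_norm_cancel)+
  then show ?thesis by (simp add: wall_mean_def algebra_simps)
qed

locale network_prob = prob_space M + network_params S
  for S :: network and M :: "'w measure"
    and C :: "nat \<Rightarrow> 'w \<Rightarrow> nat" and X :: "nat \<Rightarrow> nat \<Rightarrow> 'w \<Rightarrow> complex"
    and h :: "nat \<Rightarrow> nat \<Rightarrow> 'w \<Rightarrow> real" and g :: "'w \<Rightarrow> real" +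
  assumes model: "network_model S M C X h g"
begin

abbreviation "L \<equiv> L0 S C X"
abbreviation "I \<equiv> I_MU S C X h"

lemma poisson: "present N \<Longrightarrow> poisson_process M (tx_measure S N) (C N) (X N)"
  and fading: "present N \<Longrightarrow> distributed M lborel (h N i) (exponential_density 1)"
  and gain_measurable [measurable]: "g \<in> borel_measurable M"
  and indep_sources: "indep_sets (source_events M C X h g) (sources S)"
  using model by (auto simp: network_model_def)

lemma sets_tx_measure [simp]: "sets (tx_measure S N) = sets borel"
  and space_tx_measure [simp]: "space (tx_measure S N) = UNIV"
  by (simp_all add: tx_measure_def)

lemma
  assumes "present N"
  shows count_measurable_M: "C N \<in> measurable M (count_space UNIV)"
    and fading_measurable_M: "h N i \<in> borel_measurable M"
  using poisson[OF assms] distributed_measurable[OF fading[OF assms, of i]]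
  by (simp_all add: poisson_process_def)

text \<open>Everything except the serving gain. \<open>L\<close> and \<open>I\<close> are measurable
  for the generated algebra, which makes the pair independent of \<open>g\<close>.\<close>

definition network_events :: "'w set set" where
  "network_events = (\<Union>src\<in>sources S - {Serving}. source_events M C X h g src)"

definition network_algebra :: "'w measure" where
  "network_algebra = sigma (space M) network_events"

lemma source_events_subset: "src \<in> sources S \<Longrightarrow> source_events M C X h g src \<subseteq> events"
  using indep_sources by (auto simp: indep_sets_def)

lemma network_events_subset: "network_events \<subseteq> Pow (space M)"
  using source_events_subset sets.space_closed by (force simp: network_events_def)

lemma space_network_algebra [simp]: "space network_algebra = space M"
  by (simp add: network_algebra_def space_measure_of_conv)

lemma sets_network_algebra: "sets network_algebra = sigma_sets (space M) network_events"
  unfolding network_algebra_def by (rule sets_measure_of[OF network_events_subset])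

lemma network_algebra_subset: "sets network_algebra \<subseteq> events"
  unfolding sets_network_algebra
  by (rule sets.sigma_sets_subset) (use source_events_subset in \<open>auto simp: network_events_def\<close>)

lemma measurable_network_algebraI: "f \<in> measurable network_algebra A \<Longrightarrow> f \<in> measurable M A"
  using network_algebra_subset by (auto simp: measurable_def)

lemma
  assumes N: "present N"
  shows count_measurable: "C N \<in> measurable network_algebra (count_space UNIV)"
    and point_measurable: "X N i \<in> borel_measurable network_algebra"
    and fading_measurable: "h N i \<in> borel_measurable network_algebra"
proof -
  let ?Q = "count_space UNIV \<Otimes>\<^sub>M PiM UNIV (\<lambda>_. borel) :: (nat \<times> (nat \<Rightarrow> complex)) measure"
  have p: "(\<lambda>\<omega>. (C N \<omega>, \<lambda>i. X N i \<omega>)) \<in> measurable network_algebra ?Q"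
  proof (rule measurableI)
    fix A assume A: "A \<in> sets ?Q"
    have "(\<lambda>\<omega>. (C N \<omega>, \<lambda>i. X N i \<omega>)) -` A \<inter> space M \<in> network_events"
      unfolding network_events_def using N A
      by (intro UN_I[of "Process N"]) (auto simp: sources_def source_events_def)
    then show "(\<lambda>\<omega>. (C N \<omega>, \<lambda>i. X N i \<omega>)) -` A \<inter> space network_algebra \<in> sets network_algebra"
      by (auto simp: sets_network_algebra)
  qed (auto simp: space_pair_measure space_PiM)
  have "(\<lambda>\<omega>. fst (C N \<omega>, \<lambda>i. X N i \<omega>)) \<in> measurable network_algebra (count_space UNIV)"
    by (rule measurable_compose[OF p measurable_fst])
  then show "C N \<in> measurable network_algebra (count_space UNIV)" by simp
  have "(\<lambda>\<omega>. snd (C N \<omega>, \<lambda>i. X N i \<omega>)) \<in> measurable network_algebra (PiM UNIV (\<lambda>_. borel))"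
    by (rule measurable_compose[OF p measurable_snd])
  then have "(\<lambda>\<omega>. snd (C N \<omega>, \<lambda>i. X N i \<omega>) i) \<in> borel_measurable network_algebra"
    by (rule measurable_compose[OF _ measurable_component_singleton]) simp
  then show "X N i \<in> borel_measurable network_algebra" by simp
  show "h N i \<in> borel_measurable network_algebra"
  proof (rule measurableI)
    fix A :: "real set" assume A: "A \<in> sets borel"
    have "h N i -` A \<inter> space M \<in> network_events"
      unfolding network_events_def using N A
      by (intro UN_I[of "Fading N i"]) (auto simp: sources_def source_events_def)
    then show "h N i -` A \<inter> space network_algebra \<in> sets network_algebra"
      by (auto simp: sets_network_algebra)
  qed simp
qed

lemma path_loss_measurable [measurable]: "path_loss S N \<in> borel_measurable borel"
  unfolding path_loss_def by measurable

lemma L_measurable_network: "L \<in> borel_measurable network_algebra"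
proof -
  \<comment> \<open>The range of the infimum is random. Padding with \<open>top\<close> gives a
    countable infimum over a fixed index set.\<close>
  have inf: "(INF i\<in>{..<n}. p i) = (INF i. if i < n then p i else top)" for n and p :: "nat \<Rightarrow> ennreal"
  proof (rule antisym)
    show "(INF i\<in>{..<n}. p i) \<le> (INF i. if i < n then p i else top)"
      by (rule INF_greatest) (auto intro: INF_lower)
    show "(INF i. if i < n then p i else top) \<le> (INF i\<in>{..<n}. p i)"
    proof (rule INF_greatest)
      fix i assume "i \<in> {..<n}"
      then show "(INF i. if i < n then p i else top) \<le> p i"
        by (intro INF_lower2[of i]) auto
    qed
  qed
  have eq: "L \<omega> = (INF N\<in>{N. present N}. INF i. if i < C N \<omega> then path_loss S N (cmod (X N i \<omega>)) else top)" for \<omega>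
    unfolding L0_def inf ..
  have "(\<lambda>\<omega>. if i < C N \<omega> then path_loss S N (cmod (X N i \<omega>)) else top) \<in> borel_measurable network_algebra"
    if N: "present N" for N i
  proof -
    note [measurable] = count_measurable[OF N] point_measurable[OF N]
    show ?thesis by measurable
  qed
  then show ?thesis unfolding eq[abs_def] by (intro borel_measurable_INF) auto
qed

lemma I_measurable_network: "I \<in> borel_measurable network_algebra"
proof -
  note [measurable] = L_measurable_network
  have "(\<lambda>\<omega>. if present N then \<Sum>i<C N \<omega>. (let l = path_loss S N (cmod (X N i \<omega>)) in
                 if L \<omega> < l then h N i \<omega> * enn2real (1 / l) else 0) else 0) \<in> borel_measurable network_algebra" for N
  proof (cases "present N")
    case True
    note [measurable] = count_measurable[OF True] point_measurable[OF True] fading_measurable[OF True]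
    have "(\<lambda>\<omega>. \<Sum>i<n. (let l = path_loss S N (cmod (X N i \<omega>)) in
                 if L \<omega> < l then h N i \<omega> * enn2real (1 / l) else 0)) \<in> borel_measurable network_algebra" for n
      unfolding Let_def by measurable
    then have "(\<lambda>\<omega>. \<Sum>i<C N \<omega>. (let l = path_loss S N (cmod (X N i \<omega>)) in
                 if L \<omega> < l then h N i \<omega> * enn2real (1 / l) else 0)) \<in> borel_measurable network_algebra"
      by (rule measurable_compose_countable[OF _ count_measurable[OF True]])
    then show ?thesis using True by simp
  qed simp
  then show ?thesis unfolding I_MU_def[abs_def] by (rule borel_measurable_suminf)
qed

lemma L_measurable [measurable]: "L \<in> borel_measurable M"
  and I_measurable [measurable]: "I \<in> borel_measurable M"
  using L_measurable_network I_measurable_network by (auto intro: measurable_network_algebraI)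

lemma Int_stable_source_events: "Int_stable (source_events M C X h g src)"
proof (rule Int_stableI)
  have st: "a \<inter> b \<in> {f -` A \<inter> space M | A. A \<in> sets N}"
    if ab: "a \<in> {f -` A \<inter> space M | A. A \<in> sets N}" "b \<in> {f -` A \<inter> space M | A. A \<in> sets N}"
    for a b and f :: "'w \<Rightarrow> 'c" and N
  proof -
    obtain A B where AB: "A \<in> sets N" "B \<in> sets N" "a = f -` A \<inter> space M" "b = f -` B \<inter> space M"
      using ab by auto
    then have "a \<inter> b = f -` (A \<inter> B) \<inter> space M" "A \<inter> B \<in> sets N" by auto
    then show ?thesis by blast
  qed
  fix a b assume "a \<in> source_events M C X h g src" "b \<in> source_events M C X h g src"
  then show "a \<inter> b \<in> source_events M C X h g src"
    unfolding source_events_def by - (cases src; simp only: source.case; erule (1) st)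
qed

abbreviation "LI \<equiv> \<lambda>\<omega>. (L \<omega>, I \<omega>)"

lemma LI_measurable: "LI \<in> measurable M (borel \<Otimes>\<^sub>M borel)"
  by measurable

text \<open>The independent sources are grouped into two blocks, \<open>Serving\<close> and all
  others. Independence passes to the generated algebras because each family of source events is
  closed under intersection.\<close>

lemma prob_network_gain:
  assumes A: "A \<in> sets (borel \<Otimes>\<^sub>M borel)" and B: "B \<in> sets borel"
  shows "prob ((LI -` A \<inter> space M) \<inter> (g -` B \<inter> space M)) = prob (LI -` A \<inter> space M) * prob (g -` B \<inter> space M)"
proof (rule indep_setD)
  have S: "Serving \<in> sources S" by (simp add: sources_def)
  let ?J = "\<lambda>b. if b then sources S - {Serving} else {Serving}"
  have "indep_sets (\<lambda>b. sigma_sets (space M) (\<Union>i\<in>?J b. source_events M C X h g i)) UNIV"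
  proof (rule indep_sets_collect_sigma)
    have "(\<Union>b. ?J b) = sources S" using S by (auto simp: UNIV_bool)
    then show "indep_sets (source_events M C X h g) (\<Union>b\<in>UNIV. ?J b)" using indep_sources by simp
  qed (auto simp: disjoint_family_on_def Int_stable_source_events)
  then show "indep_set (sets network_algebra) (source_events M C X h g Serving)"
    unfolding indep_set_def
    by (rule indep_sets_mono_sets) (auto simp: sets_network_algebra network_events_def split: bool.splits)
  have "LI \<in> measurable network_algebra (borel \<Otimes>\<^sub>M borel)"
    using L_measurable_network I_measurable_network by (rule measurable_Pair)
  from measurable_sets[OF this A] show "LI -` A \<inter> space M \<in> sets network_algebra" by simp
  show "g -` B \<inter> space M \<in> source_events M C X h g Serving"
    using B by (auto simp: source_events_def)
qed

lemma distr_network_gain: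
  "distr M (borel \<Otimes>\<^sub>M borel) LI \<Otimes>\<^sub>M distr M borel g
     = distr M ((borel \<Otimes>\<^sub>M borel) \<Otimes>\<^sub>M borel) (\<lambda>\<omega>. (LI \<omega>, g \<omega>))"
proof (rule pair_measure_eqI)
  interpret D1: prob_space "distr M (borel \<Otimes>\<^sub>M borel) LI" by (rule prob_space_distr) measurable
  interpret D2: prob_space "distr M borel g" by (rule prob_space_distr) measurable
  show "sigma_finite_measure (distr M (borel \<Otimes>\<^sub>M borel) LI)" "sigma_finite_measure (distr M borel g)"
    by unfold_locales
  show "sets (distr M (borel \<Otimes>\<^sub>M borel) LI \<Otimes>\<^sub>M distr M borel g)
      = sets (distr M ((borel \<Otimes>\<^sub>M borel) \<Otimes>\<^sub>M borel) (\<lambda>\<omega>. (LI \<omega>, g \<omega>)))"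
    by (simp cong: sets_pair_measure_cong)
  fix A B assume A: "A \<in> sets (distr M (borel \<Otimes>\<^sub>M borel) LI)" and B: "B \<in> sets (distr M borel g)"
  then have A': "A \<in> sets (borel \<Otimes>\<^sub>M borel)" and B': "B \<in> sets borel" by simp_all
  have AB: "A \<times> B \<in> sets ((borel \<Otimes>\<^sub>M borel) \<Otimes>\<^sub>M borel)" using A' B' by (rule pair_measureI)
  have "(\<lambda>\<omega>. (LI \<omega>, g \<omega>)) -` (A \<times> B) \<inter> space M = (LI -` A \<inter> space M) \<inter> (g -` B \<inter> space M)" by auto
  then have "emeasure (distr M ((borel \<Otimes>\<^sub>M borel) \<Otimes>\<^sub>M borel) (\<lambda>\<omega>. (LI \<omega>, g \<omega>))) (A \<times> B)
      = ennreal (prob (LI -` A \<inter> space M) * prob (g -` B \<inter> space M))"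
    using AB by (subst emeasure_distr) (auto simp: emeasure_eq_measure prob_network_gain[OF A' B'])
  also have "\<dots> = emeasure (distr M (borel \<Otimes>\<^sub>M borel) LI) A * emeasure (distr M borel g) B"
    using A' B' by (simp add: emeasure_distr emeasure_eq_measure ennreal_mult)
  finally show "emeasure (distr M (borel \<Otimes>\<^sub>M borel) LI) A * emeasure (distr M borel g) B
      = emeasure (distr M ((borel \<Otimes>\<^sub>M borel) \<Otimes>\<^sub>M borel) (\<lambda>\<omega>. (LI \<omega>, g \<omega>))) (A \<times> B)" by simp
qed

section \<open>Finiteness of the network and sign of the interference\<close>

lemma tx_mass_le:
  "emeasure (tx_measure S N) UNIV \<le> ennreal (lam_PH S * (2 * lam_w S * R_D S) ^ N / fact N) * emeasure lborel (cball (0::complex) (R_D S))"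
proof -
  have [measurable]: "wall_mean S \<in> borel_measurable borel"
    unfolding wall_mean_eq[abs_def] by measurable
  have "emeasure (tx_measure S N) UNIV = (\<integral>\<^sup>+z. indicator (cball 0 (R_D S)) z *
     ennreal (lam_PH S * wall_mean S z ^ N / fact N * exp (- wall_mean S z)) \<partial>lborel)"
  proof -
    have m: "(\<lambda>z. indicator (cball 0 (R_D S)) z *
       ennreal (lam_PH S * wall_mean S z ^ N / fact N * exp (- wall_mean S z))) \<in> borel_measurable lborel"
      unfolding wall_mean_eq by (intro borel_measurable_times_ennreal borel_measurable_indicator) (auto intro: borel_measurable_continuous_onI continuous_intros)
    show ?thesis unfolding tx_measure_def by (subst emeasure_density[OF m]) simp_all
  qed
  also have "\<dots> \<le> (\<integral>\<^sup>+z. ennreal (lam_PH S * (2 * lam_w S * R_D S) ^ N / fact N) * indicator (cball (0::complex) (R_D S)) z \<partial>lborel)"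
  proof (rule nn_integral_mono)
    fix z :: complex
    have "lam_PH S * wall_mean S z ^ N / fact N * exp (- wall_mean S z) \<le> lam_PH S * (2 * lam_w S * R_D S) ^ N / fact N"
      if "z \<in> cball 0 (R_D S)"
    proof -
      have w0: "0 \<le> wall_mean S z" unfolding wall_mean_eq using lam_w_nonneg by simp
      have "\<bar>Re z\<bar> + \<bar>Im z\<bar> \<le> 2 * R_D S"
        using abs_Re_le_cmod[of z] abs_Im_le_cmod[of z] that by simp
      then have "wall_mean S z \<le> lam_w S * (2 * R_D S)"
        unfolding wall_mean_eq using lam_w_nonneg by (intro mult_left_mono) auto
      then have "wall_mean S z ^ N \<le> (2 * lam_w S * R_D S) ^ N" using w0 by (intro power_mono) (auto simp: mult_ac)
      then have "lam_PH S * wall_mean S z ^ N / fact N \<le> lam_PH S * (2 * lam_w S * R_D S) ^ N / fact N"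
        using lam_PH_nonneg by (intro divide_right_mono mult_left_mono) auto
      then have "lam_PH S * wall_mean S z ^ N / fact N * exp (- wall_mean S z) \<le> lam_PH S * (2 * lam_w S * R_D S) ^ N / fact N * 1"
        using w0 lam_PH_nonneg lam_w_nonneg R by (intro mult_mono) auto
      then show ?thesis by simp
    qed
    then show "indicator (cball 0 (R_D S)) z * ennreal (lam_PH S * wall_mean S z ^ N / fact N * exp (- wall_mean S z))
       \<le> ennreal (lam_PH S * (2 * lam_w S * R_D S) ^ N / fact N) * indicator (cball 0 (R_D S)) z"
      by (auto simp: indicator_def intro!: ennreal_leI)
  qed
  also have "\<dots> = ennreal (lam_PH S * (2 * lam_w S * R_D S) ^ N / fact N) * emeasure lborel (cball (0::complex) (R_D S))"
    by (intro nn_integral_cmult_indicator) auto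
  finally show ?thesis .
qed

text \<open>The probability that a Poisson process of mass \<open>m\<close> has no points gives
  \<open>1 - exp (- m) \<le> m\<close>. The mass is estimated crudely, with \<open>wall_mean\<close>
  at most \<open>2 * lam_w * R_D\<close> on the disc; the factorial still makes the bound
  summable.\<close>

lemma prob_count_pos_le:
  assumes N: "present N"
  shows "prob {\<omega> \<in> space M. 0 < C N \<omega>} \<le> lam_PH S * measure lborel (cball (0::complex) (R_D S)) * ((2 * lam_w S * R_D S) ^ N / fact N)"
proof -
  note [measurable] = count_measurable_M[OF N]
  let ?m = "measure (tx_measure S N) UNIV"
  have fin: "emeasure lborel (cball (0::complex) (R_D S)) = ennreal (measure lborel (cball (0::complex) (R_D S)))"
    by (intro emeasure_eq_ennreal_measure) (use emeasure_lborel_cball_finite[of "0::complex" "R_D S"] in auto)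
  let ?k = "lam_PH S * (2 * lam_w S * R_D S) ^ N / fact N"
  have k: "0 \<le> ?k" using lam_PH_nonneg lam_w_nonneg R by simp
  have "emeasure (tx_measure S N) UNIV \<le> ennreal (?k * measure lborel (cball (0::complex) (R_D S)))"
    using tx_mass_le[of N] unfolding fin ennreal_mult'[OF k, symmetric] .
  then have le: "?m \<le> ?k * measure lborel (cball (0::complex) (R_D S))"
    unfolding measure_def[of "tx_measure S N"]
    by (rule enn2real_leI[rotated]) (rule mult_nonneg_nonneg[OF k measure_nonneg])
  have "prob {\<omega> \<in> space M. point_count (C N) (X N) UNIV \<omega> = 0} = ?m ^ 0 / fact 0 * exp (- ?m)"
    using poisson[OF N] by (auto simp: poisson_process_def)
  then have "prob {\<omega> \<in> space M. C N \<omega> = 0} = exp (- ?m)"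
    by (simp add: point_count_def)
  moreover have "prob {\<omega> \<in> space M. 0 < C N \<omega>} = 1 - prob {\<omega> \<in> space M. C N \<omega> = 0}"
  proof -
    have "{\<omega> \<in> space M. 0 < C N \<omega>} = space M - {\<omega> \<in> space M. C N \<omega> = 0}" by auto
    then show ?thesis by (simp add: prob_compl)
  qed
  moreover have "1 - exp (- ?m) \<le> ?m" using exp_ge_add_one_self[of "- ?m"] by linarith
  ultimately have "prob {\<omega> \<in> space M. 0 < C N \<omega>} \<le> ?m" by simp
  then show ?thesis using le by (simp add: mult_ac)
qed

text \<open>Borel-Cantelli. It turns the series defining \<open>I_MU\<close> into a finite sum
  almost surely, so that its terms determine the sign of its value.\<close>

lemma AE_eventually_no_transmitters: "AE \<omega> in M. \<forall>\<^sub>F N in sequentially. present N \<longrightarrow> C N \<omega> = 0"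
proof -
  let ?A = "\<lambda>N. if present N then {\<omega> \<in> space M. 0 < C N \<omega>} else {}"
  have "AE \<omega> in M. \<forall>\<^sub>F N in sequentially. \<omega> \<in> space M - ?A N"
  proof (rule borel_cantelli_AE1)
    show "?A N \<in> events" for N
    proof (cases "present N")
      case True
      note [measurable] = count_measurable_M[OF True]
      have "{\<omega> \<in> space M. 0 < C N \<omega>} \<in> events" by measurable
      then show ?thesis using True by simp
    qed simp
    show "emeasure M (?A N) < \<infinity>" for N by (simp add: emeasure_eq_measure)
    show "summable (\<lambda>N. prob (?A N))"
    proof (rule summable_norm_majorant(1))
      show "summable (\<lambda>N. lam_PH S * measure lborel (cball (0::complex) (R_D S)) * ((2 * lam_w S * R_D S) ^ N / fact N))"
        using summable_exp_generic[of "2 * lam_w S * R_D S"] by (intro summable_mult) (simp add: divide_inverse mult.commute)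
      show "norm (prob (?A N)) \<le> lam_PH S * measure lborel (cball (0::complex) (R_D S)) * ((2 * lam_w S * R_D S) ^ N / fact N)" for N
        using prob_count_pos_le[of N] lam_PH_nonneg lam_w_nonneg R by auto
    qed
  qed
  then show ?thesis
  proof eventually_elim
    case (elim \<omega>)
    then show ?case by eventually_elim (auto split: if_splits)
  qed
qed

lemma AE_fading_nonneg: "AE \<omega> in M. \<forall>N i. present N \<longrightarrow> 0 \<le> h N i \<omega>"
proof -
  have "AE \<omega> in M. 0 \<le> h N i \<omega>" if N: "present N" for N i
  proof -
    have "AE x in lborel. 0 < exponential_density 1 x \<longrightarrow> 0 \<le> x"
      by (auto simp: exponential_density_def)
    then have "AE x in density lborel (exponential_density 1). 0 \<le> x"
      by (subst AE_density) auto
    then have "AE x in distr M lborel (h N i). 0 \<le> x"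
      using distributed_distr_eq_density[OF fading[OF N, of i]] by (simp only:)
    then show ?thesis using fading_measurable_M[OF N] by (subst (asm) AE_distr_iff) auto
  qed
  then have "AE \<omega> in M. present N \<longrightarrow> 0 \<le> h N i \<omega>" for N i by (cases "present N") auto
  then show ?thesis by (simp add: AE_all_countable)
qed

text \<open>Keeps the denominator in the rate positive, so that the rate inequality can be solved
  for the interference.\<close>

lemma AE_I_nonneg: "AE \<omega> in M. 0 \<le> I \<omega>"
  using AE_eventually_no_transmitters AE_fading_nonneg
proof eventually_elim
  case (elim \<omega>)
  let ?f = "\<lambda>N. if present N then \<Sum>i<C N \<omega>. (let l = path_loss S N (cmod (X N i \<omega>)) in
                 if L \<omega> < l then h N i \<omega> * enn2real (1 / l) else 0) else 0"
  obtain n where n: "\<And>N. n \<le> N \<Longrightarrow> present N \<Longrightarrow> C N \<omega> = 0"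
    using elim(1) by (auto simp: eventually_sequentially)
  have "summable ?f"
    by (rule summable_finite[of "{..<n}"]) (use n in \<open>auto simp: not_less\<close>)
  moreover have "0 \<le> ?f N" for N
    using elim(2) by (auto simp: Let_def intro!: sum_nonneg)
  ultimately show ?case unfolding I_MU_def by (intro suminf_nonneg)
qed

end

subsection \<open>The law of the minimum path loss\<close>

locale network_path_loss = network_prob +
  assumes cdf_L0: "\<And>\<alpha>. 0 \<le> \<alpha> \<Longrightarrow>
      measure M {\<omega> \<in> space M. L0 S C X \<omega> \<le> ennreal \<alpha>} =
        1 - (\<Prod>N. if enat N \<le> N_max S then exp (- Lam_N S N \<alpha>) else 1)"
begin

lemma prob_L_le: "0 \<le> \<alpha> \<Longrightarrow> prob {\<omega> \<in> space M. L \<omega> \<le> ennreal \<alpha>} = 1 - exp (- Lam S \<alpha>)"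
  by (simp add: cdf_L0 prodinf_exp_Lam)

lemma AE_L_pos: "AE \<omega> in M. 0 < L \<omega>"
proof -
  have "prob {\<omega> \<in> space M. L \<omega> \<le> 0} = 0" using prob_L_le[of 0] by (simp add: Lam_0)
  then have "AE \<omega> in M. \<not> L \<omega> \<le> 0"
    by (intro AE_I[where N = "{\<omega> \<in> space M. L \<omega> \<le> 0}"]) (auto simp: emeasure_eq_measure)
  then show ?thesis by eventually_elim (simp add: zero_less_iff_neq_zero)
qed

text \<open>Read off from the law of the minimum path loss rather than from the alternating
  series.\<close>

lemma Lam_mono:
  assumes "0 \<le> x" "x \<le> y"
  shows "Lam S x \<le> Lam S y"
proof -
  have "prob {\<omega> \<in> space M. L \<omega> \<le> ennreal x} \<le> prob {\<omega> \<in> space M. L \<omega> \<le> ennreal y}"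
    using assms by (intro finite_measure_mono) (auto intro: order_trans[OF _ ennreal_leI])
  then show ?thesis using prob_L_le[of x] prob_L_le[of y] assms by simp
qed

lemma Lam'_nonneg:
  assumes "0 < y" "y \<notin> edges"
  shows "0 \<le> Lam' y"
proof (rule ccontr)
  assume "\<not> 0 \<le> Lam' y"
  then obtain d where d: "0 < d" "\<And>h. 0 < h \<Longrightarrow> h < d \<Longrightarrow> Lam S (y + h) < Lam S y"
    using DERIV_neg_dec_right[OF DERIV_Lam[OF assms]] by force
  then have "Lam S (y + d / 2) < Lam S y" by simp
  moreover have "Lam S y \<le> Lam S (y + d / 2)" by (rule Lam_mono) (use d assms in auto)
  ultimately show False by linarith
qed

lemma Lam_measurable [measurable]: "Lam S \<in> borel_measurable borel"
  unfolding Lam_def[abs_def] Lam_N_def Let_def below_edge_def by measurable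

text \<open>Taking the maximum with \<open>0\<close> provides a nonnegative function everywhere. For
  positive \<open>y\<close> off the edges it changes nothing, by \<open>Lam'_nonneg\<close>.\<close>

definition dens :: "real \<Rightarrow> real" where
  "dens y = (if 0 < y then max 0 (Lam' y) * exp (- Lam S y) else 0)"

lemma dens_measurable [measurable]: "dens \<in> borel_measurable borel"
  unfolding dens_def by measurable

lemma dens_nonneg [simp]: "0 \<le> dens y"
  by (simp add: dens_def)

lemma dens_eq:
  assumes "0 < y" "y \<notin> edges"
  shows "dens y = deriv (Lam S) y * exp (- Lam S y)"
  using Lam'_nonneg[OF assms] DERIV_imp_deriv[OF DERIV_Lam[OF assms]] assms by (simp add: dens_def)

lemma countable_edges: "countable (edges \<inter> {0..})"
proof -
  have eq: "edges \<inter> {0..} = (\<Union>n::nat. edges \<inter> {0..real n})"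
    using real_arch_simple by fastforce
  show ?thesis unfolding eq by (rule countable_UN[OF countableI_type]) (rule countable_finite[OF finite_edges])
qed

lemma nn_integral_dens: 
  assumes "0 \<le> a"
  shows "(\<integral>\<^sup>+y. ennreal (dens y) * indicator {..a} y \<partial>lborel) = ennreal (1 - exp (- Lam S a))"
proof -
  have "(dens has_integral (1 - exp (- Lam S a))) {0..a}"
    by (rule has_integral_spike_finite[where S = "insert 0 (edges \<inter> {0..a})", OF _ _ has_integral_Lam_density[OF assms]])
      (use finite_edges Lam'_nonneg in \<open>auto simp: dens_def\<close>)
  then have "((\<lambda>y. if y \<in> {0..a} then dens y else 0) has_integral (1 - exp (- Lam S a))) UNIV"
    by (simp only: has_integral_restrict_UNIV)
  then have "(\<integral>\<^sup>+y. ennreal (if y \<in> {0..a} then dens y else 0) \<partial>lborel) = ennreal (1 - exp (- Lam S a))"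
    by (intro nn_integral_has_integral_lborel) auto
  moreover have "ennreal (dens y) * indicator {..a} y = ennreal (if y \<in> {0..a} then dens y else 0)" for y
    by (auto simp: dens_def indicator_def)
  ultimately show ?thesis by simp
qed

definition Y :: "'a \<Rightarrow> real" where "Y \<omega> = enn2real (L \<omega>)"

lemma Y_measurable [measurable]: "Y \<in> borel_measurable M"
  unfolding Y_def by measurable

definition finite_loss :: "'a set" where "finite_loss = {\<omega> \<in> space M. L \<omega> < \<infinity>}"

lemma finite_loss_event [measurable]: "finite_loss \<in> events"
  unfolding finite_loss_def by measurable

text \<open>Both measures agree on the half-lines \<open>{..a}\<close>. The restriction to finite
  path loss matters because \<open>Y\<close> is \<open>0\<close> where \<open>L\<close> is infinite;
  without it that mass would become an atom at \<open>0\<close>.\<close>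

lemma law_L: "distr (density M (\<lambda>\<omega>. ennreal (indicator finite_loss \<omega>))) borel Y = density lborel (\<lambda>y. ennreal (dens y))"
proof (rule measure_eqI_generator_eq[where \<Omega> = UNIV and E = "range atMost" and A = "\<lambda>n. {..real n}"])
  show "Int_stable (range (atMost :: real \<Rightarrow> real set))"
  proof (rule Int_stableI)
    fix a b :: "real set" assume "a \<in> range atMost" "b \<in> range atMost"
    then obtain x y where "a = {..x}" "b = {..y}" by auto
    then have "a \<inter> b = {..min x y}" by auto
    then show "a \<inter> b \<in> range atMost" by simp
  qed
  show "sets (distr (density M (\<lambda>\<omega>. ennreal (indicator finite_loss \<omega>))) borel Y) = sigma_sets UNIV (range atMost)"
    "sets (density lborel (\<lambda>y. ennreal (dens y))) = sigma_sets UNIV (range atMost)"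
    by (simp_all add: borel_eq_atMost sets_measure_of_conv)
  show "(\<Union>n. {..real n}) = UNIV" using real_arch_simple by auto
  have em: "emeasure (distr (density M (\<lambda>\<omega>. ennreal (indicator finite_loss \<omega>))) borel Y) {..a} = emeasure M {\<omega> \<in> space M. L \<omega> < \<infinity> \<and> Y \<omega> \<le> a}" for a
  proof -
    have "emeasure (distr (density M (\<lambda>\<omega>. ennreal (indicator finite_loss \<omega>))) borel Y) {..a}
        = emeasure (density M (\<lambda>\<omega>. ennreal (indicator finite_loss \<omega>))) (Y -` {..a} \<inter> space M)"
      by (subst emeasure_distr) auto
    also have "\<dots> = (\<integral>\<^sup>+\<omega>. ennreal (indicator finite_loss \<omega>) * indicator (Y -` {..a} \<inter> space M) \<omega> \<partial>M)"
      by (subst emeasure_density) auto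
    also have "\<dots> = (\<integral>\<^sup>+\<omega>. indicator {\<omega> \<in> space M. L \<omega> < \<infinity> \<and> Y \<omega> \<le> a} \<omega> \<partial>M)"
      by (intro nn_integral_cong) (auto simp: indicator_def finite_loss_def)
    also have "\<dots> = emeasure M {\<omega> \<in> space M. L \<omega> < \<infinity> \<and> Y \<omega> \<le> a}"
      by (rule nn_integral_indicator) measurable
    finally show ?thesis .
  qed
  show "emeasure (distr (density M (\<lambda>\<omega>. ennreal (indicator finite_loss \<omega>))) borel Y) {..real n} \<noteq> \<infinity>" for n
    unfolding em by (simp add: emeasure_eq_measure)
  fix A :: "real set" assume "A \<in> range atMost"
  then obtain a where A: "A = {..a}" by auto
  have "emeasure (density lborel (\<lambda>y. ennreal (dens y))) {..a} = (\<integral>\<^sup>+y. ennreal (dens y) * indicator {..a} y \<partial>lborel)"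
    by (subst emeasure_density) auto
  also have "\<dots> = emeasure M {\<omega> \<in> space M. L \<omega> < \<infinity> \<and> Y \<omega> \<le> a}"
  proof (cases "0 \<le> a")
    case True
    have "{\<omega> \<in> space M. L \<omega> < \<infinity> \<and> Y \<omega> \<le> a} = {\<omega> \<in> space M. L \<omega> \<le> ennreal a}"
    proof (intro Collect_cong conj_cong refl)
      fix \<omega>
      show "(L \<omega> < \<infinity> \<and> Y \<omega> \<le> a) = (L \<omega> \<le> ennreal a)"
        unfolding Y_def using True by (cases "L \<omega>") (auto simp: top_unique)
    qed
    then show ?thesis using prob_L_le[OF True] nn_integral_dens[OF True] by (simp add: emeasure_eq_measure)
  next
    case False
    then have "\<And>y. ennreal (dens y) * indicator {..a} y = 0" by (auto simp: dens_def indicator_def)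
    moreover have "{\<omega> \<in> space M. L \<omega> < \<infinity> \<and> Y \<omega> \<le> a} = {}"
      using False enn2real_nonneg order_trans unfolding Y_def by blast
    ultimately show ?thesis by (simp only: nn_integral_const emeasure_empty mult_zero_left)
  qed
  finally show "emeasure (distr (density M (\<lambda>\<omega>. ennreal (indicator finite_loss \<omega>))) borel Y) A = emeasure (density lborel (\<lambda>y. ennreal (dens y))) A"
    unfolding A em by simp
qed auto

lemma expectation_path_loss:
  fixes f :: "real \<Rightarrow> real"
  assumes [measurable]: "f \<in> borel_measurable borel"
  shows "(\<integral>\<omega>. indicator finite_loss \<omega> * f (Y \<omega>) \<partial>M) = (\<integral>y. dens y * f y \<partial>lborel)"
proof -
  have "(\<integral>\<omega>. indicator finite_loss \<omega> * f (Y \<omega>) \<partial>M) = (\<integral>\<omega>. f (Y \<omega>) \<partial>(density M (\<lambda>\<omega>. ennreal (indicator finite_loss \<omega>))))"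
    by (subst integral_density) auto
  also have "\<dots> = (\<integral>y. f y \<partial>(distr (density M (\<lambda>\<omega>. ennreal (indicator finite_loss \<omega>))) borel Y))"
    by (subst integral_distr) auto
  also have "\<dots> = (\<integral>y. dens y * f y \<partial>lborel)"
    unfolding law_L by (subst integral_density) auto
  finally show ?thesis .
qed

text \<open>Transfers null sets between the probability space, where the conditional law of the
  interference is given, and the half-line of path losses, where the outer integrals live.\<close>

lemma AE_path_loss_iff:
  assumes [measurable]: "Measurable.pred borel Q"
  shows "(AE \<omega> in M. L \<omega> < \<infinity> \<longrightarrow> Q (Y \<omega>)) \<longleftrightarrow> (AE y in lborel. 0 < dens y \<longrightarrow> Q y)"
proof -
  have "(AE y in lborel. 0 < dens y \<longrightarrow> Q y) \<longleftrightarrow> (AE y in density lborel (\<lambda>y. ennreal (dens y)). Q y)"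
    by (subst AE_density) auto
  also have "\<dots> \<longleftrightarrow> (AE \<omega> in density M (\<lambda>\<omega>. ennreal (indicator finite_loss \<omega>)). Q (Y \<omega>))"
    unfolding law_L[symmetric] by (subst AE_distr_iff) auto
  also have "\<dots> \<longleftrightarrow> (AE \<omega> in M. 0 < ennreal (indicator finite_loss \<omega>) \<longrightarrow> Q (Y \<omega>))"
    by (subst AE_density) auto
  also have "\<dots> \<longleftrightarrow> (AE \<omega> in M. L \<omega> < \<infinity> \<longrightarrow> Q (Y \<omega>))"
    by (intro AE_cong) (auto simp: indicator_def finite_loss_def)
  finally show ?thesis by simp
qed

lemma integrable_dens: "integrable lborel dens"
proof (rule integrableI_bounded)
  have "(\<integral>\<^sup>+y. ennreal (norm (dens y)) \<partial>lborel) = emeasure (density lborel (\<lambda>y. ennreal (dens y))) UNIV"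
    by (subst emeasure_density) auto
  also have "\<dots> = emeasure (density M (\<lambda>\<omega>. ennreal (indicator finite_loss \<omega>))) (space M)"
    unfolding law_L[symmetric] by (subst emeasure_distr) auto
  also have "\<dots> = (\<integral>\<^sup>+\<omega>. ennreal (indicator finite_loss \<omega>) * indicator (space M) \<omega> \<partial>M)"
    by (subst emeasure_density) auto
  also have "\<dots> \<le> (\<integral>\<^sup>+\<omega>. 1 \<partial>M)" by (intro nn_integral_mono) (auto simp: indicator_def)
  also have "\<dots> < \<infinity>" by (simp add: emeasure_eq_measure)
  finally show "(\<integral>\<^sup>+y. ennreal (norm (dens y)) \<partial>lborel) < \<infinity>" .
qed simp

end

subsection \<open>Random thresholds for the interference\<close>

text \<open>The multiple of \<open>1 / n\<close> next above \<open>x\<close>. Approaching a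
  threshold from above suits the event \<open>I \<le> z\<close>, whose indicator is right-continuous
  in \<open>z\<close>.\<close>

lemma floor_grid_bounds:
  assumes "0 < n"
  shows "x < (real_of_int \<lfloor>real n * x\<rfloor> + 1) / real n" "(real_of_int \<lfloor>real n * x\<rfloor> + 1) / real n \<le> x + 1 / real n"
proof -
  have "real n * x < real_of_int \<lfloor>real n * x\<rfloor> + 1" "real_of_int \<lfloor>real n * x\<rfloor> \<le> real n * x" by linarith+
  then show "x < (real_of_int \<lfloor>real n * x\<rfloor> + 1) / real n" "(real_of_int \<lfloor>real n * x\<rfloor> + 1) / real n \<le> x + 1 / real n"
    using assms by (simp_all add: field_simps)
qed

lemma floor_grid_tendsto: "(\<lambda>n. (real_of_int \<lfloor>real (Suc n) * x\<rfloor> + 1) / real (Suc n)) \<longlonglongrightarrow> x"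
proof (rule tendsto_sandwich)
  show "\<forall>\<^sub>F n in sequentially. x \<le> (real_of_int \<lfloor>real (Suc n) * x\<rfloor> + 1) / real (Suc n)"
    by (intro always_eventually allI less_imp_le floor_grid_bounds) simp
  show "\<forall>\<^sub>F n in sequentially. (real_of_int \<lfloor>real (Suc n) * x\<rfloor> + 1) / real (Suc n) \<le> x + 1 / real (Suc n)"
    by (intro always_eventually allI floor_grid_bounds) simp
  have "(\<lambda>n. x + 1 / real (Suc n)) \<longlonglongrightarrow> x + 0"
    by (intro tendsto_add tendsto_const LIMSEQ_Suc[OF lim_1_over_n])
  then show "(\<lambda>n. x + 1 / real (Suc n)) \<longlonglongrightarrow> x" by simp
qed simp

locale network_interference = network_path_loss +
  assumes cdf_I_MU: "\<And>z. z \<noteq> 0 \<Longrightarrow> AE \<omega> in M. L0 S C X \<omega> < \<infinity> \<longrightarrow>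
      ((\<lambda>w. 1 / (pi * w) *
            Im (exp (- \<i> * of_real (w * z)) * Phi S w (enn2real (L0 S C X \<omega>))))
        has_integral
          (1/2 - real_cond_exp M (vimage_algebra (space M) (L0 S C X) borel)
                   (indicator {\<omega> \<in> space M. I_MU S C X h \<omega> \<le> z}) \<omega>)) {0<..}"
begin

text \<open>Cut off outside the open quadrant so as to be measurable on the whole plane; the
  integrals only see values inside.\<close>

definition phi :: "real \<Rightarrow> real \<Rightarrow> complex" where
  "phi y w = (if 0 < w \<and> 0 < y then Phi S w y else 0)"

lemma phi_measurable2: "(\<lambda>p. phi (fst p) (snd p)) \<in> borel_measurable (borel \<Otimes>\<^sub>M borel)"
proof -
  have "(\<lambda>p. (snd p, fst p)) \<in> measurable (borel \<Otimes>\<^sub>M borel) (borel \<Otimes>\<^sub>M (borel :: real measure))"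
    by measurable
  from measurable_compose[OF this Phi_measurable] show ?thesis
    unfolding phi_def by (simp only: fst_conv snd_conv)
qed

lemma phi_measurable [measurable (raw)]:
  "f \<in> borel_measurable N \<Longrightarrow> k \<in> borel_measurable N \<Longrightarrow> (\<lambda>x. phi (f x) (k x)) \<in> borel_measurable N"
  using measurable_compose[OF measurable_Pair phi_measurable2, of f N k] by simp

lemma gil_pelaez_phi:
  assumes y: "0 < y"
  obtains B p where "gil_pelaez (phi y) B p"
proof -
  obtain B p where "0 < B" "\<And>w. 0 < w \<Longrightarrow> norm (Phi S w y) \<le> B"
    "\<And>w. 0 < w \<Longrightarrow> norm (Phi S w y - 1) \<le> B * w"
    "\<And>w. 1 \<le> w \<Longrightarrow> norm (Phi S w y - of_real p) \<le> B / w"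
    using Phi_bounds[OF y] by metis
  then have "gil_pelaez (phi y) B p"
    using y by unfold_locales (auto simp: phi_def intro: phi_measurable)
  then show ?thesis by (rule that)
qed

text \<open>\<open>1/2\<close> minus the distribution function at \<open>z\<close> of the interference given path loss
  \<open>y\<close>, as a function jointly measurable in both arguments.\<close>

definition icdf :: "real \<Rightarrow> real \<Rightarrow> real" where "icdf y z = gp_limit (phi y) z"

lemma icdf_measurable [measurable (raw)]:
  assumes [measurable]: "f \<in> borel_measurable N" "k \<in> borel_measurable N"
  shows "(\<lambda>x. icdf (f x) (k x)) \<in> borel_measurable N"
  unfolding icdf_def gp_limit_def gp_partial_def set_lebesgue_integral_def gp_kernel_def by measurable

text \<open>Clipping makes the bound \<open>1/2\<close> hold everywhere; \<open>icdf\<close> satisfies it only for almost every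
  value of the path loss.\<close>

definition icdfc :: "real \<Rightarrow> real \<Rightarrow> real" where "icdfc y z = max (- (1/2)) (min (1/2) (icdf y z))"

lemma icdfc_measurable [measurable (raw)]:
  "f \<in> borel_measurable N \<Longrightarrow> k \<in> borel_measurable N \<Longrightarrow> (\<lambda>x. icdfc (f x) (k x)) \<in> borel_measurable N"
  unfolding icdfc_def by (intro borel_measurable_max borel_measurable_min borel_measurable_const icdf_measurable)

lemma abs_icdfc_le: "\<bar>icdfc y z\<bar> \<le> 1/2"
  by (auto simp: icdfc_def)

abbreviation "loss_algebra \<equiv> vimage_algebra (space M) L (borel :: ennreal measure)"
abbreviation "interference_le z \<equiv> {\<omega> \<in> space M. I \<omega> \<le> z}"
abbreviation "cond_cdf z \<equiv> real_cond_exp M loss_algebra (indicator (interference_le z))"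

lemma subalgebra_loss: "subalgebra M loss_algebra"
  unfolding subalgebra_def using L_measurable by (auto simp: sets_vimage_algebra2 intro: measurable_sets)

sublocale loss: finite_measure_subalgebra M loss_algebra
  by unfold_locales (rule subalgebra_loss)

lemma AE_Y_pos: "AE \<omega> in M. L \<omega> < \<infinity> \<longrightarrow> 0 < Y \<omega>"
  using AE_L_pos by eventually_elim (auto simp: Y_def enn2real_positive_iff)

text \<open>The gauge integral in the hypothesis is identified with the sequential limit of partial
  integrals, for the path loss realised at each sample point.\<close>

lemma AE_icdf_eq:
  assumes z: "z \<noteq> 0"
  shows "AE \<omega> in M. L \<omega> < \<infinity> \<longrightarrow> icdf (Y \<omega>) z = 1/2 - cond_cdf z \<omega>"
  using cdf_I_MU[OF z] AE_Y_pos
proof eventually_elim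
  case (elim \<omega>)
  show ?case
  proof
    assume fin: "L \<omega> < \<infinity>"
    then have y: "0 < Y \<omega>" using elim by blast
    obtain B p where "gil_pelaez (phi (Y \<omega>)) B p" by (rule gil_pelaez_phi[OF y])
    then interpret gil_pelaez "phi (Y \<omega>)" B p .
    have "((\<lambda>w. 1 / (pi * w) * Im (exp (- \<i> * of_real (w * z)) * Phi S w (Y \<omega>))) has_integral (1/2 - cond_cdf z \<omega>)) {0<..}"
      using elim fin unfolding Y_def by blast
    then have "(gp_kernel (phi (Y \<omega>)) z has_integral (1/2 - cond_cdf z \<omega>)) {0<..}"
      by (rule has_integral_eq[rotated]) (use y in \<open>simp add: gp_kernel_def phi_def\<close>)
    then show "icdf (Y \<omega>) z = 1/2 - cond_cdf z \<omega>"
      unfolding icdf_def by (rule has_integral_kernel_imp_gp_limit[OF _ z])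
  qed
qed

lemma AE_cond_cdf_bounds: "AE \<omega> in M. 0 \<le> cond_cdf z \<omega> \<and> cond_cdf z \<omega> \<le> 1"
proof -
  have i: "integrable M (indicator (interference_le z) :: 'a \<Rightarrow> real)"
    by (intro integrable_real_indicator) (auto simp: emeasure_eq_measure)
  have "AE \<omega> in M. cond_cdf z \<omega> \<ge> 0" by (rule loss.real_cond_exp_ge_c[OF i]) auto
  moreover have "AE \<omega> in M. cond_cdf z \<omega> \<le> 1" by (rule loss.real_cond_exp_le_c[OF i]) (auto simp: indicator_def)
  ultimately show ?thesis by eventually_elim simp
qed

lemma icdf_tendsto:
  assumes "0 < y" "x \<longlonglongrightarrow> z" "z \<noteq> 0"
  shows "(\<lambda>n. icdf y (x n)) \<longlonglongrightarrow> icdf y z"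
proof -
  obtain B p where "gil_pelaez (phi y) B p" by (rule gil_pelaez_phi[OF assms(1)])
  then interpret gil_pelaez "phi y" B p .
  show ?thesis unfolding icdf_def by (rule gp_limit_tendsto) fact+
qed

text \<open>For each fixed \<open>z\<close> the bound holds outside a null set that may depend on
  \<open>z\<close>. The null sets of the rational \<open>z\<close> are collected, and continuity of
  \<open>icdf y\<close> away from \<open>0\<close> gives the remaining \<open>z\<close>.\<close>

lemma AE_icdf_bounded: "AE y in lborel. 0 < dens y \<longrightarrow> (\<forall>z. z \<noteq> 0 \<longrightarrow> \<bar>icdf y z\<bar> \<le> 1/2)"
proof -
  have "AE y in lborel. \<forall>r\<in>\<rat> - {0}. 0 < dens y \<longrightarrow> \<bar>icdf y r\<bar> \<le> 1/2"
  proof (subst AE_ball_countable)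
    show "countable (\<rat> - {0} :: real set)" by (intro countable_Diff countable_rat)
    show "\<forall>r\<in>\<rat> - {0}. AE y in lborel. 0 < dens y \<longrightarrow> \<bar>icdf y r\<bar> \<le> 1/2"
    proof
      fix r :: real assume "r \<in> \<rat> - {0}"
      then have "r \<noteq> 0" by auto
      have "AE \<omega> in M. L \<omega> < \<infinity> \<longrightarrow> \<bar>icdf (Y \<omega>) r\<bar> \<le> 1/2"
        using AE_icdf_eq[OF \<open>r \<noteq> 0\<close>] AE_cond_cdf_bounds[of r] by eventually_elim (auto simp: abs_if)
      then show "AE y in lborel. 0 < dens y \<longrightarrow> \<bar>icdf y r\<bar> \<le> 1/2"
        by (subst (asm) AE_path_loss_iff) auto
    qed
  qed
  then show ?thesis
  proof eventually_elim
    case (elim y)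
    show ?case
    proof (intro impI allI)
      fix z :: real assume d: "0 < dens y" and z: "z \<noteq> 0"
      have y: "0 < y" using d by (auto simp: dens_def split: if_splits)
      define x where "x n = (real_of_int \<lfloor>real (Suc n) * z\<rfloor> + 1) / real (Suc n)" for n
      have x: "\<And>n. x n \<in> \<rat>" "x \<longlonglongrightarrow> z"
        unfolding x_def using floor_grid_tendsto[of z] by (auto simp del: of_nat_Suc)
      have "\<forall>\<^sub>F n in sequentially. \<bar>icdf y (x n)\<bar> \<le> 1/2"
        using tendsto_imp_eventually_ne[OF x(2) z] by eventually_elim (use elim d x in auto)
      then show "\<bar>icdf y z\<bar> \<le> 1/2"
        by (rule tendsto_upperbound[OF tendsto_rabs[OF icdf_tendsto[OF y x(2) z]]]) simp
    qed
  qed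
qed

lemma AE_icdfc_eq: "AE y in lborel. 0 < dens y \<longrightarrow> (\<forall>z. z \<noteq> 0 \<longrightarrow> icdfc y z = icdf y z)"
  using AE_icdf_bounded
proof eventually_elim
  case (elim y)
  show ?case
  proof (intro impI allI)
    fix z :: real assume "0 < dens y" "z \<noteq> 0"
    then have "\<bar>icdf y z\<bar> \<le> 1/2" using elim by blast
    then show "icdfc y z = icdf y z" by (auto simp: icdfc_def)
  qed
qed

lemma integrable_bounded_M:
  fixes f :: "'a \<Rightarrow> real"
  assumes [measurable]: "f \<in> borel_measurable M" and "\<And>\<omega>. \<bar>f \<omega>\<bar> \<le> K"
  shows "integrable M f"
  by (rule integrable_const_bound[where B = K]) (use assms in auto)

text \<open>The defining property of conditional expectation: the weight
  \<open>indicator finite_loss \<omega> * f (Y \<omega>)\<close> depends on the path loss only, so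
  the indicator of the event may be replaced by its conditional expectation.\<close>

lemma expectation_const_threshold:
  fixes f :: "real \<Rightarrow> real"
  assumes [measurable]: "f \<in> borel_measurable borel" and b: "\<And>y. \<bar>f y\<bar> \<le> K" and z: "z \<noteq> 0"
  shows "(\<integral>\<omega>. indicator finite_loss \<omega> * f (Y \<omega>) * indicator (interference_le z) \<omega> \<partial>M)
      = (\<integral>\<omega>. indicator finite_loss \<omega> * f (Y \<omega>) * (1/2 - icdfc (Y \<omega>) z) \<partial>M)"
proof -
  have K: "0 \<le> K" using b[of 0] by linarith
  let ?f = "\<lambda>\<omega>. indicator finite_loss \<omega> * f (Y \<omega>)"
  have "L \<in> measurable loss_algebra borel" by (rule measurable_vimage_algebra1) simp
  then have "(\<lambda>\<omega>. indicator {..<\<infinity>} (L \<omega>) * f (enn2real (L \<omega>))) \<in> borel_measurable loss_algebra"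
    by (rule measurable_compose) measurable
  then have fm: "?f \<in> borel_measurable loss_algebra"
    by (rule measurable_cong[THEN iffD1, rotated]) (auto simp: finite_loss_def Y_def indicator_def)
  have "(\<integral>\<omega>. ?f \<omega> * indicator (interference_le z) \<omega> \<partial>M) = (\<integral>\<omega>. ?f \<omega> * cond_cdf z \<omega> \<partial>M)"
  proof (rule loss.real_cond_exp_intg(2)[symmetric, OF _ fm])
    show "integrable M (\<lambda>\<omega>. ?f \<omega> * indicator (interference_le z) \<omega>)"
      by (rule integrable_bounded_M[where K = K]) (use b K in \<open>auto simp: indicator_def\<close>)
  qed measurable
  also have "\<dots> = (\<integral>\<omega>. ?f \<omega> * (1/2 - icdfc (Y \<omega>) z) \<partial>M)"
  proof (rule integral_cong_AE)
    show "(\<lambda>\<omega>. ?f \<omega> * cond_cdf z \<omega>) \<in> borel_measurable M"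
      by (intro borel_measurable_times) (auto intro: borel_measurable_cond_exp2)
    show "AE \<omega> in M. ?f \<omega> * cond_cdf z \<omega> = ?f \<omega> * (1/2 - icdfc (Y \<omega>) z)"
      using AE_icdf_eq[OF z] AE_cond_cdf_bounds[of z]
    proof eventually_elim
      case (elim \<omega>)
      show ?case
      proof (cases "\<omega> \<in> finite_loss")
        case True
        then have "icdf (Y \<omega>) z = 1/2 - cond_cdf z \<omega>" using elim by (auto simp: finite_loss_def)
        then have "icdfc (Y \<omega>) z = 1/2 - cond_cdf z \<omega>" using elim by (auto simp: icdfc_def)
        then show ?thesis by simp
      qed simp
    qed
  qed measurable
  finally show ?thesis .
qed

text \<open>On the support of \<open>f\<close> the threshold takes finitely many values, none of
  them \<open>0\<close>; constant thresholds are summed over these values.\<close>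

lemma expectation_simple_threshold:
  fixes f zf :: "real \<Rightarrow> real"
  assumes f [measurable]: "f \<in> borel_measurable borel" and b: "\<And>y. \<bar>f y\<bar> \<le> K"
    and zf [measurable]: "zf \<in> borel_measurable borel"
    and D: "finite D" "0 \<notin> D" "\<And>y. f y \<noteq> 0 \<Longrightarrow> zf y \<in> D"
  shows "(\<integral>\<omega>. indicator finite_loss \<omega> * f (Y \<omega>) * (if I \<omega> \<le> zf (Y \<omega>) then 1 else 0) \<partial>M)
      = (\<integral>\<omega>. indicator finite_loss \<omega> * f (Y \<omega>) * (1/2 - icdfc (Y \<omega>) (zf (Y \<omega>))) \<partial>M)"
proof -
  have K: "0 \<le> K" using b[of 0] by linarith
  define fd where "fd d y = f y * (if zf y = d then 1 else 0)" for d y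
  have [measurable]: "fd d \<in> borel_measurable borel" for d unfolding fd_def by measurable
  have fdb: "\<bar>fd d y\<bar> \<le> K" for d y using b[of y] K by (auto simp: fd_def)
  have split: "f y * k (zf y) = (\<Sum>d\<in>D. fd d y * k d)" for y and k :: "real \<Rightarrow> real"
  proof (cases "f y = 0")
    case False
    then have "zf y \<in> D" using D by blast
    have "(\<Sum>d\<in>D. fd d y * k d) = (\<Sum>d\<in>D. if d = zf y then f y * k d else 0)"
      by (intro sum.cong) (auto simp: fd_def)
    then show ?thesis using \<open>zf y \<in> D\<close> D by (simp add: sum.delta)
  qed (simp add: fd_def)
  have i1: "integrable M (\<lambda>\<omega>. indicator finite_loss \<omega> * fd d (Y \<omega>) * indicator (interference_le d) \<omega>)" for d
    by (rule integrable_bounded_M[where K = K]) (use fdb K in \<open>auto simp: indicator_def\<close>)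
  have i2: "integrable M (\<lambda>\<omega>. indicator finite_loss \<omega> * fd d (Y \<omega>) * (1/2 - icdfc (Y \<omega>) d))" for d
  proof (rule integrable_bounded_M[where K = K])
    fix \<omega>
    have "\<bar>1/2 - icdfc (Y \<omega>) d\<bar> \<le> 1" using abs_icdfc_le[of "Y \<omega>" d] by linarith
    then have "\<bar>fd d (Y \<omega>)\<bar> * \<bar>1/2 - icdfc (Y \<omega>) d\<bar> \<le> K * 1"
      using fdb K by (intro mult_mono) auto
    then show "\<bar>indicator finite_loss \<omega> * fd d (Y \<omega>) * (1/2 - icdfc (Y \<omega>) d)\<bar> \<le> K"
      using K by (cases "\<omega> \<in> finite_loss") (auto simp: abs_mult)
  qed measurable
  have "(\<integral>\<omega>. indicator finite_loss \<omega> * f (Y \<omega>) * (if I \<omega> \<le> zf (Y \<omega>) then 1 else 0) \<partial>M)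
     = (\<integral>\<omega>. (\<Sum>d\<in>D. indicator finite_loss \<omega> * fd d (Y \<omega>) * indicator (interference_le d) \<omega>) \<partial>M)"
  proof (rule Bochner_Integration.integral_cong[OF refl])
    fix \<omega> assume "\<omega> \<in> space M"
    then have "(\<Sum>d\<in>D. fd d (Y \<omega>) * indicator (interference_le d) \<omega>) = (\<Sum>d\<in>D. fd d (Y \<omega>) * (if I \<omega> \<le> d then 1 else 0))"
      by (intro sum.cong) (auto simp: indicator_def)
    also have "\<dots> = f (Y \<omega>) * (if I \<omega> \<le> zf (Y \<omega>) then 1 else 0)"
      by (rule split[symmetric])
    finally show "indicator finite_loss \<omega> * f (Y \<omega>) * (if I \<omega> \<le> zf (Y \<omega>) then 1 else 0)
       = (\<Sum>d\<in>D. indicator finite_loss \<omega> * fd d (Y \<omega>) * indicator (interference_le d) \<omega>)"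
      by (simp only: mult.assoc sum_distrib_left[symmetric])
  qed
  also have "\<dots> = (\<Sum>d\<in>D. \<integral>\<omega>. indicator finite_loss \<omega> * fd d (Y \<omega>) * indicator (interference_le d) \<omega> \<partial>M)"
    by (rule Bochner_Integration.integral_sum) (rule i1)
  also have "\<dots> = (\<Sum>d\<in>D. \<integral>\<omega>. indicator finite_loss \<omega> * fd d (Y \<omega>) * (1/2 - icdfc (Y \<omega>) d) \<partial>M)"
  proof (rule sum.cong[OF refl])
    fix d assume "d \<in> D"
    then have "d \<noteq> 0" using D by auto
    then show "(\<integral>\<omega>. indicator finite_loss \<omega> * fd d (Y \<omega>) * indicator (interference_le d) \<omega> \<partial>M)
      = (\<integral>\<omega>. indicator finite_loss \<omega> * fd d (Y \<omega>) * (1/2 - icdfc (Y \<omega>) d) \<partial>M)"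
      by (intro expectation_const_threshold[where K = K] fdb) measurable
  qed
  also have "\<dots> = (\<integral>\<omega>. (\<Sum>d\<in>D. indicator finite_loss \<omega> * fd d (Y \<omega>) * (1/2 - icdfc (Y \<omega>) d)) \<partial>M)"
    by (rule Bochner_Integration.integral_sum[symmetric]) (rule i2)
  also have "\<dots> = (\<integral>\<omega>. indicator finite_loss \<omega> * f (Y \<omega>) * (1/2 - icdfc (Y \<omega>) (zf (Y \<omega>))) \<partial>M)"
  proof (rule Bochner_Integration.integral_cong[OF refl])
    fix \<omega>
    have "(\<Sum>d\<in>D. fd d (Y \<omega>) * (1/2 - icdfc (Y \<omega>) d)) = f (Y \<omega>) * (1/2 - icdfc (Y \<omega>) (zf (Y \<omega>)))"
      by (rule split[of "Y \<omega>" "\<lambda>d. 1/2 - icdfc (Y \<omega>) d", symmetric])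
    then show "(\<Sum>d\<in>D. indicator finite_loss \<omega> * fd d (Y \<omega>) * (1/2 - icdfc (Y \<omega>) d))
        = indicator finite_loss \<omega> * f (Y \<omega>) * (1/2 - icdfc (Y \<omega>) (zf (Y \<omega>)))"
      by (simp only: mult.assoc sum_distrib_left[symmetric])
  qed
  finally show ?thesis .
qed

text \<open>The hypothesis speaks about one constant threshold at a time, outside a null set that depends
  on it. A threshold depending on the path loss is approximated from above by finitely valued ones;
  this uses that \<open>icdf\<close> is continuous away from the atom at \<open>0\<close>.\<close>

lemma expectation_threshold:
  fixes f zf :: "real \<Rightarrow> real"
  assumes f [measurable]: "f \<in> borel_measurable borel" and b: "\<And>y. \<bar>f y\<bar> \<le> K"
    and zf [measurable]: "zf \<in> borel_measurable borel"
    and nz: "AE y in lborel. zf y \<noteq> 0"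
  shows "(\<integral>\<omega>. indicator finite_loss \<omega> * f (Y \<omega>) * (if I \<omega> \<le> zf (Y \<omega>) then 1 else 0) \<partial>M)
      = (\<integral>\<omega>. indicator finite_loss \<omega> * f (Y \<omega>) * (1/2 - icdfc (Y \<omega>) (zf (Y \<omega>))) \<partial>M)"
proof -
  have K: "0 \<le> K" using b[of 0] by linarith
  define zn where "zn n y = (real_of_int \<lfloor>real (Suc n) * zf y\<rfloor> + 1) / real (Suc n)" for n y
  \<comment> \<open>Truncation leaves only finitely many grid points as thresholds, and removes the
    grid point \<open>0\<close>, to which the law of the interference does not apply.\<close>
  define fn where "fn n y = f y * (if \<bar>zf y\<bar> \<le> real (Suc n) \<and> zn n y \<noteq> 0 then 1 else 0)" for n y
  have zm [measurable]: "zn n \<in> borel_measurable borel" for n unfolding zn_def by measurable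
  have fm [measurable]: "fn n \<in> borel_measurable borel" for n unfolding fn_def by measurable
  have fb: "\<bar>fn n y\<bar> \<le> K" for n y using b[of y] K by (auto simp: fn_def)
  let ?A = "\<lambda>n \<omega>. indicator finite_loss \<omega> * fn n (Y \<omega>) * (if I \<omega> \<le> zn n (Y \<omega>) then 1 else 0)"
  let ?B = "\<lambda>n \<omega>. indicator finite_loss \<omega> * fn n (Y \<omega>) * (1/2 - icdfc (Y \<omega>) (zn n (Y \<omega>)))"
  let ?a = "\<lambda>\<omega>. indicator finite_loss \<omega> * f (Y \<omega>) * (if I \<omega> \<le> zf (Y \<omega>) then 1 else 0)"
  let ?b = "\<lambda>\<omega>. indicator finite_loss \<omega> * f (Y \<omega>) * (1/2 - icdfc (Y \<omega>) (zf (Y \<omega>)))"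
  have eq: "(\<integral>\<omega>. ?A n \<omega> \<partial>M) = (\<integral>\<omega>. ?B n \<omega> \<partial>M)" for n
  proof (rule expectation_simple_threshold[OF fm fb zm])
    let ?m = "int (Suc n * Suc n)"
    let ?D = "(\<lambda>j. real_of_int j / real (Suc n)) ` {- ?m..?m + 1} - {0}"
    show "finite ?D" "0 \<notin> ?D" by auto
    fix y assume "fn n y \<noteq> 0"
    then have y: "\<bar>zf y\<bar> \<le> real (Suc n)" "zn n y \<noteq> 0" by (auto simp: fn_def split: if_splits)
    have "\<bar>real (Suc n) * zf y\<bar> \<le> real (Suc n) * real (Suc n)"
      unfolding abs_mult using y by (intro mult_mono) auto
    also have "\<dots> = real_of_int ?m" by (simp only: of_int_of_nat_eq of_nat_mult of_int_mult)
    finally have "- real_of_int ?m \<le> real (Suc n) * zf y" "real (Suc n) * zf y \<le> real_of_int ?m" by linarith+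
    then have "- ?m \<le> \<lfloor>real (Suc n) * zf y\<rfloor>" "\<lfloor>real (Suc n) * zf y\<rfloor> \<le> ?m"
      by (simp_all add: le_floor_iff floor_le_iff del: of_nat_Suc of_nat_mult)
    then have "\<lfloor>real (Suc n) * zf y\<rfloor> + 1 \<in> {- ?m..?m + 1}" by simp
    moreover have "zn n y = real_of_int (\<lfloor>real (Suc n) * zf y\<rfloor> + 1) / real (Suc n)" by (simp add: zn_def)
    ultimately show "zn n y \<in> ?D" using y by blast
  qed
  have lim: "AE \<omega> in M. (\<lambda>n. ?A n \<omega>) \<longlonglongrightarrow> ?a \<omega> \<and> (\<lambda>n. ?B n \<omega>) \<longlonglongrightarrow> ?b \<omega>"
  proof -
    have 1: "AE \<omega> in M. L \<omega> < \<infinity> \<longrightarrow> zf (Y \<omega>) \<noteq> 0"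
      by (subst AE_path_loss_iff) (use nz in auto)
    show ?thesis using 1 AE_Y_pos
    proof eventually_elim
      case (elim \<omega>)
      show ?case
      proof (cases "\<omega> \<in> finite_loss")
        case True
        define y where "y = Y \<omega>"
        have y: "0 < y" "zf y \<noteq> 0" using elim True by (auto simp: y_def finite_loss_def)
        have zt: "(\<lambda>n. zn n y) \<longlonglongrightarrow> zf y" unfolding zn_def by (rule floor_grid_tendsto)
        have ft: "(\<lambda>n. fn n y) \<longlonglongrightarrow> f y"
        proof (rule tendsto_eventually)
          have "\<forall>\<^sub>F n in sequentially. \<bar>zf y\<bar> \<le> real (Suc n)"
            by (rule eventually_sequentiallyI[of "nat \<lceil>\<bar>zf y\<bar>\<rceil>"]) linarith
          then show "\<forall>\<^sub>F n in sequentially. fn n y = f y"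
            using tendsto_imp_eventually_ne[OF zt y(2)] by eventually_elim (simp add: fn_def)
        qed
        \<comment> \<open>Because the grid points lie strictly above the threshold, equality of
          interference and threshold is counted correctly in the limit.\<close>
        have it: "(\<lambda>n. if I \<omega> \<le> zn n y then 1 else 0 :: real) \<longlonglongrightarrow> (if I \<omega> \<le> zf y then 1 else 0)"
        proof (rule tendsto_eventually, cases "I \<omega> \<le> zf y")
          case True
          then have "I \<omega> \<le> zn n y" for n using floor_grid_bounds(1)[of "Suc n" "zf y"] by (simp add: zn_def)
          then show "\<forall>\<^sub>F n in sequentially. (if I \<omega> \<le> zn n y then 1 else 0 :: real) = (if I \<omega> \<le> zf y then 1 else 0)"
            using True by simp
        next
          case False
          then have "\<forall>\<^sub>F n in sequentially. zn n y < I \<omega>" by (intro order_tendstoD(2)[OF zt]) simp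
          then show "\<forall>\<^sub>F n in sequentially. (if I \<omega> \<le> zn n y then 1 else 0 :: real) = (if I \<omega> \<le> zf y then 1 else 0)"
            by eventually_elim (use False in simp)
        qed
        have gt: "(\<lambda>n. icdfc y (zn n y)) \<longlonglongrightarrow> icdfc y (zf y)"
          unfolding icdfc_def by (intro tendsto_max tendsto_min tendsto_const icdf_tendsto[OF y(1) zt y(2)])
        show ?thesis unfolding y_def[symmetric]
          by (intro conjI tendsto_mult tendsto_diff tendsto_const ft it gt)
      qed simp
    qed
  qed
  have domA: "\<bar>?A n \<omega>\<bar> \<le> K" for n \<omega> using fb[of n "Y \<omega>"] K by (auto simp: indicator_def)
  have domB: "\<bar>?B n \<omega>\<bar> \<le> K" for n \<omega>
  proof -
    have "\<bar>1/2 - icdfc (Y \<omega>) (zn n (Y \<omega>))\<bar> \<le> 1" using abs_icdfc_le[of "Y \<omega>" "zn n (Y \<omega>)"] by linarith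
    then have "\<bar>fn n (Y \<omega>)\<bar> * \<bar>1/2 - icdfc (Y \<omega>) (zn n (Y \<omega>))\<bar> \<le> K * 1" using fb K by (intro mult_mono) auto
    then show ?thesis using K by (cases "\<omega> \<in> finite_loss") (auto simp: abs_mult)
  qed
  have "(\<lambda>n. \<integral>\<omega>. ?A n \<omega> \<partial>M) \<longlonglongrightarrow> (\<integral>\<omega>. ?a \<omega> \<partial>M)"
    by (rule integral_dominated_convergence[where w = "\<lambda>_. K"]) (use lim domA in auto)
  moreover have "(\<lambda>n. \<integral>\<omega>. ?B n \<omega> \<partial>M) \<longlonglongrightarrow> (\<integral>\<omega>. ?b \<omega> \<partial>M)"
    by (rule integral_dominated_convergence[where w = "\<lambda>_. K"]) (use lim domB in auto)
  ultimately show ?thesis unfolding eq by (rule LIMSEQ_unique)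
qed

end

subsection \<open>The joint distribution function\<close>

definition gain_monomial :: "nat \<Rightarrow> nat \<Rightarrow> real \<Rightarrow> real" where
  "gain_monomial s t x = indicator {0..} x * (x ^ t * exp (- (real s * x)))"

lemma gain_monomial_measurable [measurable]: "gain_monomial s t \<in> borel_measurable borel"
  unfolding gain_monomial_def by measurable

lemma gain_monomial_nonneg: "0 \<le> gain_monomial s t x"
  by (auto simp: gain_monomial_def indicator_def)

lemma integrable_gain_monomial:
  assumes "1 \<le> s"
  shows "integrable lborel (gain_monomial s t)"
  using set_integrable_power_exp_scale[of "real s" 0 t] assms
  by (simp add: set_integrable_def gain_monomial_def[abs_def])

context network_interference
begin

text \<open>One definition covers both bounds on the interference: \<open>\<alpha> = q / P\<close>,
  \<open>b = -1\<close> for the lower and \<open>\<alpha> = - v / P\<close>,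
  \<open>b = \<gamma>\<close> for the upper one. The condition \<open>\<tau> * y \<le> x\<close>
  selects the gains for which lower does not exceed upper.\<close>

definition threshold_mean :: "real \<Rightarrow> real \<Rightarrow> real \<Rightarrow> nat \<Rightarrow> nat \<Rightarrow> real \<Rightarrow> real" where
  "threshold_mean \<tau> \<alpha> b s t y =
     (LINT x|lborel. gain_monomial s t x * (if \<tau> * y \<le> x then icdfc y (\<alpha> + b * x / y) else 0))"

lemma threshold_mean_measurable [measurable]: "threshold_mean \<tau> \<alpha> b s t \<in> borel_measurable borel"
  unfolding threshold_mean_def by measurable

lemma integrable_threshold_integrand:
  assumes "1 \<le> s"
  shows "integrable lborel (\<lambda>x. gain_monomial s t x * (if \<tau> * y \<le> x then icdfc y (\<alpha> + b * x / y) else 0))"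
proof (rule Bochner_Integration.integrable_bound[OF integrable_gain_monomial[OF assms, of t]])
  show "AE x in lborel. norm (gain_monomial s t x * (if \<tau> * y \<le> x then icdfc y (\<alpha> + b * x / y) else 0)) \<le> norm (gain_monomial s t x)"
  proof (rule AE_I2)
    fix x
    have "\<bar>if \<tau> * y \<le> x then icdfc y (\<alpha> + b * x / y) else 0\<bar> \<le> 1"
      using abs_icdfc_le[of y "\<alpha> + b * x / y"] by auto
    then have "\<bar>gain_monomial s t x\<bar> * \<bar>if \<tau> * y \<le> x then icdfc y (\<alpha> + b * x / y) else 0\<bar> \<le> \<bar>gain_monomial s t x\<bar> * 1"
      by (intro mult_left_mono) auto
    then show "norm (gain_monomial s t x * (if \<tau> * y \<le> x then icdfc y (\<alpha> + b * x / y) else 0)) \<le> norm (gain_monomial s t x)"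
      by (simp only: real_norm_def abs_mult mult_1_right)
  qed
qed measurable

lemma abs_threshold_mean_le:
  assumes "1 \<le> s"
  shows "\<bar>threshold_mean \<tau> \<alpha> b s t y\<bar> \<le> (LINT x|lborel. gain_monomial s t x)"
  unfolding threshold_mean_def real_norm_def[symmetric]
proof (rule Bochner_Integration.integral_norm_bound_integral[OF integrable_threshold_integrand[OF assms] integrable_gain_monomial[OF assms]])
  fix x
  have "\<bar>if \<tau> * y \<le> x then icdfc y (\<alpha> + b * x / y) else 0\<bar> \<le> 1"
    using abs_icdfc_le[of y "\<alpha> + b * x / y"] by auto
  then have "gain_monomial s t x * \<bar>if \<tau> * y \<le> x then icdfc y (\<alpha> + b * x / y) else 0\<bar> \<le> gain_monomial s t x * 1"
    by (intro mult_left_mono gain_monomial_nonneg)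
  then show "norm (gain_monomial s t x * (if \<tau> * y \<le> x then icdfc y (\<alpha> + b * x / y) else 0)) \<le> gain_monomial s t x"
    by (simp only: real_norm_def abs_mult abs_of_nonneg[OF gain_monomial_nonneg] mult_1_right)
qed

lemma integrable_dens_threshold_mean:
  assumes "1 \<le> s"
  shows "integrable lborel (\<lambda>y. dens y * threshold_mean \<tau> \<alpha> b s t y)"
proof -
  let ?K = "LINT x|lborel. gain_monomial s t x"
  have "integrable lborel (\<lambda>y. dens y * ?K)" using integrable_dens by (rule integrable_mult_left)
  then show ?thesis
  proof (rule Bochner_Integration.integrable_bound)
    show "AE y in lborel. norm (dens y * threshold_mean \<tau> \<alpha> b s t y) \<le> norm (dens y * ?K)"
      using abs_threshold_mean_le[OF assms] by (intro AE_I2) (auto simp: abs_mult intro!: mult_left_mono order_trans[OF _ abs_ge_self])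
  qed measurable
qed

text \<open>The common shape of the inner integrals of \<open>J1\<close> and \<open>J2\<close>. The
  slope of the threshold in the gain is \<open>b / y\<close>, and the gain integral starts at
  \<open>\<tau> * y\<close>.\<close>

definition outer_integrand :: "real \<Rightarrow> real \<Rightarrow> real \<Rightarrow> nat \<Rightarrow> nat \<Rightarrow> real \<Rightarrow> real" where
  "outer_integrand \<tau> \<alpha> b s t y = integral {0<..} (\<lambda>w. 1 / (pi * w) *
     Im (exp (- \<i> * of_real (w * \<alpha>)) * gain_transform (real s) t (\<tau> * y) (\<i> * of_real (w * (b / y))) * Phi S w y) *
     deriv (Lam S) y * exp (- Lam S y))"

lemma outer_integrand_eq:
  assumes y: "0 < y" "y \<notin> edges" and s: "1 \<le> s" and b: "b \<noteq> 0" and \<tau>: "0 \<le> \<tau>"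
    and good: "0 < dens y \<longrightarrow> (\<forall>z. z \<noteq> 0 \<longrightarrow> icdfc y z = icdf y z)"
  shows "outer_integrand \<tau> \<alpha> b s t y = dens y * threshold_mean \<tau> \<alpha> b s t y"
proof -
  obtain B p where "gil_pelaez (phi y) B p" by (rule gil_pelaez_phi[OF y(1)])
  then interpret gil_pelaez "phi y" B p .
  let ?G = "\<lambda>w. 1 / (pi * w) *
     Im (exp (- \<i> * of_real (w * \<alpha>)) * gain_transform (real s) t (\<tau> * y) (\<i> * of_real (w * (b / y))) * Phi S w y)"
  let ?V = "LBINT x:{\<tau> * y..}. x ^ t * exp (- (real s * x)) * icdf y (\<alpha> + b / y * x)"
  have "((\<lambda>w. 1 / (pi * w) *
     Im (exp (- \<i> * of_real (w * \<alpha>)) * gain_transform (real s) t (\<tau> * y) (\<i> * of_real (w * (b / y))) * phi y w)) has_integral ?V) {0<..}"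
    unfolding icdf_def by (rule has_integral_gain_transform) (use s b y \<tau> in auto)
  then have "(?G has_integral ?V) {0<..}"
    by (rule has_integral_eq[rotated]) (use y in \<open>simp add: phi_def\<close>)
  then have "((\<lambda>w. ?G w * (deriv (Lam S) y * exp (- Lam S y))) has_integral ?V * (deriv (Lam S) y * exp (- Lam S y))) {0<..}"
    by (rule has_integral_mult_left)
  from integral_unique[OF this] have "outer_integrand \<tau> \<alpha> b s t y = ?V * (deriv (Lam S) y * exp (- Lam S y))"
    unfolding outer_integrand_def by (simp only: mult.assoc)
  then have 1: "outer_integrand \<tau> \<alpha> b s t y = dens y * ?V"
    unfolding dens_eq[OF y] by (simp only: mult.commute)
  show ?thesis
  proof (cases "dens y = 0")
    case True
    then show ?thesis using 1 by simp
  next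
    case False
    then have good': "icdfc y z = icdf y z" if "z \<noteq> 0" for z
      using good that dens_nonneg[of y] by (simp add: less_le)
    have "?V = threshold_mean \<tau> \<alpha> b s t y"
      unfolding set_lebesgue_integral_def threshold_mean_def
    proof (rule integral_cong_AE)
      show "AE x in lborel. indicator {\<tau> * y..} x *\<^sub>R (x ^ t * exp (- (real s * x)) * icdf y (\<alpha> + b / y * x))
          = gain_monomial s t x * (if \<tau> * y \<le> x then icdfc y (\<alpha> + b * x / y) else 0)"
        \<comment> \<open>Again the only gain whose threshold is \<open>0\<close>, where
          \<open>icdf\<close> and its clipped version might differ.\<close>
        using AE_lborel_singleton[of "- \<alpha> * y / b"]
      proof eventually_elim
        case (elim x)
        then have "\<alpha> + b * x / y \<noteq> 0" using b y by (auto simp: field_simps add_eq_0_iff)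
        then have "icdfc y (\<alpha> + b * x / y) = icdf y (\<alpha> + b / y * x)" using good' by simp
        moreover have "0 \<le> x" if "\<tau> * y \<le> x" using that \<tau> y by (meson mult_nonneg_nonneg less_imp_le order_trans)
        ultimately show ?case by (auto simp: gain_monomial_def indicator_def)
      qed
    qed measurable
    then show ?thesis using 1 by simp
  qed
qed

text \<open>The outer integrand is identified off the countably many edges and off a null set of
  path losses without bounded \<open>icdf\<close>; changing it there does not affect the
  integral.\<close>

lemma integral_outer_integrand:
  assumes s: "1 \<le> s" and b: "b \<noteq> 0" and \<tau>: "0 \<le> \<tau>"
  shows "integral {0<..} (outer_integrand \<tau> \<alpha> b s t) = (LINT y|lborel. dens y * threshold_mean \<tau> \<alpha> b s t y)"
proof -
  let ?k = "\<lambda>y. dens y * threshold_mean \<tau> \<alpha> b s t y"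
  have "AE y in lborel. y \<in> {0<..} \<longrightarrow> outer_integrand \<tau> \<alpha> b s t y = ?k y"
  proof -
    have "AE y in lborel. y \<notin> edges \<inter> {0..}"
      by (rule AE_not_in) (intro countable_imp_null_set_lborel countable_edges)
    then show ?thesis using AE_icdfc_eq
      by eventually_elim (auto intro!: outer_integrand_eq s b \<tau>)
  qed
  then obtain N where N: "N \<in> null_sets lborel" "{y. \<not> (y \<in> {0<..} \<longrightarrow> outer_integrand \<tau> \<alpha> b s t y = ?k y)} \<subseteq> N"
    by (auto elim!: AE_E simp: null_sets_def)
  have "negligible N"
    using N(1) by (simp add: negligible_iff_null_sets null_sets_completionI)
  then have "integral {0<..} (outer_integrand \<tau> \<alpha> b s t) = integral {0<..} ?k"
    by (rule integral_spike) (use N(2) in auto)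
  also have "\<dots> = (LBINT y:{0<..}. ?k y)"
  proof (rule set_borel_integral_eq_integral(2)[symmetric])
    show "set_integrable lborel {0<..} ?k"
      unfolding set_integrable_def
      by (rule integrable_mult_indicator[OF _ integrable_dens_threshold_mean[OF s]]) simp
  qed
  also have "\<dots> = (LINT y|lborel. ?k y)"
    unfolding set_lebesgue_integral_def
    by (rule Bochner_Integration.integral_cong) (auto simp: indicator_def dens_def)
  finally show ?thesis .
qed

lemma tx_power_pos: "0 < tx_power S"
  using valid by (simp add: valid_network_def)

lemma J1_eq:
  assumes s: "1 \<le> s" and T: "0 \<le> T_star \<gamma> q v"
  shows "J1 S \<gamma> q v s t = (LINT y|lborel. dens y * threshold_mean (T_star \<gamma> q v / tx_power S) (q / tx_power S) (- 1) s t y)"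
proof -
  let ?\<tau> = "T_star \<gamma> q v / tx_power S"
  have "J1 S \<gamma> q v s t = integral {0<..} (outer_integrand ?\<tau> (q / tx_power S) (- 1) s t)"
    unfolding J1_def outer_integrand_def
  proof (intro integral_cong)
    fix y w :: real assume "y \<in> {0<..}" "w \<in> {0<..}"
    then have y: "y \<noteq> 0" by simp
    have 1: "of_real (real s) - \<i> * of_real (w / y) = of_real (real s) + \<i> * complex_of_real (w * (- 1 / y))"
      by simp
    have 2: "of_real ?\<tau> * (of_real (real s * y) - \<i> * of_real w) = of_real (?\<tau> * y) * (of_real (real s) + \<i> * complex_of_real (w * (- 1 / y)))"
    proof -
      have "complex_of_real y * (of_real (real s) + \<i> * complex_of_real (w * (- 1 / y))) = of_real (real s * y) - \<i> * of_real w"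
        using y by (simp add: field_simps)
      then show ?thesis by (simp only: of_real_mult[of ?\<tau> y] mult.assoc)
    qed
    have 3: "w * q / tx_power S = w * (q / tx_power S)" by simp
    show "1 / (pi * w) * Im (exp (- \<i> * of_real (w * q / tx_power S)) *
           (of_real (real s) - \<i> * of_real (w / y)) powi (- (1 + int t)) *
           Gamma_upper (1 + of_nat t) (of_real (T_star \<gamma> q v / tx_power S) * (of_real (real s * y) - \<i> * of_real w)) *
           Phi S w y) * deriv (Lam S) y * exp (- Lam S y) =
      1 / (pi * w) * Im (exp (- \<i> * of_real (w * (q / tx_power S))) *
        gain_transform (real s) t (?\<tau> * y) (\<i> * of_real (w * (- 1 / y))) * Phi S w y) * deriv (Lam S) y * exp (- Lam S y)"
      unfolding gain_transform_def 1 2 3 by (simp only: mult.assoc)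
  qed
  also have "\<dots> = (LINT y|lborel. dens y * threshold_mean ?\<tau> (q / tx_power S) (- 1) s t y)"
    by (rule integral_outer_integrand) (use s T tx_power_pos in auto)
  finally show ?thesis .
qed

lemma J2_eq:
  assumes s: "1 \<le> s" and T: "0 \<le> T_star \<gamma> q v" and \<gamma>: "0 < \<gamma>"
  shows "J2 S \<gamma> q v s t = (LINT y|lborel. dens y * threshold_mean (T_star \<gamma> q v / tx_power S) (- v / tx_power S) \<gamma> s t y)"
proof -
  let ?\<tau> = "T_star \<gamma> q v / tx_power S"
  have "J2 S \<gamma> q v s t = integral {0<..} (outer_integrand ?\<tau> (- v / tx_power S) \<gamma> s t)"
    unfolding J2_def outer_integrand_def
  proof (intro integral_cong)
    fix y w :: real assume "y \<in> {0<..}" "w \<in> {0<..}"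
    then have y: "y \<noteq> 0" by simp
    have 1: "w * \<gamma> / y = w * (\<gamma> / y)" by simp
    have 2: "of_real ?\<tau> * (of_real (real s * y) + \<i> * of_real (w * \<gamma>)) = of_real (?\<tau> * y) * (of_real (real s) + \<i> * complex_of_real (w * (\<gamma> / y)))"
    proof -
      have "complex_of_real y * (of_real (real s) + \<i> * complex_of_real (w * (\<gamma> / y))) = of_real (real s * y) + \<i> * of_real (w * \<gamma>)"
        using y by (simp add: field_simps)
      then show ?thesis by (simp only: of_real_mult[of ?\<tau> y] mult.assoc)
    qed
    have 3: "\<i> * complex_of_real (w * v / tx_power S) = - \<i> * of_real (w * (- v / tx_power S))" by simp
    show "1 / (pi * w) * Im (exp (\<i> * of_real (w * v / tx_power S)) *
           (of_real (real s) + \<i> * of_real (w * \<gamma> / y)) powi (- (1 + int t)) *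
           Gamma_upper (1 + of_nat t) (of_real (T_star \<gamma> q v / tx_power S) * (of_real (real s * y) + \<i> * of_real (w * \<gamma>))) *
           Phi S w y) * deriv (Lam S) y * exp (- Lam S y) =
      1 / (pi * w) * Im (exp (- \<i> * of_real (w * (- v / tx_power S))) *
        gain_transform (real s) t (?\<tau> * y) (\<i> * of_real (w * (\<gamma> / y))) * Phi S w y) * deriv (Lam S) y * exp (- Lam S y)"
      unfolding gain_transform_def 1 2 3 by (simp only: mult.assoc)
  qed
  also have "\<dots> = (LINT y|lborel. dens y * threshold_mean ?\<tau> (- v / tx_power S) \<gamma> s t y)"
    by (rule integral_outer_integrand) (use s T \<gamma> tx_power_pos in auto)
  finally show ?thesis .
qed

end

section \<open>The serving gain and the event that the interference lies between both
  thresholds\<close>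

locale network_link = network_interference +
  fixes a :: "nat \<Rightarrow> nat \<Rightarrow> real"
  assumes pdf_g_nonneg: "\<And>\<zeta>. 0 \<le> \<zeta> \<Longrightarrow> 0 \<le> gain_density S a \<zeta>"
    and pdf_g: "distributed M lborel g
      (\<lambda>\<zeta>. ennreal (if 0 \<le> \<zeta> then gain_density S a \<zeta> else 0))"
begin

definition gain_pdf :: "real \<Rightarrow> real" where
  "gain_pdf x = (if 0 \<le> x then gain_density S a x else 0)"

lemma gain_pdf_nonneg: "0 \<le> gain_pdf x"
  using pdf_g_nonneg by (simp add: gain_pdf_def)

lemma gain_pdf_eq: "gain_pdf x = K_mn (n_min S) (n_max S) *
    (\<Sum>s=1..n_min S. \<Sum>t=n_max S - n_min S..(n_max S + n_min S - 2 * s) * s. a s t * gain_monomial s t x)"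
  by (auto simp: gain_pdf_def gain_density_def Let_def gain_monomial_def mult.assoc)

lemma gain_pdf_measurable [measurable]: "gain_pdf \<in> borel_measurable borel"
  unfolding gain_pdf_eq[abs_def] by measurable

lemma distr_gain: "distr M borel g = density lborel (\<lambda>x. ennreal (gain_pdf x))"
proof -
  have "distr M borel g = distr M lborel g" by (rule distr_cong) auto
  then show ?thesis using distributed_distr_eq_density[OF pdf_g] by (simp only: gain_pdf_def)
qed

lemma AE_gain_pos: "AE \<omega> in M. 0 < g \<omega>"
proof -
  have "AE x in density lborel (\<lambda>x. ennreal (gain_pdf x)). 0 < x"
    by (subst AE_density, simp, use AE_lborel_singleton[of 0] in eventually_elim) (auto simp: gain_pdf_def)
  then have "AE x in distr M borel g. 0 < x" unfolding distr_gain .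
  then show ?thesis by (subst (asm) AE_distr_iff) auto
qed

abbreviation "law_LI \<equiv> distr M (borel \<Otimes>\<^sub>M borel) LI"
abbreviation "law_g \<equiv> distr M borel g"

sublocale law: pair_prob_space law_LI law_g
proof -
  interpret D1: prob_space law_LI by (rule prob_space_distr) measurable
  interpret D2: prob_space law_g by (rule prob_space_distr) measurable
  show "pair_prob_space law_LI law_g" ..
qed

text \<open>Given path loss and interference, equality fixes the gain, which has a density and is
  independent of both. Hence strict and weak inequality at the lower threshold have the same
  probability.\<close>

lemma AE_interference_ne: "AE \<omega> in M. L \<omega> < \<infinity> \<longrightarrow> I \<omega> \<noteq> \<alpha> + (- 1) * g \<omega> / Y \<omega>"
proof -
  let ?Q = "\<lambda>x. 0 < enn2real (fst (fst x)) \<longrightarrow> snd (fst x) \<noteq> \<alpha> + (- 1) * snd x / enn2real (fst (fst x))"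
  have "AE x in law_LI \<Otimes>\<^sub>M law_g. ?Q x"
  proof (rule law.AE_pair_measure)
    have "Measurable.pred ((borel \<Otimes>\<^sub>M borel) \<Otimes>\<^sub>M borel) ?Q" by measurable
    then show "{x \<in> space (law_LI \<Otimes>\<^sub>M law_g). ?Q x} \<in> sets (law_LI \<Otimes>\<^sub>M law_g)"
      by (simp add: pred_def space_pair_measure cong: sets_pair_measure_cong)
    show "AE x in law_LI. AE y in law_g. ?Q (x, y)"
    proof (rule AE_I2)
      fix x :: "ennreal \<times> real"
      let ?c = "enn2real (fst x) * (\<alpha> - snd x)"
      have "AE y in law_g. y \<noteq> ?c"
        unfolding distr_gain by (subst AE_density, simp, use AE_lborel_singleton[of ?c] in eventually_elim) auto
      then show "AE y in law_g. ?Q (x, y)"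
        by eventually_elim (auto simp: field_simps)
    qed
  qed
  then have "AE x in distr M ((borel \<Otimes>\<^sub>M borel) \<Otimes>\<^sub>M borel) (\<lambda>\<omega>. (LI \<omega>, g \<omega>)). ?Q x"
    unfolding distr_network_gain .
  then have "AE \<omega> in M. ?Q (LI \<omega>, g \<omega>)"
    by (subst (asm) AE_distr_iff) auto
  then show ?thesis using AE_Y_pos by eventually_elim (auto simp: Y_def)
qed

context
  fixes q v \<gamma> :: real
  assumes q: "0 \<le> q" and v: "0 < v" and \<gamma>: "0 < \<gamma>"
begin

abbreviation "lower x y \<equiv> q / tx_power S + (- 1) * x / y"
abbreviation "upper x y \<equiv> - v / tx_power S + \<gamma> * x / y"
abbreviation "\<tau> \<equiv> T_star \<gamma> q v / tx_power S"

definition service_event :: "'a set" where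
  "service_event = {\<omega> \<in> space M. L \<omega> < \<infinity> \<and> lower (g \<omega>) (Y \<omega>) \<le> I \<omega> \<and> I \<omega> \<le> upper (g \<omega>) (Y \<omega>)}"

lemma \<tau>_pos: "0 < \<tau>"
  using q v \<gamma> tx_power_pos by (simp add: T_star_def)

text \<open>Origin of \<open>T_star\<close>: the two thresholds coincide exactly at the gain
  \<open>\<tau> * y\<close>.\<close>

lemma lower_le_upper_iff:
  assumes "0 < y"
  shows "lower x y \<le> upper x y \<longleftrightarrow> \<tau> * y \<le> x"
proof -
  have P: "0 < tx_power S" by (rule tx_power_pos)
  have "lower x y \<le> upper x y \<longleftrightarrow> (q + v) / tx_power S \<le> (\<gamma> + 1) * x / y"
    by (simp add: add_divide_distrib distrib_right) linarith
  also have "\<dots> \<longleftrightarrow> (q + v) / tx_power S * y \<le> (\<gamma> + 1) * x"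
    using assms by (simp add: pos_le_divide_eq)
  also have "\<dots> \<longleftrightarrow> (\<gamma> + 1) * (\<tau> * y) \<le> (\<gamma> + 1) * x"
    using \<gamma> by (simp add: T_star_def)
  also have "\<dots> \<longleftrightarrow> \<tau> * y \<le> x" using \<gamma> by (intro mult_le_cancel_left_pos) simp
  finally show ?thesis .
qed

text \<open>If the lower threshold exceeded the upper one, the difference of indicators would be
  \<open>-1\<close> for interference between them; the condition involving \<tau> excludes
  this.\<close>

definition psi :: "ennreal \<times> real \<Rightarrow> real \<Rightarrow> real" where
  "psi x r = (if fst x < \<infinity> \<and> \<tau> * enn2real (fst x) \<le> r
     then (if snd x \<le> upper r (enn2real (fst x)) then 1 else 0) - (if snd x \<le> lower r (enn2real (fst x)) then 1 else 0)
     else 0)"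

lemma psi_measurable: "case_prod psi \<in> borel_measurable ((borel \<Otimes>\<^sub>M borel) \<Otimes>\<^sub>M borel)"
  unfolding psi_def[abs_def] case_prod_beta by measurable

lemma abs_psi_le: "\<bar>psi x r\<bar> \<le> 1"
  by (auto simp: psi_def)

lemma prob_service_event: "prob service_event = (\<integral>\<omega>. psi (LI \<omega>) (g \<omega>) \<partial>M)"
proof -
  have e [measurable]: "service_event \<in> events" unfolding service_event_def by measurable
  have "prob service_event = (\<integral>\<omega>. indicator service_event \<omega> \<partial>M)" using e by simp
  also have "\<dots> = (\<integral>\<omega>. psi (LI \<omega>) (g \<omega>) \<partial>M)"
  proof (rule integral_cong_AE)
    show "AE \<omega> in M. indicator service_event \<omega> = psi (LI \<omega>) (g \<omega>)"
      using AE_interference_ne[of "q / tx_power S"] AE_Y_pos AE_space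
    proof eventually_elim
      case (elim \<omega>)
      show ?case
      proof (cases "L \<omega> < \<infinity>")
        case True
        then have y: "0 < Y \<omega>" and ne: "I \<omega> \<noteq> lower (g \<omega>) (Y \<omega>)" using elim by auto
        show ?thesis
          using lower_le_upper_iff[OF y, of "g \<omega>"] ne True elim
          by (auto simp: psi_def service_event_def indicator_def Y_def[symmetric])
      qed (simp add: psi_def service_event_def)
    qed
    have "(\<lambda>\<omega>. (LI \<omega>, g \<omega>)) \<in> measurable M ((borel \<Otimes>\<^sub>M borel) \<Otimes>\<^sub>M borel)" by measurable
    from measurable_compose[OF this psi_measurable]
    show "(\<lambda>\<omega>. psi (LI \<omega>) (g \<omega>)) \<in> borel_measurable M" by simp
  qed measurable
  finally show ?thesis .
qed

lemma psi_measurable_fst: "(\<lambda>x. psi x r) \<in> borel_measurable (borel \<Otimes>\<^sub>M borel)"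
proof -
  have "(\<lambda>x. (x, r)) \<in> measurable (borel \<Otimes>\<^sub>M borel) ((borel \<Otimes>\<^sub>M borel) \<Otimes>\<^sub>M borel)" by measurable
  from measurable_compose[OF this psi_measurable] show ?thesis by simp
qed

lemma expectation_psi_measurable: "(\<lambda>r. \<integral>\<omega>. psi (LI \<omega>) r \<partial>M) \<in> borel_measurable borel"
proof (rule borel_measurable_lebesgue_integral)
  have "(\<lambda>x. (LI (snd x), fst x)) \<in> measurable (borel \<Otimes>\<^sub>M M) ((borel \<Otimes>\<^sub>M borel) \<Otimes>\<^sub>M borel)" by measurable
  from measurable_compose[OF this psi_measurable]
  show "case_prod (\<lambda>r \<omega>. psi (LI \<omega>) r) \<in> borel_measurable (borel \<Otimes>\<^sub>M M)" by (simp add: case_prod_beta)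
qed

lemma expectation_psi: "(\<integral>\<omega>. psi (LI \<omega>) (g \<omega>) \<partial>M) = (\<integral>r. gain_pdf r * (\<integral>\<omega>. psi (LI \<omega>) r \<partial>M) \<partial>lborel)"
proof -
  have LIg: "(\<lambda>\<omega>. (LI \<omega>, g \<omega>)) \<in> measurable M ((borel \<Otimes>\<^sub>M borel) \<Otimes>\<^sub>M borel)" by measurable
  have pm: "case_prod psi \<in> borel_measurable (law_LI \<Otimes>\<^sub>M law_g)"
    using psi_measurable by (simp cong: measurable_cong_sets sets_pair_measure_cong)
  have int: "integrable (law_LI \<Otimes>\<^sub>M law_g) (case_prod psi)"
    by (rule law.integrable_const_bound[where B = 1]) (use abs_psi_le pm in \<open>auto simp: case_prod_beta\<close>)
  have "(\<integral>\<omega>. psi (LI \<omega>) (g \<omega>) \<partial>M) = integral\<^sup>L (law_LI \<Otimes>\<^sub>M law_g) (case_prod psi)"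
    unfolding distr_network_gain by (subst integral_distr[OF LIg psi_measurable]) simp
  also have "\<dots> = (\<integral>r. (\<integral>x. psi x r \<partial>law_LI) \<partial>law_g)"
    using law.integral_snd[OF int] by simp
  also have "\<dots> = (\<integral>r. (\<integral>\<omega>. psi (LI \<omega>) r \<partial>M) \<partial>law_g)"
    by (subst integral_distr[OF LI_measurable psi_measurable_fst]) simp
  also have "\<dots> = (\<integral>r. gain_pdf r * (\<integral>\<omega>. psi (LI \<omega>) r \<partial>M) \<partial>lborel)"
  proof -
    note [measurable] = expectation_psi_measurable
    show ?thesis
      unfolding distr_gain by (subst integral_density) (auto simp: gain_pdf_nonneg)
  qed
  finally show ?thesis .
qed

text \<open>Lower minus upper, because \<open>icdfc\<close> stands for \<open>1/2\<close> minus the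
  distribution function.\<close>

definition window :: "real \<Rightarrow> real \<Rightarrow> real" where
  "window r y = (if \<tau> * y \<le> r then icdfc y (lower r y) else 0) - (if \<tau> * y \<le> r then icdfc y (upper r y) else 0)"

lemma window_measurable [measurable (raw)]:
  assumes [measurable]: "f \<in> borel_measurable N" "k \<in> borel_measurable N"
  shows "(\<lambda>x. window (f x) (k x)) \<in> borel_measurable N"
  unfolding window_def by measurable

lemma abs_window_le: "\<bar>window r y\<bar> \<le> 1"
  using abs_icdfc_le[of y "lower r y"] abs_icdfc_le[of y "upper r y"] unfolding window_def by (auto simp: abs_le_iff)

lemma expectation_psi_const:
  assumes r: "0 < r"
  shows "(\<integral>\<omega>. psi (LI \<omega>) r \<partial>M) = (\<integral>y. dens y * window r y \<partial>lborel)"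
proof -
  define f where "f y = (if \<tau> * y \<le> r then 1 else 0 :: real)" for y
  have f [measurable]: "f \<in> borel_measurable borel" unfolding f_def by measurable
  have fb: "\<bar>f y\<bar> \<le> 1" for y by (simp add: f_def)
  have P: "0 < tx_power S" by (rule tx_power_pos)
  \<comment> \<open>For a fixed positive gain the lower threshold vanishes at most at
    \<open>y = r * P / q\<close>, and never at a nonzero \<open>y\<close> if \<open>q = 0\<close>.
    The upper one is treated alike.\<close>
  have nzl: "AE y in lborel. lower r y \<noteq> 0"
    using AE_lborel_singleton[of 0] AE_lborel_singleton[of "r * tx_power S / q"]
  proof eventually_elim
    case (elim y)
    show ?case
    proof
      assume "lower r y = 0"
      then have "q / tx_power S = r / y" by simp
      then have "q * y = r * tx_power S" using elim P by (simp add: field_simps)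
      moreover have "q \<noteq> 0" using calculation r P by auto
      ultimately show False using elim by (simp add: field_simps)
    qed
  qed
  have nzu: "AE y in lborel. upper r y \<noteq> 0"
    using AE_lborel_singleton[of 0] AE_lborel_singleton[of "\<gamma> * r * tx_power S / v"]
  proof eventually_elim
    case (elim y)
    show ?case
    proof
      assume "upper r y = 0"
      then have "v / tx_power S = \<gamma> * r / y" by simp
      then have "v * y = \<gamma> * r * tx_power S" using elim P by (simp add: field_simps)
      then show False using elim v by (simp add: field_simps)
    qed
  qed
  let ?u = "\<lambda>\<omega>. indicator finite_loss \<omega> * f (Y \<omega>) * (if I \<omega> \<le> upper r (Y \<omega>) then 1 else 0)"
  let ?l = "\<lambda>\<omega>. indicator finite_loss \<omega> * f (Y \<omega>) * (if I \<omega> \<le> lower r (Y \<omega>) then 1 else 0)"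
  let ?u' = "\<lambda>\<omega>. indicator finite_loss \<omega> * f (Y \<omega>) * (1/2 - icdfc (Y \<omega>) (upper r (Y \<omega>)))"
  let ?l' = "\<lambda>\<omega>. indicator finite_loss \<omega> * f (Y \<omega>) * (1/2 - icdfc (Y \<omega>) (lower r (Y \<omega>)))"
  have i1: "integrable M ?u" "integrable M ?l"
    by (rule integrable_bounded_M[where K = 1]; measurable?; auto simp: indicator_def f_def)+
  have bd: "\<bar>1/2 - icdfc y z\<bar> \<le> 1" for y z using abs_icdfc_le[of y z] by linarith
  have i2: "integrable M ?u'" "integrable M ?l'"
    by (rule integrable_bounded_M[where K = 1]; measurable?; use bd in \<open>auto simp: indicator_def f_def\<close>)+
  have "(\<integral>\<omega>. psi (LI \<omega>) r \<partial>M) = (\<integral>\<omega>. ?u \<omega> - ?l \<omega> \<partial>M)"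
    by (rule Bochner_Integration.integral_cong) (auto simp: psi_def finite_loss_def Y_def f_def indicator_def)
  also have "\<dots> = (\<integral>\<omega>. ?u \<omega> \<partial>M) - (\<integral>\<omega>. ?l \<omega> \<partial>M)"
    by (rule Bochner_Integration.integral_diff[OF i1])
  also have "(\<integral>\<omega>. ?u \<omega> \<partial>M) = (\<integral>\<omega>. ?u' \<omega> \<partial>M)"
    by (rule expectation_threshold[OF f fb _ nzu]) measurable
  also have "(\<integral>\<omega>. ?l \<omega> \<partial>M) = (\<integral>\<omega>. ?l' \<omega> \<partial>M)"
    by (rule expectation_threshold[OF f fb _ nzl]) measurable
  also have "(\<integral>\<omega>. ?u' \<omega> \<partial>M) - (\<integral>\<omega>. ?l' \<omega> \<partial>M) = (\<integral>\<omega>. ?u' \<omega> - ?l' \<omega> \<partial>M)"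
    by (rule Bochner_Integration.integral_diff[OF i2, symmetric])
  also have "\<dots> = (\<integral>\<omega>. indicator finite_loss \<omega> * window r (Y \<omega>) \<partial>M)"
    by (rule Bochner_Integration.integral_cong) (auto simp: window_def f_def algebra_simps)
  also have "\<dots> = (\<integral>y. dens y * window r y \<partial>lborel)"
    by (rule expectation_path_loss) measurable
  finally show ?thesis .
qed

lemma integrable_gain_dens_window:
  assumes "1 \<le> s"
  shows "integrable (lborel \<Otimes>\<^sub>M lborel) (case_prod (\<lambda>r y. gain_monomial s t r * (dens y * window r y)))"
proof (rule Bochner_Integration.integrable_bound[OF integrable_lborel_product[OF integrable_gain_monomial[OF assms, of t] integrable_dens]])
  show "AE x in lborel \<Otimes>\<^sub>M lborel. norm (case_prod (\<lambda>r y. gain_monomial s t r * (dens y * window r y)) x)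
      \<le> norm (gain_monomial s t (fst x) * dens (snd x))"
  proof (rule AE_I2)
    fix x :: "real \<times> real"
    have "\<bar>gain_monomial s t (fst x) * dens (snd x)\<bar> * \<bar>window (fst x) (snd x)\<bar> \<le> \<bar>gain_monomial s t (fst x) * dens (snd x)\<bar> * 1"
      by (intro mult_left_mono abs_window_le) auto
    then show "norm (case_prod (\<lambda>r y. gain_monomial s t r * (dens y * window r y)) x) \<le> norm (gain_monomial s t (fst x) * dens (snd x))"
      by (simp add: case_prod_beta abs_mult mult.assoc)
  qed
qed measurable

lemma gain_monomial_window_integral:
  assumes s: "1 \<le> s"
  shows "(\<integral>r. gain_monomial s t r * (\<integral>y. dens y * window r y \<partial>lborel) \<partial>lborel) = J1 S \<gamma> q v s t - J2 S \<gamma> q v s t"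
proof -
  have T: "0 \<le> T_star \<gamma> q v" using \<tau>_pos tx_power_pos by (simp add: zero_less_divide_iff)
  have "(\<integral>r. gain_monomial s t r * (\<integral>y. dens y * window r y \<partial>lborel) \<partial>lborel)
      = (\<integral>r. (\<integral>y. gain_monomial s t r * (dens y * window r y) \<partial>lborel) \<partial>lborel)"
    by simp
  also have "\<dots> = (\<integral>y. (\<integral>r. gain_monomial s t r * (dens y * window r y) \<partial>lborel) \<partial>lborel)"
    by (rule lborel_pair.Fubini_integral[OF integrable_gain_dens_window[OF s], symmetric])
  also have "\<dots> = (\<integral>y. dens y * threshold_mean \<tau> (q / tx_power S) (- 1) s t y
       - dens y * threshold_mean \<tau> (- v / tx_power S) \<gamma> s t y \<partial>lborel)"
  proof (rule Bochner_Integration.integral_cong[OF refl])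
    fix y
    have "(\<integral>r. gain_monomial s t r * (dens y * window r y) \<partial>lborel) = (\<integral>r. dens y * (gain_monomial s t r * window r y) \<partial>lborel)"
      by (simp only: mult.left_commute)
    also have "\<dots> = dens y * (\<integral>r. gain_monomial s t r * window r y \<partial>lborel)" by simp
    also have "(\<integral>r. gain_monomial s t r * window r y \<partial>lborel) =
      (\<integral>r. gain_monomial s t r * (if \<tau> * y \<le> r then icdfc y (lower r y) else 0)
        - gain_monomial s t r * (if \<tau> * y \<le> r then icdfc y (upper r y) else 0) \<partial>lborel)"
      unfolding window_def right_diff_distrib ..
    also have "\<dots> = threshold_mean \<tau> (q / tx_power S) (- 1) s t y - threshold_mean \<tau> (- v / tx_power S) \<gamma> s t y"
      unfolding threshold_mean_def
      by (rule Bochner_Integration.integral_diff[OF integrable_threshold_integrand[OF s] integrable_threshold_integrand[OF s]])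
    finally show "(\<integral>r. gain_monomial s t r * (dens y * window r y) \<partial>lborel) =
       dens y * threshold_mean \<tau> (q / tx_power S) (- 1) s t y - dens y * threshold_mean \<tau> (- v / tx_power S) \<gamma> s t y"
      by (simp only: right_diff_distrib)
  qed
  also have "\<dots> = J1 S \<gamma> q v s t - J2 S \<gamma> q v s t"
    unfolding J1_eq[OF s T] J2_eq[OF s T \<gamma>]
    by (rule Bochner_Integration.integral_diff[OF integrable_dens_threshold_mean[OF s] integrable_dens_threshold_mean[OF s]])
  finally show ?thesis .
qed

lemma prob_service_event_eq: "prob service_event = joint_ccdf_formula S a \<gamma> q v"
proof -
  let ?W = "\<lambda>r. \<integral>y. dens y * window r y \<partial>lborel"
  let ?T = "\<lambda>s. {n_max S - n_min S..(n_max S + n_min S - 2 * s) * s}"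
  have mi: "integrable lborel (\<lambda>r. gain_monomial s t r * ?W r)" if s: "1 \<le> s" for s t
    using lborel_pair.integrable_fst[OF integrable_gain_dens_window[OF s, of t]] by simp
  have "prob service_event = (\<integral>r. gain_pdf r * (\<integral>\<omega>. psi (LI \<omega>) r \<partial>M) \<partial>lborel)"
    unfolding prob_service_event expectation_psi ..
  also have "\<dots> = (\<integral>r. gain_pdf r * ?W r \<partial>lborel)"
  proof (rule integral_cong_AE)
    note [measurable] = expectation_psi_measurable
    show "(\<lambda>r. gain_pdf r * (\<integral>\<omega>. psi (LI \<omega>) r \<partial>M)) \<in> borel_measurable lborel" by simp
    show "AE r in lborel. gain_pdf r * (\<integral>\<omega>. psi (LI \<omega>) r \<partial>M) = gain_pdf r * ?W r"
      using AE_lborel_singleton[of 0]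
    proof eventually_elim
      case (elim r)
      then show ?case by (cases "0 < r") (simp_all add: expectation_psi_const gain_pdf_def)
    qed
  qed measurable
  also have "\<dots> = (\<integral>r. K_mn (n_min S) (n_max S) * (\<Sum>s=1..n_min S. \<Sum>t\<in>?T s. a s t * (gain_monomial s t r * ?W r)) \<partial>lborel)"
    unfolding gain_pdf_eq by (simp add: sum_distrib_right sum_distrib_left mult.assoc)
  also have "\<dots> = K_mn (n_min S) (n_max S) * (\<integral>r. (\<Sum>s=1..n_min S. \<Sum>t\<in>?T s. a s t * (gain_monomial s t r * ?W r)) \<partial>lborel)"
    by (rule integral_mult_right_zero)
  also have "(\<integral>r. (\<Sum>s=1..n_min S. \<Sum>t\<in>?T s. a s t * (gain_monomial s t r * ?W r)) \<partial>lborel)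
      = (\<Sum>s=1..n_min S. \<integral>r. (\<Sum>t\<in>?T s. a s t * (gain_monomial s t r * ?W r)) \<partial>lborel)"
    by (rule Bochner_Integration.integral_sum) (auto intro!: Bochner_Integration.integrable_sum integrable_mult_right mi)
  also have "\<dots> = (\<Sum>s=1..n_min S. \<Sum>t\<in>?T s. a s t * (J1 S \<gamma> q v s t - J2 S \<gamma> q v s t))"
  proof (rule sum.cong[OF refl])
    fix s assume "s \<in> {1..n_min S}"
    then have s: "1 \<le> s" by simp
    have "(\<integral>r. (\<Sum>t\<in>?T s. a s t * (gain_monomial s t r * ?W r)) \<partial>lborel)
       = (\<Sum>t\<in>?T s. \<integral>r. a s t * (gain_monomial s t r * ?W r) \<partial>lborel)"
      by (rule Bochner_Integration.integral_sum) (auto intro!: integrable_mult_right mi s)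
    also have "\<dots> = (\<Sum>t\<in>?T s. a s t * (J1 S \<gamma> q v s t - J2 S \<gamma> q v s t))"
      by (simp only: integral_mult_right_zero gain_monomial_window_integral[OF s])
    finally show "(\<integral>r. (\<Sum>t\<in>?T s. a s t * (gain_monomial s t r * ?W r)) \<partial>lborel) = \<dots>" .
  qed
  finally show ?thesis by (simp only: joint_ccdf_formula_def Let_def)
qed

end

end

text \<open>With \<open>c = 2 powr (R / B) - 1\<close> the rate condition becomes
  \<open>c * (P * J + v) \<le> P * G\<close>, which is linear in the interference;
  \<open>1 / c\<close> is \<gamma>.\<close>

lemma rate_threshold_iff:
  fixes B P G J v R :: real
  assumes "0 < B" "0 < P" "0 < G" "0 \<le> J" "0 < v" "0 < R"
  shows "R \<le> B * log 2 (1 + P * G / (P * J + v)) \<longleftrightarrow> J \<le> - v / P + 1 / (2 powr (R / B) - 1) * G"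
proof -
  define c where "c = 2 powr (R / B) - 1"
  have c: "0 < c" using assms by (simp add: c_def)
  have D: "0 < P * J + v" using assms by (intro add_nonneg_pos) auto
  have "0 < P * G / (P * J + v)" by (rule divide_pos_pos[OF mult_pos_pos D]) (use assms in auto)
  then have X: "0 < 1 + P * G / (P * J + v)" by linarith
  have "R \<le> B * log 2 (1 + P * G / (P * J + v)) \<longleftrightarrow> R / B \<le> log 2 (1 + P * G / (P * J + v))"
    using assms by (simp add: pos_divide_le_eq mult.commute)
  also have "\<dots> \<longleftrightarrow> 2 powr (R / B) \<le> 1 + P * G / (P * J + v)"
    using X by (simp add: le_log_iff)
  also have "\<dots> \<longleftrightarrow> c \<le> P * G / (P * J + v)" by (auto simp: c_def)
  also have "\<dots> \<longleftrightarrow> c * (P * J + v) \<le> P * G" using D by (rule pos_le_divide_eq)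
  also have "\<dots> \<longleftrightarrow> (P * J + v) \<le> P * G / c" using c by (simp add: pos_le_divide_eq mult.commute)
  also have "\<dots> \<longleftrightarrow> P * J \<le> P * (- v / P + 1 / c * G)"
  proof -
    have e: "P * (- v / P + 1 / c * G) = P * G / c - v" using assms by (simp add: right_diff_distrib)
    show ?thesis unfolding e by linarith
  qed
  also have "\<dots> \<longleftrightarrow> J \<le> - v / P + 1 / c * G" using assms by (intro mult_le_cancel_left_pos)
  finally show ?thesis by (simp add: c_def)
qed

section \<open>From rate and harvested energy to thresholds for the interference\<close>

context network_link
begin

lemma rx_gain_finite:
  assumes "0 < L \<omega>" "L \<omega> < \<infinity>"
  shows "rx_gain S C X g \<omega> = g \<omega> / Y \<omega>"
proof (cases "L \<omega>")
  case (real r)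
  then have "1 / L \<omega> = ennreal (1 / r)" using assms divide_ennreal[of 1 r] by simp
  then show ?thesis using real by (simp add: rx_gain_def Y_def)
qed (use assms in simp)

lemma rx_gain_infinite: "L \<omega> = \<infinity> \<Longrightarrow> rx_gain S C X g \<omega> = 0"
  by (simp add: rx_gain_def)

lemma rx_gain_measurable [measurable]: "rx_gain S C X g \<in> borel_measurable M"
  unfolding rx_gain_def by measurable

lemma rate_measurable [measurable]: "rate S C X h g \<in> borel_measurable M"
  unfolding rate_def by measurable

lemma harvested_measurable [measurable]: "harvested S C X h g \<in> borel_measurable M"
  unfolding harvested_def by measurable

lemma harvested_iff:
  assumes "0 < L \<omega>" "L \<omega> < \<infinity>"
  shows "Qs \<le> harvested S C X h g \<omega> \<longleftrightarrow> Qs / (rho S * xi S) / tx_power S + (- 1) * g \<omega> / Y \<omega> \<le> I \<omega>"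
proof -
  have p: "0 < rho S * xi S" "0 < tx_power S" using valid by (auto simp: valid_network_def)
  have "Qs \<le> harvested S C X h g \<omega> \<longleftrightarrow> Qs \<le> (g \<omega> / Y \<omega> + I \<omega>) * tx_power S * (rho S * xi S)"
    unfolding harvested_def rx_gain_finite[OF assms] by (simp only: mult_ac)
  also have "\<dots> \<longleftrightarrow> Qs / (rho S * xi S) \<le> (g \<omega> / Y \<omega> + I \<omega>) * tx_power S" by (rule pos_divide_le_eq[OF p(1), symmetric])
  also have "\<dots> \<longleftrightarrow> Qs / (rho S * xi S) / tx_power S \<le> g \<omega> / Y \<omega> + I \<omega>" by (rule pos_divide_le_eq[OF p(2), symmetric])
  finally show ?thesis by auto
qed

context
  fixes Rs Qs q v :: real
  assumes Qs: "0 \<le> Qs" and q_def: "q = Qs / (rho S * xi S)"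
    and v_def: "v = var_n S + var_c S / (1 - rho S)"
begin

lemma noise_pos: "0 < v"
proof -
  have h: "0 \<le> var_n S" "0 \<le> var_c S" "0 < var_n S + var_c S" "0 < 1 - rho S" "1 - rho S \<le> 1"
    using valid by (auto simp: valid_network_def)
  have "var_c S / 1 \<le> var_c S / (1 - rho S)" using h by (intro divide_left_mono) auto
  then show ?thesis using h by (simp add: v_def)
qed

lemma energy_nonneg: "0 \<le> q"
  using valid Qs by (auto simp: q_def valid_network_def)

lemma prob_rate_energy_pos:
  assumes Rs: "0 < Rs"
  shows "measure M {\<omega> \<in> space M. rate S C X h g \<omega> \<ge> Rs \<and> harvested S C X h g \<omega> \<ge> Qs} =
        joint_ccdf_formula S a (1 / (2 powr (Rs / B_c S) - 1)) q v"
proof -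
  let ?\<gamma> = "1 / (2 powr (Rs / B_c S) - 1)"
  have B: "0 < B_c S" and P: "0 < tx_power S" using valid by (auto simp: valid_network_def)
  have \<gamma>: "0 < ?\<gamma>" using Rs B by simp
  have "measure M {\<omega> \<in> space M. rate S C X h g \<omega> \<ge> Rs \<and> harvested S C X h g \<omega> \<ge> Qs} = prob (service_event q v ?\<gamma>)"
  proof (rule finite_measure_eq_AE)
    show "AE \<omega> in M. \<omega> \<in> {\<omega> \<in> space M. rate S C X h g \<omega> \<ge> Rs \<and> harvested S C X h g \<omega> \<ge> Qs} \<longleftrightarrow> \<omega> \<in> service_event q v ?\<gamma>"
      using AE_I_nonneg AE_gain_pos AE_L_pos AE_Y_pos
    proof eventually_elim
      case (elim \<omega>)
      show ?case
      proof (cases "L \<omega> < \<infinity>")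
        case True
        then have y: "0 < Y \<omega>" using elim by blast
        have "rate S C X h g \<omega> = B_c S * log 2 (1 + tx_power S * (g \<omega> / Y \<omega>) / (tx_power S * I \<omega> + v))"
          unfolding rate_def rx_gain_finite[OF elim(3) True] v_def by (simp only: add.assoc)
        then have r1: "Rs \<le> rate S C X h g \<omega> \<longleftrightarrow> I \<omega> \<le> - v / tx_power S + ?\<gamma> * g \<omega> / Y \<omega>"
          using rate_threshold_iff[OF B P _ elim(1) noise_pos Rs, of "g \<omega> / Y \<omega>"] elim(2) y by simp
        have h1: "Qs \<le> harvested S C X h g \<omega> \<longleftrightarrow> q / tx_power S + (- 1) * g \<omega> / Y \<omega> \<le> I \<omega>"
          unfolding q_def by (rule harvested_iff[OF elim(3) True])
        show ?thesis
          unfolding service_event_def[OF energy_nonneg noise_pos \<gamma>] mem_Collect_eq r1 h1 using True by blast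
      next
        \<comment> \<open>With infinite path loss there is no received signal: the rate is
          \<open>0 < Rs\<close>, and neither event occurs.\<close>
        case False
        then have "L \<omega> = \<infinity>" by (simp add: less_top[symmetric])
        then have "rate S C X h g \<omega> = 0" by (simp add: rate_def rx_gain_infinite)
        then show ?thesis using Rs False by (auto simp: service_event_def[OF energy_nonneg noise_pos \<gamma>])
      qed
    qed
    show "{\<omega> \<in> space M. rate S C X h g \<omega> \<ge> Rs \<and> harvested S C X h g \<omega> \<ge> Qs} \<in> events" by measurable
    have "service_event q v c \<in> events" if "0 < c" for c
      unfolding service_event_def[OF energy_nonneg noise_pos that] by measurable
    then show "service_event q v ?\<gamma> \<in> events" using \<gamma> .
  qed
  then show ?thesis using prob_service_event_eq[OF energy_nonneg noise_pos \<gamma>] by simp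
qed

text \<open>As \<gamma> grows, the upper threshold tends to infinity wherever the gain is positive
  and the path loss finite, so the rate constraint disappears pointwise; bounded convergence does
  the rest.\<close>

lemma prob_rate_energy_0:
  "((\<lambda>\<gamma>. joint_ccdf_formula S a \<gamma> q v) \<longlongrightarrow>
        measure M {\<omega> \<in> space M. L0 S C X \<omega> < \<infinity> \<and>
          rate S C X h g \<omega> \<ge> 0 \<and> harvested S C X h g \<omega> \<ge> Qs}) at_top"
proof (rule tendsto_at_topI_sequentially)
  fix \<gamma> :: "nat \<Rightarrow> real" assume \<gamma>: "filterlim \<gamma> at_top sequentially"
  let ?E = "{\<omega> \<in> space M. L0 S C X \<omega> < \<infinity> \<and> rate S C X h g \<omega> \<ge> 0 \<and> harvested S C X h g \<omega> \<ge> Qs}"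
  let ?F = "\<lambda>n. {\<omega> \<in> space M. L \<omega> < \<infinity> \<and> q / tx_power S + (- 1) * g \<omega> / Y \<omega> \<le> I \<omega> \<and> I \<omega> \<le> - v / tx_power S + \<gamma> n * g \<omega> / Y \<omega>}"
  have B: "0 < B_c S" and P: "0 < tx_power S" using valid by (auto simp: valid_network_def)
  have E: "?E \<in> events" and F: "?F n \<in> events" for n by measurable
  have "(\<lambda>n. \<integral>\<omega>. indicator (?F n) \<omega> \<partial>M) \<longlonglongrightarrow> (\<integral>\<omega>. indicator ?E \<omega> \<partial>M :: real)"
  proof (rule integral_dominated_convergence[where w = "\<lambda>_. 1"])
    show "AE \<omega> in M. (\<lambda>n. indicator (?F n) \<omega> :: real) \<longlonglongrightarrow> indicator ?E \<omega>"
      using AE_I_nonneg AE_gain_pos AE_L_pos AE_Y_pos AE_space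
    proof eventually_elim
      case (elim \<omega>)
      show ?case
      proof (cases "L \<omega> < \<infinity>")
        case True
        then have y: "0 < Y \<omega>" using elim by blast
        have "0 \<le> tx_power S * (g \<omega> / Y \<omega>) / (tx_power S * I \<omega> + v)"
          using elim y P noise_pos by (intro divide_nonneg_nonneg mult_nonneg_nonneg add_nonneg_nonneg) auto
        then have "0 \<le> log 2 (1 + tx_power S * (g \<omega> / Y \<omega>) / (tx_power S * I \<omega> + v))" by simp
        moreover have "rate S C X h g \<omega> = B_c S * log 2 (1 + tx_power S * (g \<omega> / Y \<omega>) / (tx_power S * I \<omega> + v))"
          unfolding rate_def rx_gain_finite[OF elim(3) True] v_def by (simp only: add.assoc)
        ultimately have rate0: "0 \<le> rate S C X h g \<omega>" using B by simp
        \<comment> \<open>The bound on \<gamma> comes from solving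
          \<open>I \<le> - v / P + \<gamma> * g / Y\<close> for \<gamma>.\<close>
        have "\<forall>\<^sub>F n in sequentially. (I \<omega> + v / tx_power S) * Y \<omega> / g \<omega> \<le> \<gamma> n"
          using \<gamma> by (simp add: filterlim_at_top)
        then have "\<forall>\<^sub>F n in sequentially. (indicator (?F n) \<omega> :: real) = indicator ?E \<omega>"
        proof eventually_elim
          case (elim n)
          then have "(I \<omega> + v / tx_power S) * Y \<omega> \<le> \<gamma> n * g \<omega>"
            using \<open>0 < g \<omega>\<close> by (simp add: pos_divide_le_eq)
          then have "I \<omega> + v / tx_power S \<le> \<gamma> n * g \<omega> / Y \<omega>"
            using y by (simp add: pos_le_divide_eq)
          then have "I \<omega> \<le> - v / tx_power S + \<gamma> n * g \<omega> / Y \<omega>" by simp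
          then show ?case
            using harvested_iff[OF \<open>0 < L \<omega>\<close> True, of Qs] rate0 True by (simp add: indicator_def q_def)
        qed
        then show ?thesis by (rule tendsto_eventually)
      qed (simp add: indicator_def)
    qed
  qed (use E F in \<open>auto simp: indicator_def\<close>)
  then have lim: "(\<lambda>n. prob (?F n)) \<longlonglongrightarrow> prob ?E" using E F by simp
  have "\<forall>\<^sub>F n in sequentially. 0 < \<gamma> n" using \<gamma> by (simp add: filterlim_at_top_dense)
  then have "\<forall>\<^sub>F n in sequentially. prob (?F n) = joint_ccdf_formula S a (\<gamma> n) q v"
  proof eventually_elim
    case (elim n)
    show ?case
      using prob_service_event_eq[OF energy_nonneg noise_pos elim]
      unfolding service_event_def[OF energy_nonneg noise_pos elim] .
  qed
  then show "(\<lambda>n. joint_ccdf_formula S a (\<gamma> n) q v) \<longlonglongrightarrow> prob ?E"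
    by (rule Lim_transform_eventually[OF lim])
qed

end

end

theorem proposition3:
  fixes S :: network and M :: "'w measure"
    and C :: "nat \<Rightarrow> 'w \<Rightarrow> nat" and X :: "nat \<Rightarrow> nat \<Rightarrow> 'w \<Rightarrow> complex"
    and h :: "nat \<Rightarrow> nat \<Rightarrow> 'w \<Rightarrow> real" and g :: "'w \<Rightarrow> real"
    and a :: "nat \<Rightarrow> nat \<Rightarrow> real" and Rs Qs q v :: real
  assumes model: "network_model S M C X h g"
    and cdf_L0: "\<And>\<alpha>. 0 \<le> \<alpha> \<Longrightarrow>
      measure M {\<omega> \<in> space M. L0 S C X \<omega> \<le> ennreal \<alpha>} =
        1 - (\<Prod>N. if enat N \<le> N_max S then exp (- Lam_N S N \<alpha>) else 1)"
    \<comment> \<open>conditional distribution function of the interference (Gil-Pelaez inversion);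
        \<open>0\<close> is an atom of the conditional law\<close>
    and cdf_I_MU: "\<And>z. z \<noteq> 0 \<Longrightarrow> AE \<omega> in M. L0 S C X \<omega> < \<infinity> \<longrightarrow>
      ((\<lambda>w. 1 / (pi * w) *
            Im (exp (- \<i> * of_real (w * z)) * Phi S w (enn2real (L0 S C X \<omega>))))
        has_integral
          (1/2 - real_cond_exp M (vimage_algebra (space M) (L0 S C X) borel)
                   (indicator {\<omega> \<in> space M. I_MU S C X h \<omega> \<le> z}) \<omega>)) {0<..}"
    and pdf_g_nonneg: "\<And>\<zeta>. 0 \<le> \<zeta> \<Longrightarrow> 0 \<le> gain_density S a \<zeta>"
    and pdf_g: "distributed M lborel g
      (\<lambda>\<zeta>. ennreal (if 0 \<le> \<zeta> then gain_density S a \<zeta> else 0))"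
    and Rs: "0 \<le> Rs" and Qs: "0 \<le> Qs"
    and q: "q = Qs / (rho S * xi S)"
    and v: "v = var_n S + var_c S / (1 - rho S)"
  shows "(0 < Rs \<longrightarrow>
      measure M {\<omega> \<in> space M. rate S C X h g \<omega> \<ge> Rs \<and> harvested S C X h g \<omega> \<ge> Qs} =
        joint_ccdf_formula S a (1 / (2 powr (Rs / B_c S) - 1)) q v) \<and>
    (Rs = 0 \<longrightarrow>
      ((\<lambda>\<gamma>. joint_ccdf_formula S a \<gamma> q v) \<longlongrightarrow>
        measure M {\<omega> \<in> space M. L0 S C X \<omega> < \<infinity> \<and>
          rate S C X h g \<omega> \<ge> Rs \<and> harvested S C X h g \<omega> \<ge> Qs}) at_top)"
    \<comment> \<open>for \<open>Rs = 0\<close> the parameter \<open>\<gamma>\<close> is infinite and the formula is read as a limit; the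
        condition on \<open>L0\<close> matters only for \<open>Qs = 0\<close>\<close>
proof -
  interpret prob_space M using model by (simp add: network_model_def)
  interpret network_params S by unfold_locales (use model in \<open>simp add: network_model_def\<close>)
  interpret network_link S M C X h g a
    by unfold_locales (fact model cdf_L0 cdf_I_MU pdf_g_nonneg pdf_g)+
  show ?thesis
    using prob_rate_energy_pos[OF Qs q v] prob_rate_energy_0[OF Qs q v] by blast
qed

end
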